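(* Let $1\le p\le 2$, let $H$ be a complex Hilbert space, let $n\ge 1$, and let $P_1,\dots,P_n$ be continuous homogeneous polynomials on $\mathcal S_p(H)$ of degrees $k_1,\dots,k_n$ respectively. If $\mathbf k=k_1+\cdots+k_n$, then $$\|P_1\cdots P_n\|_{\mathcal P(^{\mathbf k}\mathcal S_p(H))} \ge \left(\frac{\prod_{i=1}^{n} k_i^{k_i}}{\mathbf k^{\mathbf k}}\right)^{1/p} \|P_1\|_{\mathcal P(^{k_1}\mathcal S_p(H))} \cdots \|P_n\|_{\mathcal P(^{k_n}\mathcal S_p(H))}.$$ Moreover, the constant $\left(\prod_{i=1}^{n} k_i^{k_i}/\mathbf k^{\mathbf k}\right)^{1/p}$ is optimal provided that $\dim(H)\ge n$.
   Context: $\mathcal S_p(H)$ is the $p$-Schatten class of operators on the Hilbert space $H$, i.e. the compact operators $s$ on $H$ whose sequence of singular values lies in $\ell_p$, normed by the $\ell_p$-norm of that sequence. For a complex Banach space $X$ and an integer $k\ge 1$, a continuous $k$-homogeneous polynomial (homogeneous polynomial of degree $k$) on $X$ is a map $P:X\to\mathbb C$ for which there is a continuous $k$-linear map $T:X\times\cdots\times X\to\mathbb C$ with $P(x)=T(x,\dots,x)$ for all $x\in X$. The space $\mathcal P(^kX)$ of such maps carries the norm $\|P\|_{\mathcal P(^kX)}=\sup_{\|z\|_X=1}|P(z)|$. The product $P_1\cdots P_n$ is the pointwise product. "The constant is optimal" means that, for the given degrees $k_1,\dots,k_n$, the inequality for all continuous homogeneous polynomials $P_1,\dots,P_n$ of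 these degrees on the space fails if the constant is replaced by any larger one. *)

theory Defs
  imports "HOL-Analysis.Analysis"
begin

section \<open>Complex Hilbert spaces\<close>

class complex_vector = real_vector +
  fixes scaleC :: "complex \<Rightarrow> 'a \<Rightarrow> 'a"  (infixr \<open>*\<^sub>C\<close> 75)
  assumes scaleC_add_right: "a *\<^sub>C (x + y) = a *\<^sub>C x + a *\<^sub>C y"
    and scaleC_add_left: "(a + b) *\<^sub>C x = a *\<^sub>C x + b *\<^sub>C x"
    and scaleC_scaleC: "a *\<^sub>C b *\<^sub>C x = (a * b) *\<^sub>C x"
    and scaleC_of_real: "complex_of_real r *\<^sub>C x = r *\<^sub>R x"

class complex_normed_vector = complex_vector + real_normed_vector +
  assumes norm_scaleC: "norm (a *\<^sub>C x) = cmod a * norm x"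

text \<open>
  The inner product is linear in its first argument. The underlying real Hilbert space is the
  library's, with the real part as inner product, so \<open>norm x = sqrt (Re (cinner x x))\<close>.
\<close>

class complex_hilbert_space = complex_normed_vector + real_inner + complete_space +
  fixes cinner :: "'a \<Rightarrow> 'a \<Rightarrow> complex"
  assumes cinner_commute: "cinner x y = cnj (cinner y x)"
    and cinner_add_left: "cinner (x + y) z = cinner x z + cinner y z"
    and cinner_scaleC_left: "cinner (a *\<^sub>C x) y = a * cinner x y"
    and inner_eq_Re_cinner: "inner x y = Re (cinner x y)"

global_interpretation complex_vector: vector_space "scaleC :: complex \<Rightarrow> 'a \<Rightarrow> 'a :: complex_vector"
  defines cdependent_raw_def: cdependent = complex_vector.dependent
    and cspan_raw_def: cspan = complex_vector.span
    and cdim_raw_def: cdim = complex_vector.dim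
proof
  show "1 *\<^sub>C x = x" for x :: 'a
    using scaleC_of_real[of 1 x] by simp
qed (rule scaleC_add_right scaleC_add_left scaleC_scaleC)+

text \<open>The dimension of the whole space (possibly infinite) is at least \<open>n\<close>.\<close>

definition cdim_at_least :: "'h::complex_vector itself \<Rightarrow> nat \<Rightarrow> bool" where
  "cdim_at_least _ n \<longleftrightarrow> (\<exists>B :: 'h set. finite B \<and> card B = n \<and> \<not> cdependent B)"

section \<open>Schatten classes\<close>

text \<open>
  The type \<open>'h \<Rightarrow>\<^sub>L 'h\<close> consists of the bounded real-linear maps, with the operator norm;
  complex linearity is required separately.
\<close>

lemma bounded_linear_scaleC:
  "bounded_linear (\<lambda>x :: 'a::complex_normed_vector. a *\<^sub>C x)"
proof (rule bounded_linear_intro[where K = "cmod a"])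
  show "a *\<^sub>C (x + y) = a *\<^sub>C x + a *\<^sub>C y" for x y :: 'a
    by (rule scaleC_add_right)
  show "a *\<^sub>C (r *\<^sub>R x) = r *\<^sub>R (a *\<^sub>C x)" for r and x :: 'a
    by (metis scaleC_of_real scaleC_scaleC mult.commute)
  show "norm (a *\<^sub>C x) \<le> norm x * cmod a" for x :: 'a
    by (simp add: norm_scaleC)
qed

instantiation blinfun :: (real_normed_vector, complex_normed_vector) complex_vector
begin

definition scaleC_blinfun :: "complex \<Rightarrow> ('a \<Rightarrow>\<^sub>L 'b) \<Rightarrow> ('a \<Rightarrow>\<^sub>L 'b)" where
  "scaleC_blinfun a S = Blinfun (\<lambda>x. a *\<^sub>C blinfun_apply S x)"

lemma scaleC_blinfun_apply [simp]:
  "blinfun_apply (a *\<^sub>C S) x = a *\<^sub>C blinfun_apply S x"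
  unfolding scaleC_blinfun_def
  by (simp add: bounded_linear_Blinfun_apply
      bounded_linear_compose[OF bounded_linear_scaleC blinfun.bounded_linear_right])

instance
  by standard
    (auto intro!: blinfun_eqI
      simp: blinfun.add_left blinfun.scaleR_left scaleC_add_right scaleC_add_left
        scaleC_scaleC scaleC_of_real)

end

definition complex_linear_op :: "('h::complex_normed_vector \<Rightarrow>\<^sub>L 'h) \<Rightarrow> bool" where
  "complex_linear_op S \<longleftrightarrow> (\<forall>a x. blinfun_apply S (a *\<^sub>C x) = a *\<^sub>C blinfun_apply S x)"

definition compact_op :: "('h::real_normed_vector \<Rightarrow>\<^sub>L 'h) \<Rightarrow> bool" where
  "compact_op S \<longleftrightarrow> compact (closure (blinfun_apply S ` cball 0 1))"

definition cadjoint :: "('h::complex_hilbert_space \<Rightarrow>\<^sub>L 'h) \<Rightarrow> ('h \<Rightarrow>\<^sub>L 'h)" where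
  "cadjoint S = (THE S'. \<forall>x y. cinner (blinfun_apply S x) y = cinner x (blinfun_apply S' y))"

text \<open>
  The singular values of a compact operator \<open>S\<close> are the square roots of the eigenvalues of
  \<open>S\<^sup>*S\<close>, in nonincreasing order and repeated according to multiplicity. Only the nonzero ones
  are counted; if there are finitely many of them, the sequence is continued by zeros.
\<close>

definition singular_values :: "('h::complex_hilbert_space \<Rightarrow>\<^sub>L 'h) \<Rightarrow> nat \<Rightarrow> real" where
  "singular_values S = (THE s. antimono s \<and> s \<longlonglongrightarrow> 0 \<and>
     (\<forall>\<sigma>>0. card {j. s j = \<sigma>} =
        cdim {x. blinfun_apply (cadjoint S) (blinfun_apply S x) = \<sigma>\<^sup>2 *\<^sub>R x}))"

definition schatten_class :: "real \<Rightarrow> ('h::complex_hilbert_space \<Rightarrow>\<^sub>L 'h) set" where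
  "schatten_class p = {S. complex_linear_op S \<and> compact_op S \<and>
     summable (\<lambda>j. singular_values S j powr p)}"

definition schatten_norm :: "real \<Rightarrow> ('h::complex_hilbert_space \<Rightarrow>\<^sub>L 'h) \<Rightarrow> real" where
  "schatten_norm p S = (\<Sum>j. singular_values S j powr p) powr (1 / p)"

section \<open>Continuous homogeneous polynomials\<close>

text \<open>
  A complex normed space is given by a complex subspace \<open>X\<close> of the ambient type together with a
  norm \<open>N\<close> on it (not the norm of the ambient type). A \<open>k\<close>-tuple in \<open>X\<close> is an element
  of \<open>{..<k} \<rightarrow>\<^sub>E X\<close>.
\<close>

definition multilinear_on :: "'a::complex_vector set \<Rightarrow> nat \<Rightarrow> ((nat \<Rightarrow> 'a) \<Rightarrow> complex) \<Rightarrow> bool" where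
  "multilinear_on X k T \<longleftrightarrow>
     (\<forall>x \<in> {..<k} \<rightarrow>\<^sub>E X. \<forall>i<k. \<forall>u\<in>X. \<forall>v\<in>X. \<forall>a.
        T (x(i := u + v)) = T (x(i := u)) + T (x(i := v)) \<and>
        T (x(i := a *\<^sub>C u)) = a * T (x(i := u)))"

definition continuous_tuple_map ::
  "'a::complex_vector set \<Rightarrow> ('a \<Rightarrow> real) \<Rightarrow> nat \<Rightarrow> ((nat \<Rightarrow> 'a) \<Rightarrow> complex) \<Rightarrow> bool" where
  "continuous_tuple_map X N k T \<longleftrightarrow>
     (\<forall>x \<in> {..<k} \<rightarrow>\<^sub>E X. \<forall>\<epsilon>>0. \<exists>\<delta>>0. \<forall>y \<in> {..<k} \<rightarrow>\<^sub>E X.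
        (\<forall>i<k. N (y i - x i) < \<delta>) \<longrightarrow> cmod (T y - T x) < \<epsilon>)"

definition homogeneous_polynomial ::
  "'a::complex_vector set \<Rightarrow> ('a \<Rightarrow> real) \<Rightarrow> nat \<Rightarrow> ('a \<Rightarrow> complex) \<Rightarrow> bool" where
  "homogeneous_polynomial X N k P \<longleftrightarrow>
     (\<exists>T. multilinear_on X k T \<and> continuous_tuple_map X N k T \<and>
        (\<forall>x\<in>X. P x = T (\<lambda>i\<in>{..<k}. x)))"

text \<open>
  The element \<open>0\<close> is inserted only for \<open>X = {0}\<close>, where the unit sphere is empty and the
  supremum (in the nonnegative reals) is \<open>0\<close>.
\<close>

definition polynomial_norm ::
  "'a::complex_vector set \<Rightarrow> ('a \<Rightarrow> real) \<Rightarrow> ('a \<Rightarrow> complex) \<Rightarrow> real" where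
  "polynomial_norm X N P = Sup (insert 0 {cmod (P z) | z. z \<in> X \<and> N z = 1})"

end

theory Submission
  imports Defs "HOL-Complex_Analysis.Conformal_Mappings"
begin

text \<open>
  Choose unit vectors \<open>x i\<close> at which \<open>P i\<close> almost attains its norm and put
  \<open>r i = (k i / K) powr (1 / p)\<close>. The potential \<open>\<bar>P 1 y\<bar> \<cdots> \<bar>P m y\<bar> exp (- (K / p) N y powr p)\<close>
  can be kept above \<open>\<Prod>i\<le>m. \<bar>P i (r i x i)\<bar> exp (- (K / p) r i powr p)\<close> while the vectors
  \<open>r i x i\<close> are added one after the other to \<open>y\<close>, each multiplied by a suitable unimodular number:
  this is the maximum principle combined with Clarkson's inequality
  \<open>N (x + y) powr p + N (x - y) powr p \<le> 2 (N x powr p + N y powr p)\<close>. Normalising the last \<open>y\<close>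
  and using \<open>t \<le> exp (t - 1)\<close> gives the constant.

  Clarkson's inequality for \<open>p \<le> 2\<close> is proved by comparing, in an orthonormal family \<open>f i\<close>
  diagonalising \<open>C = S\<^sup>* S + T\<^sup>* T\<close>, the sums \<open>\<Sum>i. norm ((S \<plusminus> T) (f i)) powr p\<close>, which dominate
  \<open>N (S \<plusminus> T) powr p\<close>, with the trace of \<open>C powr (p / 2)\<close>, which is at most
  \<open>N S powr p + N T powr p\<close>.

  The constant is attained by the powers of the diagonal coefficients
  \<open>P i S = \<langle>S e i, e i\<rangle> ^ k i\<close> for orthonormal \<open>e 1, \<dots>, e n\<close>, because
  \<open>\<Sum>i. \<bar>\<langle>S e i, e i\<rangle>\<bar> powr p \<le> N S powr p\<close>.
\<close>

section \<open>Positive sesquilinear forms\<close>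

text \<open>Clarkson's inequality bounds only the average of \<open>N (y + w x) powr p\<close> and
  \<open>N (y - w x) powr p\<close>, so the norm alone does not tell which sign to take. The
  exponential turns this average into a product of two factors, the form in which the maximum
  principle speaks of a polynomial at \<open>w\<close> and \<open>- w\<close>, and one of the signs
  then serves both purposes. The exponent \<open>K / p\<close> is the one for which
  \<open>t ^ K * exp (- (K / p) * t powr p)\<close> is largest at \<open>t = 1\<close>, so that
  normalising the last \<open>y\<close> can only increase the potential. The radius
  \<open>r i\<close> maximises the same expression with \<open>t ^ k i\<close> in place of
  \<open>t ^ K\<close>, and the constant is the product of the \<open>r i ^ k i\<close>. On the
  operator side, powers and inverses of operators occur only as weighted sums over eigenvectors of
  positive semidefinite forms. One calculus of such forms serves the inner product, the form of an
  operator, the sum \<open>C\<close> and the rank one form of a functional. The adjoint enters only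
  to unfold the definition of the singular values.\<close>

locale pos_form =
  fixes B :: "'a::complex_vector \<Rightarrow> 'a \<Rightarrow> complex"
  assumes commute: "B x y = cnj (B y x)"
    and add_left: "B (x + y) z = B x z + B y z"
    and scale_left: "B (a *\<^sub>C x) y = a * B x y"
    and Re_self_nonneg: "0 \<le> Re (B x x)"
begin

lemma add_right: "B x (y + z) = B x y + B x z"
  by (metis add_left commute complex_cnj_add)

lemma scale_right: "B x (a *\<^sub>C y) = cnj a * B x y"
  by (metis scale_left commute complex_cnj_mult)

lemma zero_left [simp]: "B 0 y = 0"
  using scale_left[of 0 0 y] by simp

lemma zero_right [simp]: "B x 0 = 0"
  using commute[of x 0] by simp

lemma diff_left: "B (x - y) z = B x z - B y z"
  by (metis add_left diff_add_cancel add_diff_cancel_right')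

lemma diff_right: "B x (y - z) = B x y - B x z"
  by (metis add_right diff_add_cancel add_diff_cancel_right')

lemma sum_left: "B (\<Sum>i\<in>I. f i) y = (\<Sum>i\<in>I. B (f i) y)"
  by (induction I rule: infinite_finite_induct) (simp_all add: add_left)

lemma sum_right: "B x (\<Sum>i\<in>I. f i) = (\<Sum>i\<in>I. B x (f i))"
  by (induction I rule: infinite_finite_induct) (simp_all add: add_right)

definition quad :: "'a \<Rightarrow> real" where
  "quad x = Re (B x x)"

lemma quad_nonneg [simp]: "0 \<le> quad x"
  by (simp add: quad_def Re_self_nonneg)

lemma quad_zero [simp]: "quad 0 = 0"
  by (simp add: quad_def)

lemma self_eq: "B x x = of_real (quad x)"
  using commute[of x x] by (simp add: quad_def complex_eq_iff)

lemma quad_add: "quad (x + y) = quad x + quad y + 2 * Re (B x y)"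
  using arg_cong[OF commute[of y x], of Re] by (simp add: quad_def add_left add_right)

lemma quad_diff: "quad (x - y) = quad x + quad y - 2 * Re (B x y)"
  using arg_cong[OF commute[of y x], of Re] by (simp add: quad_def diff_left diff_right)

lemma quad_scale: "quad (a *\<^sub>C x) = (cmod a)\<^sup>2 * quad x"
proof -
  have "B (a *\<^sub>C x) (a *\<^sub>C x) = a * cnj a * B x x"
    by (simp add: scale_left scale_right)
  also have "\<dots> = of_real ((cmod a)\<^sup>2 * quad x)"
    unfolding self_eq using complex_norm_square[of a] by simp
  finally show ?thesis
    unfolding quad_def by simp
qed

lemma parallelogram: "quad (x + y) + quad (x - y) = 2 * quad x + 2 * quad y"
  by (simp add: quad_add quad_diff)

lemma cauchy_schwarz: "(cmod (B x y))\<^sup>2 \<le> quad x * quad y"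
proof -
  define b where "b = B x y"
  \<comment> \<open>The factor \<open>b\<close> rotates \<open>y\<close> so that the mixed term
    becomes real; what results is a real quadratic in \<open>t\<close> that is never
    negative.\<close>
  have ex: "0 \<le> quad x - 2 * t * (cmod b)\<^sup>2 + t\<^sup>2 * (cmod b)\<^sup>2 * quad y" for t
  proof -
    have "0 \<le> quad (x - (of_real t * b) *\<^sub>C y)"
      by simp
    also have "\<dots> = quad x - 2 * t * (cmod b)\<^sup>2 + t\<^sup>2 * (cmod b)\<^sup>2 * quad y"
      unfolding quad_diff quad_scale scale_right
      by (simp add: b_def[symmetric] norm_mult power_mult_distrib cmod_power2
          power2_eq_square[of "Re b"] power2_eq_square[of "Im b"] algebra_simps)
    finally show ?thesis .
  qed
  show ?thesis
  proof (cases "quad y = 0")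
    case True
    show ?thesis
    proof (rule ccontr)
      assume "\<not> ?thesis"
      then have "(cmod b)\<^sup>2 > 0" using True b_def by simp
      \<comment> \<open>With \<open>quad y = 0\<close> the quadratic is affine in \<open>t\<close>,
        and this \<open>t\<close> gives it the value \<open>-1\<close>.\<close>
      with ex[of "(quad x + 1) / (2 * (cmod b)\<^sup>2)"] True show False
        by simp
    qed
  next
    case False
    then have "quad y > 0" using quad_nonneg[of y] by linarith
    with ex[of "1 / quad y"] have "0 \<le> quad x - (cmod b)\<^sup>2 / quad y"
      by (simp add: power2_eq_square)
    with \<open>quad y > 0\<close> show ?thesis
      by (simp add: b_def field_simps)
  qed
qed

lemma cauchy_schwarz': "cmod (B x y) \<le> sqrt (quad x) * sqrt (quad y)"
  using cauchy_schwarz[of x y] by (metis real_le_rsqrt real_sqrt_mult)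

end

interpretation cinner: pos_form "cinner :: 'a::complex_hilbert_space \<Rightarrow> 'a \<Rightarrow> complex"
  rewrites "cinner.quad = (\<lambda>x::'a. (norm x)\<^sup>2)"
proof -
  show p: "pos_form (cinner :: 'a \<Rightarrow> 'a \<Rightarrow> complex)"
    by unfold_locales
      (auto intro: cinner_commute simp: cinner_add_left cinner_scaleC_left simp flip: inner_eq_Re_cinner)
  show "pos_form.quad cinner = (\<lambda>x::'a. (norm x)\<^sup>2)"
    by (simp add: fun_eq_iff pos_form.quad_def[OF p] power2_norm_eq_inner inner_eq_Re_cinner)
qed

lemma cinner_cauchy_schwarz: "cmod (cinner x y) \<le> norm x * norm y"
  using cinner.cauchy_schwarz'[of x y] by simp

lemma bounded_bilinear_cinner: "bounded_bilinear (cinner :: 'a::complex_hilbert_space \<Rightarrow> 'a \<Rightarrow> complex)"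
proof
  show "cinner (r *\<^sub>R a) b = r *\<^sub>R cinner a b" for r and a b :: 'a
    using cinner_scaleC_left[of "of_real r" a b] by (simp add: scaleC_of_real scaleR_conv_of_real)
  show "cinner a (r *\<^sub>R b) = r *\<^sub>R cinner a b" for r and a b :: 'a
    using cinner.scale_right[of a "of_real r" b] by (simp add: scaleC_of_real scaleR_conv_of_real)
  show "\<exists>K. \<forall>a b :: 'a. norm (cinner a b) \<le> norm a * norm b * K"
    using cinner_cauchy_schwarz by (metis mult.right_neutral)
qed (simp_all add: cinner.add_left cinner.add_right)

lemmas tendsto_cinner [tendsto_intros] = bounded_bilinear.tendsto[OF bounded_bilinear_cinner]

lemma cinner_ext: "(\<And>y. cinner x y = cinner x' y) \<Longrightarrow> x = x'"
  using cinner.self_eq[of "x - x'"] by (simp add: cinner.diff_left)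

lemma cinner_ext_right: "(\<And>y. cinner y x = cinner y x') \<Longrightarrow> x = x'"
  by (metis cinner_ext cinner_commute)


section \<open>The spectral theorem for compact forms\<close>

text \<open>Compactness is expressed as a Cauchy subsequence for the seminorm
  \<open>sqrt (quad x)\<close>. That seminorm may be degenerate and incomplete, so no limit is asked
  for in it; limits are found later in the norm of the space.\<close>

locale compact_form = pos_form B for B :: "'h::complex_hilbert_space \<Rightarrow> 'h \<Rightarrow> complex" +
  assumes bounded: "\<exists>M. \<forall>x. quad x \<le> M * (norm x)\<^sup>2"
    and compact_ball: "\<And>x :: nat \<Rightarrow> 'h. (\<And>n. norm (x n) \<le> 1) \<Longrightarrow>
      \<exists>r :: nat \<Rightarrow> nat. strict_mono r \<and>
        (\<forall>\<epsilon>>0. \<exists>n0. \<forall>m\<ge>n0. \<forall>n\<ge>n0. Re (B (x (r m) - x (r n)) (x (r m) - x (r n))) < \<epsilon>)"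
begin

lemma quad_continuous:
  assumes "x \<longlonglongrightarrow> v"
  shows "(\<lambda>n. quad (x n)) \<longlonglongrightarrow> quad v"
proof -
  obtain M where M: "\<And>x. quad x \<le> M * (norm x)\<^sup>2" using bounded by blast
  have z: "(\<lambda>n. quad (x n - v)) \<longlonglongrightarrow> 0"
  proof (rule Lim_null_comparison)
    have "(\<lambda>n. M * (norm (x n - v))\<^sup>2) \<longlonglongrightarrow> M * (norm (v - v))\<^sup>2"
      by (intro tendsto_intros assms)
    then show "(\<lambda>n. M * (norm (x n - v))\<^sup>2) \<longlonglongrightarrow> 0" by simp
    show "\<forall>\<^sub>F n in sequentially. norm (quad (x n - v)) \<le> M * (norm (x n - v))\<^sup>2"
      by (intro always_eventually allI) (simp add: M)
  qed
  have "(\<lambda>n. B (x n - v) v) \<longlonglongrightarrow> 0"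
  proof (rule Lim_null_comparison)
    have "(\<lambda>n. sqrt (quad (x n - v)) * sqrt (quad v)) \<longlonglongrightarrow> sqrt 0 * sqrt (quad v)"
      by (intro tendsto_intros z)
    then show "(\<lambda>n. sqrt (quad (x n - v)) * sqrt (quad v)) \<longlonglongrightarrow> 0" by simp
  qed (use cauchy_schwarz' in auto)
  then have "(\<lambda>n. quad (x n - v) + quad v + 2 * Re (B (x n - v) v)) \<longlonglongrightarrow> 0 + quad v + 2 * Re 0"
    by (intro tendsto_intros z)
  then show ?thesis
    using quad_add[of "x n - v" v for n] by simp
qed

definition perp :: "'h set \<Rightarrow> 'h set" where
  "perp L = {x. \<forall>v\<in>L. cinner x v = 0}"

lemma perp_add: "x \<in> perp L \<Longrightarrow> y \<in> perp L \<Longrightarrow> x + y \<in> perp L"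
  by (simp add: perp_def cinner.add_left)

lemma perp_scale: "x \<in> perp L \<Longrightarrow> a *\<^sub>C x \<in> perp L"
  by (simp add: perp_def cinner.scale_left)

lemma zero_in_perp [simp]: "0 \<in> perp L"
  by (simp add: perp_def)

text \<open>The largest Rayleigh quotient on the complement. The ball replaces the sphere so that a
  trivial complement gives \<open>0\<close> and not a supremum over the empty set.\<close>

definition top_value :: "'h set \<Rightarrow> real" where
  "top_value L = Sup (quad ` (perp L \<inter> cball 0 1))"

lemma bdd_above_quad: "bdd_above (quad ` (perp L \<inter> cball 0 1))"
proof -
  obtain M where M: "\<And>x. quad x \<le> M * (norm x)\<^sup>2" using bounded by blast
  have "quad x \<le> \<bar>M\<bar>" if "norm x \<le> 1" for x
  proof -
    have "quad x \<le> \<bar>M\<bar> * (norm x)\<^sup>2"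
      using M[of x] by (smt (verit) mult_right_mono zero_le_power2)
    also have "\<dots> \<le> \<bar>M\<bar> * 1\<^sup>2" using that by (intro mult_left_mono power_mono) auto
    finally show ?thesis by simp
  qed
  then show ?thesis by (auto intro!: bdd_aboveI)
qed

lemma top_value_nonneg: "0 \<le> top_value L"
proof -
  have "quad 0 \<in> quad ` (perp L \<inter> cball 0 1)" by (intro imageI) simp
  from cSup_upper[OF this bdd_above_quad] show ?thesis by (simp add: top_value_def)
qed

lemma quad_le_top_value:
  assumes "x \<in> perp L"
  shows "quad x \<le> top_value L * (norm x)\<^sup>2"
proof (cases "x = 0")
  case False
  define u where "u = complex_of_real (1 / norm x) *\<^sub>C x"
  have "norm u = 1" using False by (simp add: u_def norm_scaleC norm_divide)
  then have "u \<in> perp L \<inter> cball 0 1"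
    using assms perp_scale by (auto simp: u_def)
  then have "quad u \<le> top_value L"
    unfolding top_value_def by (intro cSup_upper bdd_above_quad imageI)
  moreover have "quad u = quad x / (norm x)\<^sup>2"
    by (simp add: u_def quad_scale norm_divide power_divide)
  ultimately show ?thesis using False by (simp add: field_simps)
qed simp

text \<open>A maximising sequence has a subsequence that is Cauchy in norm: the parallelogram laws
  of \<open>B\<close> and of the inner product, with the bound
  \<open>quad x \<le> c * (norm x)^2\<close> on the complement, estimate the norm distance of two
  near maximisers by their seminorm distance, and compactness makes the latter small.\<close>

lemma maximizer_exists:
  assumes "0 < top_value L"
  shows "\<exists>g \<in> perp L. norm g = 1 \<and> quad g = top_value L"
proof -
  define c where "c = top_value L"
  have "c > 0" using assms by (simp add: c_def)
  have "\<exists>x. x \<in> perp L \<and> norm x \<le> 1 \<and> quad x > c - 1 / real (Suc m)" for m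
  proof -
    have "quad ` (perp L \<inter> cball 0 1) \<noteq> {}"
      using zero_in_perp by fastforce
    moreover have "c - 1 / real (Suc m) < Sup (quad ` (perp L \<inter> cball 0 1))"
      by (simp add: c_def top_value_def)
    ultimately obtain y where "y \<in> quad ` (perp L \<inter> cball 0 1)" "c - 1 / real (Suc m) < y"
      using less_cSupE by metis
    then show ?thesis by auto
  qed
  then have "\<forall>m. \<exists>x. x \<in> perp L \<and> norm x \<le> 1 \<and> quad x > c - 1 / real (Suc m)"
    by blast
  from choice[OF this] obtain x where x: "\<And>m. x m \<in> perp L" "\<And>m. norm (x m) \<le> 1"
      "\<And>m. quad (x m) > c - 1 / real (Suc m)"
    by blast
  have "\<exists>r :: nat \<Rightarrow> nat. strict_mono r \<and>
      (\<forall>\<epsilon>>0. \<exists>n0. \<forall>m\<ge>n0. \<forall>n\<ge>n0. quad (x (r m) - x (r n)) < \<epsilon>)"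
    using compact_ball[of x, OF x(2)] by (simp only: quad_def)
  then obtain r where r: "strict_mono (r :: nat \<Rightarrow> nat)"
    and rc: "\<forall>\<epsilon>>0. \<exists>n0. \<forall>m\<ge>n0. \<forall>n\<ge>n0. quad (x (r m) - x (r n)) < \<epsilon>"
    by blast
  have lim: "(\<lambda>m. quad (x (r m))) \<longlonglongrightarrow> c"
  proof -
    have "(\<lambda>m. quad (x m)) \<longlonglongrightarrow> c"
    proof (rule real_tendsto_sandwich)
      show "(\<lambda>m. c - 1 / real (Suc m)) \<longlonglongrightarrow> c"
        using tendsto_diff[OF tendsto_const[of c] LIMSEQ_inverse_real_of_nat] by (simp add: inverse_eq_divide)
      have "quad (x m) \<le> c" for m
        unfolding c_def top_value_def
        by (intro cSup_upper bdd_above_quad imageI) (simp add: x(1,2))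
      then show "eventually (\<lambda>m. quad (x m) \<le> c) sequentially" by simp
      show "eventually (\<lambda>m. c - 1 / real (Suc m) \<le> quad (x m)) sequentially"
        using x(3) by (intro always_eventually allI less_imp_le)
      show "(\<lambda>m. c) \<longlonglongrightarrow> c" by simp
    qed
    from LIMSEQ_subseq_LIMSEQ[OF this r] show ?thesis by (simp add: o_def)
  qed
  have dist: "c * (norm (x m - x n))\<^sup>2 \<le> 4 * c - 2 * quad (x m) - 2 * quad (x n) + quad (x m - x n)" for m n
  proof -
    have sq: "(norm (x m))\<^sup>2 \<le> 1" for m
      using power_mono[OF x(2)[of m], of 2] by simp
    have "(norm (x m + x n))\<^sup>2 + (norm (x m - x n))\<^sup>2 \<le> 4"
      unfolding cinner.parallelogram using sq[of m] sq[of n] by linarith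
    then have "c * ((norm (x m + x n))\<^sup>2 + (norm (x m - x n))\<^sup>2) \<le> c * 4"
      using \<open>c > 0\<close> by (intro mult_left_mono) auto
    then have "c * (norm (x m + x n))\<^sup>2 + c * (norm (x m - x n))\<^sup>2 \<le> c * 4"
      by (simp only: distrib_left)
    moreover have "quad (x m + x n) \<le> c * (norm (x m + x n))\<^sup>2"
      unfolding c_def by (intro quad_le_top_value perp_add x)
    ultimately show ?thesis using parallelogram[of "x m" "x n"] by linarith
  qed
  have "Cauchy (x \<circ> r)"
  proof (rule metric_CauchyI)
    fix \<epsilon> :: real assume "\<epsilon> > 0"
    \<comment> \<open>\<open>5 = 2 + 2 + 1\<close>: a defect \<open>e\<close> in each of two values
      of \<open>quad\<close>, both entering \<open>dist\<close> twice, and \<open>e\<close> for the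
      seminorm distance.\<close>
    define e where "e = c * \<epsilon>\<^sup>2 / 5"
    have "e > 0" using \<open>c > 0\<close> \<open>\<epsilon> > 0\<close> by (simp add: e_def)
    obtain n0 where n0: "\<And>m n. m \<ge> n0 \<Longrightarrow> n \<ge> n0 \<Longrightarrow> quad (x (r m) - x (r n)) < e"
      using rc[rule_format, OF \<open>e > 0\<close>] by blast
    have "eventually (\<lambda>m. quad (x (r m)) > c - e) sequentially"
      using lim \<open>e > 0\<close> by (intro order_tendstoD(1)) auto
    then obtain n1 where n1: "\<And>m. m \<ge> n1 \<Longrightarrow> quad (x (r m)) > c - e"
      by (auto simp: eventually_sequentially)
    have "dist ((x \<circ> r) m) ((x \<circ> r) n) < \<epsilon>" if "m \<ge> max n0 n1" "n \<ge> max n0 n1" for m n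
    proof -
      have "c * (norm (x (r m) - x (r n)))\<^sup>2 < 5 * e"
        using dist[of "r m" "r n"] n0[of m n] n1[of m] n1[of n] that by simp
      also have "\<dots> = c * \<epsilon>\<^sup>2" by (simp add: e_def)
      finally have "(norm (x (r m) - x (r n)))\<^sup>2 < \<epsilon>\<^sup>2" using \<open>c > 0\<close> by simp
      then show ?thesis
        using \<open>\<epsilon> > 0\<close> by (auto simp: dist_norm intro: power2_less_imp_less)
    qed
    then show "\<exists>M. \<forall>m\<ge>M. \<forall>n\<ge>M. dist ((x \<circ> r) m) ((x \<circ> r) n) < \<epsilon>" by blast
  qed
  then obtain v where v: "(\<lambda>m. x (r m)) \<longlonglongrightarrow> v"
    using Cauchy_convergent by (auto simp: convergent_def o_def)
  have "cinner v l = 0" if "l \<in> L" for l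
  proof -
    have "(\<lambda>m. cinner (x (r m)) l) \<longlonglongrightarrow> cinner v l"
      by (intro tendsto_intros v)
    moreover have "cinner (x (r m)) l = 0" for m
      using x(1)[of "r m"] that by (simp add: perp_def)
    ultimately have "(\<lambda>m. 0) \<longlonglongrightarrow> cinner v l" by simp
    then show ?thesis by (simp add: LIMSEQ_const_iff)
  qed
  then have vL: "v \<in> perp L" by (simp add: perp_def)
  have q: "quad v = c"
    using LIMSEQ_unique[OF quad_continuous[OF v] lim] .
  have "norm v \<le> 1"
    using x(2) by (intro LIMSEQ_le_const2[OF tendsto_norm[OF v]]) auto
  moreover have "1 \<le> norm v"
  proof -
    have "c \<le> c * (norm v)\<^sup>2" using quad_le_top_value[OF vL] q by (simp add: c_def)
    then have "1 \<le> (norm v)\<^sup>2" using \<open>c > 0\<close> by simp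
    then show ?thesis using power2_le_imp_le[of 1 "norm v"] by simp
  qed
  ultimately show ?thesis using vL q c_def by force
qed

text \<open>The first variation of \<open>quad\<close> vanishes at a maximizer on the unit sphere.\<close>

lemma maximizer_eigen:
  assumes g: "g \<in> perp L" "norm g = 1" "quad g = top_value L"
    and h: "h \<in> perp L"
  shows "B g h = top_value L * cinner g h"
proof -
  define c where "c = top_value L"
  define b where "b = B g h - c * cinner g h"
  have key: "2 * t * (cmod b)\<^sup>2 \<le> t\<^sup>2 * (cmod b)\<^sup>2 * (c * (norm h)\<^sup>2)" for t
  proof -
    define w where "w = (of_real t * b) *\<^sub>C h"
    have "g + w \<in> perp L" unfolding w_def by (intro perp_add perp_scale g h)
    then have "quad g + quad w + 2 * Re (B g w) \<le> c * (norm g ^ 2 + norm w ^ 2 + 2 * Re (cinner g w))"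
      using quad_le_top_value[of "g + w" L] unfolding quad_add cinner.quad_add c_def by simp
    then have "2 * Re (B g w - c * cinner g w) \<le> c * (norm w)\<^sup>2"
      using quad_nonneg[of w] unfolding g(2,3) c_def[symmetric] by (simp add: distrib_left del: quad_nonneg)
    moreover have "Re (B g w - c * cinner g w) = t * (cmod b)\<^sup>2"
    proof -
      have "B g w - c * cinner g w = of_real t * (cnj b * b)"
        unfolding w_def scale_right cinner.scale_right b_def by (simp add: algebra_simps)
      also have "\<dots> = complex_of_real (t * (cmod b)\<^sup>2)"
        using complex_norm_square[of b] by (simp add: mult.commute)
      finally show ?thesis by (metis Re_complex_of_real)
    qed
    moreover have "c * (norm w)\<^sup>2 = t\<^sup>2 * (cmod b)\<^sup>2 * (c * (norm h)\<^sup>2)"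
      by (simp add: w_def norm_scaleC norm_mult power_mult_distrib)
    ultimately show ?thesis by linarith
  qed
  define d where "d = c * (norm h)\<^sup>2"
  have "d \<ge> 0" using top_value_nonneg[of L] by (simp add: d_def c_def)
  have "(cmod b)\<^sup>2 \<le> 0"
  proof (rule ccontr)
    assume "\<not> ?thesis"
    then have pos: "(cmod b)\<^sup>2 > 0" by simp
    \<comment> \<open>Any \<open>t > 0\<close> with \<open>t * d < 2\<close> contradicts
      \<open>key\<close>: near \<open>t = 0\<close> the linear gain beats the quadratic
      loss.\<close>
    define t where "t = 1 / (d + 1)"
    have t: "t > 0" "t * d \<le> 1" using \<open>d \<ge> 0\<close> by (simp_all add: t_def)
    have "(cmod b)\<^sup>2 * t * 2 \<le> (cmod b)\<^sup>2 * t * (t * d)"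
      using key[of t] unfolding d_def[symmetric] by (simp add: power2_eq_square mult_ac)
    then have "2 \<le> t * d" using pos t by simp
    with t show False by simp
  qed
  then show ?thesis by (simp add: b_def c_def)
qed


definition next_vec :: "'h set \<Rightarrow> 'h" where
  "next_vec L = (if 0 < top_value L
     then SOME g. g \<in> perp L \<and> norm g = 1 \<and> quad g = top_value L else 0)"

text \<open>Each vector depends on all earlier ones; carrying the whole list along makes this a
  primitive recursion.\<close>

primrec vecs :: "nat \<Rightarrow> 'h list" where
  "vecs 0 = []"
| "vecs (Suc n) = vecs n @ [next_vec (set (vecs n))]"

definition eigvec :: "nat \<Rightarrow> 'h" where
  "eigvec n = next_vec (set (vecs n))"

definition eigval :: "nat \<Rightarrow> real" where
  "eigval n = top_value (eigvec ` {..<n})"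

lemma set_vecs: "set (vecs n) = eigvec ` {..<n}"
  by (induction n) (auto simp: eigvec_def lessThan_Suc)

lemma eigval_nonneg: "0 \<le> eigval n"
  by (simp add: eigval_def top_value_nonneg)

lemma eigval_antimono: "antimono eigval"
proof
  fix m n :: nat assume "m \<le> n"
  then have "eigvec ` {..<m} \<subseteq> eigvec ` {..<n}" by (intro image_mono) auto
  then have "perp (eigvec ` {..<n}) \<subseteq> perp (eigvec ` {..<m})"
    unfolding perp_def by blast
  then show "eigval n \<le> eigval m"
    unfolding eigval_def top_value_def
    using zero_in_perp[of "eigvec ` {..<n}"]
    by (intro cSup_subset_mono bdd_above_quad) fastforce+
qed

lemma eigvec_props:
  shows "eigvec n \<in> perp (eigvec ` {..<n})"
    and "norm (eigvec n) = of_bool (0 < eigval n)"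
    and "quad (eigvec n) = eigval n"
proof -
  have ev: "eigvec n = (if 0 < eigval n
      then SOME g. g \<in> perp (eigvec ` {..<n}) \<and> norm g = 1 \<and> quad g = eigval n else 0)"
    unfolding eigvec_def[of n] next_vec_def set_vecs eigval_def by (rule refl)
  have "eigvec n \<in> perp (eigvec ` {..<n}) \<and> norm (eigvec n) = of_bool (0 < eigval n)
      \<and> quad (eigvec n) = eigval n"
  proof (cases "0 < eigval n")
    case True
    have "\<exists>g. g \<in> perp (eigvec ` {..<n}) \<and> norm g = 1 \<and> quad g = eigval n"
      using maximizer_exists[of "eigvec ` {..<n}"] True by (auto simp only: eigval_def)
    from someI_ex[OF this] show ?thesis using True ev by simp
  next
    case False
    then have "eigval n = 0" using eigval_nonneg[of n] by simp
    then show ?thesis using ev by simp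
  qed
  then show "eigvec n \<in> perp (eigvec ` {..<n})"
    and "norm (eigvec n) = of_bool (0 < eigval n)"
    and "quad (eigvec n) = eigval n" by blast+
qed

lemma eigvec_orth_less: "i < n \<Longrightarrow> cinner (eigvec n) (eigvec i) = 0"
  using eigvec_props(1)[of n] by (simp add: perp_def)

lemma eigvec_inner: "cinner (eigvec i) (eigvec j) = of_bool (i = j \<and> 0 < eigval i)"
proof (cases i j rule: linorder_cases)
  case less
  then show ?thesis using eigvec_orth_less[of i j] cinner_commute[of "eigvec i" "eigvec j"] by simp
next
  case equal
  then show ?thesis using cinner.self_eq[of "eigvec i"] eigvec_props(2)[of i] by simp
next
  case greater
  then show ?thesis using eigvec_orth_less[of j i] by simp
qed

text \<open>\<open>maximizer_eigen\<close> covers only \<open>h\<close> orthogonal to the earlier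
  vectors. A general \<open>h\<close> differs from such a vector by a combination \<open>p\<close>
  of earlier eigenvectors, and on \<open>p\<close> both sides vanish, by the induction hypothesis
  and by orthogonality.\<close>

lemma eigvec_eigen: "B (eigvec n) h = eigval n * cinner (eigvec n) h"
proof (induction n arbitrary: h rule: less_induct)
  case (less n)
  show ?case
  proof (cases "0 < eigval n")
    case False
    then have "eigvec n = 0" using eigvec_props(2)[of n] by simp
    then show ?thesis by simp
  next
    case True
    define p where "p = (\<Sum>i<n. cinner h (eigvec i) *\<^sub>C eigvec i)"
    have Bi: "B (eigvec n) (eigvec i) = 0" if "i < n" for i
      using less.IH[OF that, of "eigvec n"] that eigvec_inner[of i n] commute[of "eigvec n" "eigvec i"] by simp
    have Bp: "B (eigvec n) p = 0"
      by (simp add: p_def sum_right scale_right Bi)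
    have cp: "cinner (eigvec n) p = 0"
      by (simp add: p_def cinner.sum_right cinner.scale_right eigvec_inner)
    have "cinner (h - p) (eigvec j) = 0" if "j < n" for j
    proof -
      have "cinner p (eigvec j) = (\<Sum>i<n. if i = j then cinner h (eigvec j) * of_bool (0 < eigval j) else 0)"
        unfolding p_def cinner.sum_left cinner.scale_left eigvec_inner by (intro sum.cong) auto
      also have "\<dots> = cinner h (eigvec j) * of_bool (0 < eigval j)"
        using that by simp
      also have "\<dots> = cinner h (eigvec j)"
        using eigvec_props(2)[of j] by (cases "0 < eigval j") auto
      finally show ?thesis by (simp add: cinner.diff_left)
    qed
    then have "h - p \<in> perp (eigvec ` {..<n})" by (auto simp: perp_def)
    then have "B (eigvec n) (h - p) = eigval n * cinner (eigvec n) (h - p)"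
      using maximizer_eigen[of "eigvec n" "eigvec ` {..<n}" "h - p"] eigvec_props[of n] True
      unfolding eigval_def by simp
    then show ?thesis by (simp add: diff_right cinner.diff_right Bp cp)
  qed
qed

text \<open>Distinct eigenvectors are orthogonal also for \<open>B\<close>, so the squared seminorm
  distance of two of them is the sum of their eigenvalues. A positive limit \<open>d\<close> would
  keep it at least \<open>2 * d\<close> and leave no Cauchy subsequence.\<close>

lemma eigval_tendsto_zero: "eigval \<longlonglongrightarrow> 0"
proof -
  obtain d where d: "eigval \<longlonglongrightarrow> d" "\<And>n. d \<le> eigval n"
    using decseq_convergent[of eigval 0] eigval_antimono eigval_nonneg by auto
  have "d \<ge> 0" using LIMSEQ_le_const[OF d(1)] eigval_nonneg by auto
  moreover have "\<not> 0 < d"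
  proof
    assume "0 < d"
    have "norm (eigvec n) \<le> 1" for n using eigvec_props(2)[of n] by simp
    from compact_ball[of eigvec, OF this] \<open>0 < d\<close> obtain r :: "nat \<Rightarrow> nat" and n0
      where r: "strict_mono r" and n0: "\<forall>m\<ge>n0. \<forall>n\<ge>n0.
        Re (B (eigvec (r m) - eigvec (r n)) (eigvec (r m) - eigvec (r n))) < d"
      by blast
    have "r n0 \<noteq> r (Suc n0)" using r by (simp add: strict_mono_eq)
    then have "B (eigvec (r n0)) (eigvec (r (Suc n0))) = 0"
      by (simp add: eigvec_eigen eigvec_inner)
    then have "quad (eigvec (r n0) - eigvec (r (Suc n0))) = eigval (r n0) + eigval (r (Suc n0))"
      by (simp add: quad_diff eigvec_props)
    moreover have "quad (eigvec (r n0) - eigvec (r (Suc n0))) < d"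
      using n0 by (simp add: quad_def)
    ultimately show False using d(2)[of "r n0"] d(2)[of "r (Suc n0)"] \<open>0 < d\<close> by linarith
  qed
  ultimately show ?thesis using d(1) by simp
qed

lemma eigval_dominates: "(\<And>i. i < n \<Longrightarrow> cinner h (eigvec i) = 0) \<Longrightarrow> quad h \<le> eigval n * (norm h)\<^sup>2"
  unfolding eigval_def by (intro quad_le_top_value) (auto simp: perp_def)

end

text \<open>
  A diagonalisation of \<open>B\<close>. Vectors belonging to the value \<open>0\<close> are themselves \<open>0\<close>, so that
  sums over all indices can be used for forms of finite rank as well.
\<close>

locale spectral_form = pos_form B for B :: "'h::complex_hilbert_space \<Rightarrow> 'h \<Rightarrow> complex" +
  fixes l :: "nat \<Rightarrow> real" and g :: "nat \<Rightarrow> 'h"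
  assumes decr: "antimono l"
    and null: "l \<longlonglongrightarrow> 0"
    and orthonormal: "cinner (g i) (g j) = of_bool (i = j \<and> 0 < l i)"
    and eigen: "B (g j) h = l j * cinner (g j) h"
    and dominates: "(\<And>i. i < n \<Longrightarrow> cinner h (g i) = 0) \<Longrightarrow> Re (B h h) \<le> l n * (norm h)\<^sup>2"

theorem (in compact_form) spectral_theorem: "spectral_form B eigval eigvec"
  using eigval_antimono eigval_tendsto_zero eigvec_inner eigvec_eigen eigval_dominates
  by unfold_locales (auto simp: quad_def)

locale orthofamily =
  fixes g :: "nat \<Rightarrow> 'h::complex_hilbert_space"
  assumes orthonormal: "cinner (g i) (g j) = of_bool (i = j \<and> g i \<noteq> 0)"
begin

definition resid :: "nat \<Rightarrow> 'h \<Rightarrow> 'h" where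
  "resid n h = h - (\<Sum>i<n. cinner h (g i) *\<^sub>C g i)"

lemma resid_orth:
  assumes "j < n"
  shows "cinner (resid n h) (g j) = 0"
proof -
  have "cinner (\<Sum>i<n. cinner h (g i) *\<^sub>C g i) (g j)
      = (\<Sum>i<n. if i = j then cinner h (g j) * of_bool (g j \<noteq> 0) else 0)"
    unfolding cinner.sum_left cinner.scale_left orthonormal by (intro sum.cong) auto
  also have "\<dots> = cinner h (g j) * of_bool (g j \<noteq> 0)"
    using assms by simp
  also have "\<dots> = cinner h (g j)" by (cases "g j = 0") auto
  finally show ?thesis by (simp add: resid_def cinner.diff_left)
qed

lemma norm_decomp:
  "(norm h)\<^sup>2 = (\<Sum>i<n. (cmod (cinner h (g i)))\<^sup>2) + (norm (resid n h))\<^sup>2"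
proof -
  define r where "r = resid n h"
  have h: "h = r + (\<Sum>i<n. cinner h (g i) *\<^sub>C g i)"
    by (simp add: r_def resid_def)
  have "cinner r r = cinner r h - (\<Sum>i<n. cnj (cinner h (g i)) * cinner r (g i))"
    by (simp add: r_def resid_def cinner.diff_right cinner.sum_right cinner.scale_right)
  also have "\<dots> = cinner r h"
    by (simp add: r_def resid_orth)
  also have "\<dots> = cinner h h - (\<Sum>i<n. cinner h (g i) * cinner (g i) h)"
    by (simp add: r_def resid_def cinner.diff_left cinner.sum_left cinner.scale_left)
  also have "(\<Sum>i<n. cinner h (g i) * cinner (g i) h) = (\<Sum>i<n. of_real ((cmod (cinner h (g i)))\<^sup>2))"
  proof (rule sum.cong)
    show "cinner h (g i) * cinner (g i) h = of_real ((cmod (cinner h (g i)))\<^sup>2)" for i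
      using complex_norm_square[of "cinner h (g i)"] cinner_commute[of "g i" h] by simp
  qed simp
  finally have "complex_of_real ((norm r)\<^sup>2)
      = of_real ((norm h)\<^sup>2 - (\<Sum>i<n. (cmod (cinner h (g i)))\<^sup>2))"
    unfolding cinner.self_eq by simp
  then show ?thesis unfolding of_real_eq_iff r_def by linarith
qed

lemma bessel: "finite I \<Longrightarrow> (\<Sum>i\<in>I. (cmod (cinner h (g i)))\<^sup>2) \<le> (norm h)\<^sup>2"
proof -
  assume "finite I"
  then obtain n where "I \<subseteq> {..<n}" by (metis finite_nat_iff_bounded)
  then have "(\<Sum>i\<in>I. (cmod (cinner h (g i)))\<^sup>2) \<le> (\<Sum>i<n. (cmod (cinner h (g i)))\<^sup>2)"
    by (intro sum_mono2) auto
  also have "\<dots> \<le> (norm h)\<^sup>2" unfolding norm_decomp[of h n] by simp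
  finally show ?thesis .
qed

lemma norm_resid_le: "norm (resid n h) \<le> norm h"
  by (rule power2_le_imp_le) (simp_all add: norm_decomp[of h n] sum_nonneg)

lemma norm_family: "norm (g i) = of_bool (g i \<noteq> 0)"
proof (cases "g i = 0")
  case False
  then have "complex_of_real ((norm (g i))\<^sup>2) = complex_of_real 1"
    using orthonormal[of i i] cinner.self_eq[of "g i"] by simp
  then have "(norm (g i))\<^sup>2 = 1\<^sup>2" unfolding of_real_eq_iff by simp
  then have "norm (g i) = 1" by (subst (asm) power2_eq_iff_nonneg) simp_all
  with False show ?thesis by simp
qed simp

end

lemma orthonormal_set_independent:
  fixes E :: "'h::complex_hilbert_space set"
  assumes "finite E" and on: "\<And>u v. u \<in> E \<Longrightarrow> v \<in> E \<Longrightarrow> cinner u v = of_bool (u = v)"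
  shows "\<not> cdependent E"
proof
  assume "cdependent E"
  then obtain c v where v: "v \<in> E" "c v \<noteq> 0" and z: "(\<Sum>u\<in>E. c u *\<^sub>C u) = 0"
    unfolding complex_vector.dependent_finite[OF assms(1)] by blast
  have "cinner (\<Sum>u\<in>E. c u *\<^sub>C u) v = (\<Sum>u\<in>E. if u = v then c v else 0)"
    unfolding cinner.sum_left cinner.scale_left using v(1) on by (intro sum.cong) auto
  also have "\<dots> = c v" using v(1) assms(1) by simp
  finally show False using z v(2) by simp
qed

context spectral_form
begin

lemma g_nonzero_iff: "g i \<noteq> 0 \<longleftrightarrow> 0 < l i"
proof (cases "0 < l i")
  case True
  then show ?thesis using orthonormal[of i i] by (cases "g i = 0") auto
next
  case False
  then show ?thesis using orthonormal[of i i] cinner.self_eq[of "g i"] by simp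
qed

sublocale orthofamily g
  by unfold_locales (simp add: orthonormal g_nonzero_iff)

lemma l_nonneg: "0 \<le> l n"
  using decseq_ge[OF _ null] decr by simp

lemma quad_decomp:
  "quad h = (\<Sum>i<n. l i * (cmod (cinner h (g i)))\<^sup>2) + quad (resid n h)"
proof -
  define r where "r = resid n h"
  have rg: "B r (g i) = 0" if "i < n" for i
    using eigen[of i r] commute[of r "g i"] resid_orth[OF that, of h] cinner_commute[of "g i" r]
    by (simp add: r_def)
  have "B r r = B r h - (\<Sum>i<n. cnj (cinner h (g i)) * B r (g i))"
    unfolding r_def resid_def[of n h] diff_right sum_right scale_right by simp
  also have "\<dots> = B r h"
    by (simp add: rg)
  also have "\<dots> = B h h - (\<Sum>i<n. cinner h (g i) * B (g i) h)"
    by (simp add: r_def resid_def diff_left sum_left scale_left)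
  also have "(\<Sum>i<n. cinner h (g i) * B (g i) h) = (\<Sum>i<n. of_real (l i * (cmod (cinner h (g i)))\<^sup>2))"
  proof (rule sum.cong)
    show "cinner h (g i) * B (g i) h = of_real (l i * (cmod (cinner h (g i)))\<^sup>2)" for i
      using complex_norm_square[of "cinner h (g i)"] cinner_commute[of "g i" h] by (simp add: eigen)
  qed simp
  finally have "complex_of_real (quad r)
      = of_real (quad h - (\<Sum>i<n. l i * (cmod (cinner h (g i)))\<^sup>2))"
    unfolding self_eq by simp
  then show ?thesis unfolding of_real_eq_iff r_def by linarith
qed

lemma quad_resid_le: "quad (resid n h) \<le> l n * (norm h)\<^sup>2"
proof -
  have "quad (resid n h) \<le> l n * (norm (resid n h))\<^sup>2"
    unfolding quad_def by (rule dominates) (rule resid_orth)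
  also have "\<dots> \<le> l n * (norm h)\<^sup>2"
    by (intro mult_left_mono power_mono norm_resid_le) (simp_all add: l_nonneg)
  finally show ?thesis .
qed

lemma quad_resid_tendsto: "(\<lambda>n. quad (resid n h)) \<longlonglongrightarrow> 0"
proof (rule Lim_null_comparison)
  show "\<forall>\<^sub>F n in sequentially. norm (quad (resid n h)) \<le> l n * (norm h)\<^sup>2"
    by (intro always_eventually allI) (simp add: quad_resid_le)
  show "(\<lambda>n. l n * (norm h)\<^sup>2) \<longlonglongrightarrow> 0"
    by (rule tendsto_mult_left_zero[OF null])
qed

text \<open>The \<open>g i\<close> need not span the space: by \<open>dominates\<close> and
  \<open>null\<close> the form itself tends to \<open>0\<close> on the residuals.\<close>

lemma quad_sums: "(\<lambda>i. l i * (cmod (cinner h (g i)))\<^sup>2) sums quad h"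
proof -
  have "(\<lambda>n. quad h - quad (resid n h)) \<longlonglongrightarrow> quad h - 0"
    by (intro tendsto_intros quad_resid_tendsto)
  moreover have "(\<Sum>i<n. l i * (cmod (cinner h (g i)))\<^sup>2) = quad h - quad (resid n h)" for n
    using quad_decomp[of h n] by linarith
  ultimately show ?thesis
    unfolding sums_def by simp
qed

text \<open>This matches \<open>l\<close> with the multiplicities by which
  \<open>singular_values\<close> is defined. An eigenvector for \<sigma> has coefficients only along
  \<open>?J\<close>; what remains is orthogonal to every \<open>g j\<close>, so its
  \<open>quad\<close> is \<open>0\<close> by \<open>quad_sums\<close>, but also \<sigma> times its
  squared norm.\<close>

lemma card_eigenspace:
  assumes "0 < \<sigma>"
  shows "card {j. l j = \<sigma>} = cdim {x. \<forall>h. B x h = of_real \<sigma> * cinner x h}" (is "card ?J = cdim ?V")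
proof -
  have "eventually (\<lambda>j. l j < \<sigma>) sequentially"
    using null assms by (rule order_tendstoD(2))
  then obtain m where m: "\<And>j. j \<ge> m \<Longrightarrow> l j < \<sigma>"
    by (auto simp: eventually_sequentially)
  then have "?J \<subseteq> {..<m}" by (force simp: not_less[symmetric])
  then have fin: "finite ?J" by (rule finite_subset) simp
  have inner: "cinner (g i) (g j) = of_bool (i = j)" if "i \<in> ?J" for i j
    using that assms orthonormal[of i j] g_nonzero_iff[of i] by simp
  have inj: "inj_on g ?J"
  proof (rule inj_onI)
    fix i j assume ij: "i \<in> ?J" "j \<in> ?J" "g i = g j"
    then have "cinner (g i) (g j) = 1" using inner[of i i] by simp
    then show "i = j" using inner[OF ij(1), of j] by (cases "i = j") auto
  qed
  have V: "g i \<in> ?V" if "i \<in> ?J" for i using that eigen by simp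
  have "cdim ?V = card (g ` ?J)"
  proof (rule complex_vector.dim_unique)
    show "g ` ?J \<subseteq> ?V" using V by blast
    show "\<not> cdependent (g ` ?J)"
    proof (rule orthonormal_set_independent)
      fix u v assume "u \<in> g ` ?J" "v \<in> g ` ?J"
      then obtain i j where "u = g i" "v = g j" "i \<in> ?J" "j \<in> ?J" by blast
      then show "cinner u v = of_bool (u = v)"
        using inner[of i j] inj by (auto simp: inj_on_def)
    qed (simp add: fin)
    show "?V \<subseteq> cspan (g ` ?J)"
    proof
      fix x assume x: "x \<in> ?V"
      define s where "s = (\<Sum>i\<in>?J. cinner x (g i) *\<^sub>C g i)"
      define y where "y = x - s"
      have xg: "cinner x (g j) = 0" if "j \<notin> ?J" for j
      proof -
        have "B x (g j) = of_real (l j) * cinner x (g j)"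
          using commute[of x "g j"] eigen[of j x] cinner_commute[of x "g j"] by simp
        moreover have "B x (g j) = of_real \<sigma> * cinner x (g j)" using x by simp
        ultimately show ?thesis using that by simp
      qed
      have "cinner y (g j) = 0" for j
      proof -
        have "cinner s (g j) = (\<Sum>i\<in>?J. if i = j then cinner x (g j) else 0)"
          unfolding s_def cinner.sum_left cinner.scale_left by (intro sum.cong) (auto simp: inner)
        also have "\<dots> = cinner x (g j)" using fin xg[of j] by simp
        finally show ?thesis by (simp add: y_def cinner.diff_left)
      qed
      then have "quad y = 0"
        using quad_sums[of y] sums_unique2[OF _ sums_zero] by simp
      moreover have "B y y = of_real \<sigma> * cinner y y"
      proof -
        have "B s y = of_real \<sigma> * cinner s y"
          unfolding s_def sum_left cinner.sum_left scale_left cinner.scale_left sum_distrib_left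
          by (intro sum.cong) (auto simp: eigen)
        then show ?thesis
          using x unfolding y_def[of] diff_left cinner.diff_left by (simp add: y_def algebra_simps)
      qed
      ultimately have "y = 0" using assms cinner.self_eq[of y] self_eq[of y] by simp
      moreover have "s \<in> cspan (g ` ?J)"
        unfolding s_def
        by (intro complex_vector.span_sum complex_vector.span_scale complex_vector.span_base imageI)
      ultimately show "x \<in> cspan (g ` ?J)"
        by (simp add: y_def)
    qed
  qed simp
  then show ?thesis using card_image[OF inj] by simp
qed

end

text \<open>Makes the \<open>THE\<close> in \<open>singular_values\<close> unique. At a first index
  \<open>m\<close> where \<open>s\<close> exceeds \<open>t\<close>, monotonicity puts every
  \<open>j\<close> with \<open>t j = s m\<close> before \<open>m\<close>, where the sequences agree,
  whereas \<open>m\<close> itself belongs only to the level set of \<open>s\<close>. That set is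
  finite because \<open>s\<close> tends to \<open>0\<close>, so \<open>card\<close> tells the two
  sets apart.\<close>

lemma decreasing_null_seq_unique:
  fixes s t :: "nat \<Rightarrow> real"
  assumes "antimono s" "s \<longlonglongrightarrow> 0" "antimono t" "t \<longlonglongrightarrow> 0"
    and card: "\<And>\<sigma>. 0 < \<sigma> \<Longrightarrow> card {j. s j = \<sigma>} = card {j. t j = \<sigma>}"
  shows "s = t"
proof -
  have le: "s m \<le> t m"
    if st: "antimono s" "s \<longlonglongrightarrow> 0" "antimono t" "t \<longlonglongrightarrow> 0"
      and card: "\<And>\<sigma>. 0 < \<sigma> \<Longrightarrow> card {j. s j = \<sigma>} = card {j. t j = \<sigma>}"
      and eq: "\<And>i. i < m \<Longrightarrow> s i = t i" for s t :: "nat \<Rightarrow> real" and m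
  proof (rule ccontr)
    assume "\<not> s m \<le> t m"
    then have lt: "t m < s m" by simp
    have "0 \<le> t m" using decseq_ge[OF st(3,4)] .
    with lt have pos: "0 < s m" by linarith
    have "eventually (\<lambda>j. s j < s m) sequentially"
      using st(2) pos by (rule order_tendstoD(2))
    then obtain n where n: "\<And>j. j \<ge> n \<Longrightarrow> s j < s m"
      by (auto simp: eventually_sequentially)
    have "{j. s j = s m} \<subseteq> {..<n}"
    proof
      fix j assume "j \<in> {j. s j = s m}"
      then show "j \<in> {..<n}" using n[of j] by (cases "j < n") auto
    qed
    then have fin: "finite {j. s j = s m}" by (rule finite_subset) simp
    have "{j. t j = s m} \<subseteq> {j. s j = s m}"
    proof
      fix j assume "j \<in> {j. t j = s m}"
      moreover from this have "j < m" using antimonoD[OF st(3), of m j] lt by (cases "j < m") auto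
      ultimately show "j \<in> {j. s j = s m}" using eq by simp
    qed
    moreover have "m \<in> {j. s j = s m}" "m \<notin> {j. t j = s m}" using lt by auto
    ultimately have "{j. t j = s m} \<subset> {j. s j = s m}" by blast
    from psubset_card_mono[OF fin this] card[OF pos] show False by simp
  qed
  have "s m = t m" for m
  proof (induction m rule: less_induct)
    case (less m)
    show ?case
      using le[OF assms(1-4) card, of m] le[OF assms(3,4,1,2) card[symmetric], of m] less by force
  qed
  then show ?thesis by auto
qed

text \<open>The form is given through a map \<open>F\<close> into an arbitrary normed space, so that
  functionals, operators and pairs of operators are treated alike.\<close>

lemma compact_formI:
  fixes B :: "'h::complex_hilbert_space \<Rightarrow> 'h \<Rightarrow> complex" and F :: "'h \<Rightarrow> 'b::real_normed_vector"
  assumes "pos_form B" and "bounded_linear F" and F: "\<And>x. Re (B x x) = (norm (F x))\<^sup>2"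
    and "compact K" and K: "F ` cball 0 1 \<subseteq> K"
  shows "compact_form B"
proof -
  interpret pos_form B by fact
  interpret F: bounded_linear F by fact
  show ?thesis
  proof
    obtain M where M: "\<And>x. norm (F x) \<le> norm x * M" "M > 0" using F.pos_bounded by blast
    have "quad x \<le> M\<^sup>2 * (norm x)\<^sup>2" for x
      using power_mono[OF M(1)[of x], of 2] by (simp add: quad_def F power_mult_distrib mult.commute)
    then show "\<exists>M. \<forall>x. quad x \<le> M * (norm x)\<^sup>2" by blast
  next
    fix x :: "nat \<Rightarrow> 'h" assume "\<And>n. norm (x n) \<le> 1"
    then have "\<forall>n. F (x n) \<in> K" using K by auto
    with \<open>compact K\<close> obtain y r where r: "strict_mono r" "((\<lambda>n. F (x n)) \<circ> r) \<longlonglongrightarrow> y"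
      unfolding compact_def by meson
    then have C: "Cauchy ((\<lambda>n. F (x n)) \<circ> r)" by (simp add: LIMSEQ_imp_Cauchy)
    have "\<exists>n0::nat. \<forall>m\<ge>n0. \<forall>n\<ge>n0. Re (B (x (r m) - x (r n)) (x (r m) - x (r n))) < \<epsilon>" if "\<epsilon> > 0" for \<epsilon> :: real
    proof -
      have "sqrt \<epsilon> > 0" using that by simp
      from metric_CauchyD[OF C this] obtain n0 where
        n0: "\<And>m n. m \<ge> n0 \<Longrightarrow> n \<ge> n0 \<Longrightarrow> norm (F (x (r m)) - F (x (r n))) < sqrt \<epsilon>"
        by (auto simp: dist_norm)
      have "Re (B (x (r m) - x (r n)) (x (r m) - x (r n))) < \<epsilon>" if "m \<ge> n0" "n \<ge> n0" for m n
      proof -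
        have "(norm (F (x (r m)) - F (x (r n))))\<^sup>2 < (sqrt \<epsilon>)\<^sup>2"
          using n0[OF that] by (intro power_strict_mono) auto
        then show ?thesis using \<open>\<epsilon> > 0\<close> by (simp add: F F.diff)
      qed
      then show ?thesis by blast
    qed
    then show "\<exists>r :: nat \<Rightarrow> nat. strict_mono r \<and> (\<forall>\<epsilon>>0. \<exists>n0. \<forall>m\<ge>n0. \<forall>n\<ge>n0.
        Re (B (x (r m) - x (r n)) (x (r m) - x (r n))) < \<epsilon>)"
      using r(1) by blast
  qed
qed

section \<open>Adjoints and singular values\<close>

text \<open>An eigenvector of the rank one form \<open>\<phi> x * cnj (\<phi> y)\<close> represents \<open>\<phi>\<close>.\<close>

lemma riesz_representation:
  fixes \<phi> :: "'h::complex_hilbert_space \<Rightarrow> complex"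
  assumes "bounded_linear \<phi>" and scale: "\<And>a x. \<phi> (a *\<^sub>C x) = a * \<phi> x"
  shows "\<exists>v. \<forall>x. \<phi> x = cinner x v"
proof (cases "\<forall>x. \<phi> x = 0")
  case True
  then show ?thesis by (intro exI[of _ 0]) simp
next
  case False
  then obtain x where x: "\<phi> x \<noteq> 0" by blast
  interpret \<phi>: bounded_linear \<phi> by fact
  define B where "B = (\<lambda>x y. \<phi> x * cnj (\<phi> y))"
  have ReB: "Re (B x x) = (norm (\<phi> x))\<^sup>2" for x
    using complex_norm_square[of "\<phi> x"] by (metis B_def Re_complex_of_real)
  have "pos_form B"
  proof
    show "0 \<le> Re (B x x)" for x by (simp add: ReB)
  qed (simp_all add: B_def \<phi>.add scale algebra_simps)
  obtain M where M: "\<And>x. norm (\<phi> x) \<le> norm x * M" "M > 0" using \<phi>.pos_bounded by blast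
  have "norm (\<phi> x) \<le> M" if "norm x \<le> 1" for x
    using M(1)[of x] mult_right_mono[OF that, of M] M(2) by linarith
  then have "\<phi> ` cball 0 1 \<subseteq> cball 0 M" by auto
  then have "compact_form B"
    by (intro compact_formI[OF \<open>pos_form B\<close> assms(1) ReB compact_cball])
  then interpret compact_form B .
  interpret spectral_form B eigval eigvec by (rule spectral_theorem)
  have "quad x \<noteq> 0" using x by (simp add: quad_def ReB)
  then obtain i where i: "eigval i \<noteq> 0"
    using quad_sums[of x] sums_unique2[OF _ sums_zero] by fastforce
  then have "B (eigvec i) (eigvec i) \<noteq> 0"
    using eigen[of i "eigvec i"] eigvec_inner[of i i] eigval_nonneg[of i] by simp
  then have nz: "\<phi> (eigvec i) \<noteq> 0" by (simp add: B_def)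
  have "\<phi> h = cinner h ((eigval i / \<phi> (eigvec i)) *\<^sub>C eigvec i)" for h
  proof -
    have "cnj (\<phi> h) = eigval i / \<phi> (eigvec i) * cinner (eigvec i) h"
      using eigen[of i h] nz by (simp add: B_def field_simps)
    from arg_cong[OF this, of cnj] show ?thesis
      using cinner_commute[of h "eigvec i"] by (simp add: cinner.scale_right)
  qed
  then show ?thesis by blast
qed

text \<open>The \<open>THE\<close> in \<open>cadjoint\<close> has meaning once the adjoint exists,
  by Riesz representation at each \<open>y\<close>, and is unique.\<close>

lemma cinner_cadjoint:
  assumes "complex_linear_op S"
  shows "cinner (blinfun_apply S x) y = cinner x (blinfun_apply (cadjoint S) y)"
proof -
  have "\<exists>v. \<forall>x. cinner (blinfun_apply S x) y = cinner x v" for y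
  proof (rule riesz_representation)
    show "bounded_linear (\<lambda>x. cinner (blinfun_apply S x) y)"
      by (intro bounded_linear_compose[OF bounded_bilinear.bounded_linear_left[OF bounded_bilinear_cinner]]
          blinfun.bounded_linear_right)
  qed (use assms in \<open>simp add: complex_linear_op_def cinner.scale_left\<close>)
  then obtain f where f: "\<And>x y. cinner (blinfun_apply S x) y = cinner x (f y)" by metis
  have bl: "bounded_linear f"
  proof (rule bounded_linear_intro[where K = "norm S"])
    show "f (x + y) = f x + f y" for x y
      by (rule cinner_ext_right) (simp add: f[symmetric] cinner.add_right)
    show "f (r *\<^sub>R x) = r *\<^sub>R f x" for r x
      by (rule cinner_ext_right) (simp add: f[symmetric] bounded_bilinear.scaleR_right[OF bounded_bilinear_cinner])
    show "norm (f x) \<le> norm x * norm S" for x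
    proof (cases "f x = 0")
      case False
      have "complex_of_real ((norm (f x))\<^sup>2) = cinner (blinfun_apply S (f x)) x"
        using f[of "f x" x] cinner.self_eq[of "f x"] by simp
      then have "(norm (f x))\<^sup>2 \<le> norm (blinfun_apply S (f x)) * norm x"
        using cinner_cauchy_schwarz[of "blinfun_apply S (f x)" x] by (metis norm_of_real abs_of_nonneg zero_le_power2)
      also have "\<dots> \<le> norm S * norm (f x) * norm x"
        by (intro mult_right_mono norm_blinfun) simp
      finally show ?thesis using False by (simp add: power2_eq_square mult_ac)
    qed simp
  qed
  define A where "A = Blinfun f"
  have A: "cinner (blinfun_apply S x) y = cinner x (blinfun_apply A y)" for x y
    using f by (simp add: A_def bounded_linear_Blinfun_apply bl)
  have "cadjoint S = A"
    unfolding cadjoint_def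
  proof (rule the_equality)
    show "\<forall>x y. cinner (blinfun_apply S x) y = cinner x (blinfun_apply A y)" using A by blast
    show "S' = A" if "\<forall>x y. cinner (blinfun_apply S x) y = cinner x (blinfun_apply S' y)" for S'
      using that A by (intro blinfun_eqI cinner_ext_right) metis
  qed
  then show ?thesis using A by simp
qed

text \<open>The form of \<open>cadjoint S\<close> composed with \<open>S\<close>, written without
  the adjoint.\<close>

definition op_form :: "('h::complex_hilbert_space \<Rightarrow>\<^sub>L 'h) \<Rightarrow> 'h \<Rightarrow> 'h \<Rightarrow> complex" where
  "op_form S x y = cinner (blinfun_apply S x) (blinfun_apply S y)"

lemma Re_op_form: "Re (op_form S x x) = (norm (blinfun_apply S x))\<^sup>2"
  by (simp add: op_form_def power2_norm_eq_inner inner_eq_Re_cinner)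

lemma pos_form_op_form: "complex_linear_op S \<Longrightarrow> pos_form (op_form S)"
  by unfold_locales
    (auto simp: op_form_def cinner.Re_self_nonneg complex_linear_op_def blinfun.add_right cinner.add_left
      cinner.scale_left intro: cinner_commute)

lemma compact_form_op_form: "complex_linear_op S \<Longrightarrow> compact_op S \<Longrightarrow> compact_form (op_form S)"
  by (rule compact_formI[OF pos_form_op_form blinfun.bounded_linear_right Re_op_form _ closure_subset])
    (simp_all add: compact_op_def)

text \<open>The sum is the form of the map sending \<open>x\<close> to the pair of
  \<open>S x\<close> and \<open>T x\<close>, since the norm of the product space is
  Euclidean.\<close>

lemma compact_form_add:
  assumes S: "complex_linear_op S" "compact_op S" and T: "complex_linear_op T" "compact_op T"
  shows "compact_form (\<lambda>x y. op_form S x y + op_form T x y)"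
proof (rule compact_formI)
  interpret S: pos_form "op_form S" by (rule pos_form_op_form[OF S(1)])
  interpret T: pos_form "op_form T" by (rule pos_form_op_form[OF T(1)])
  show "pos_form (\<lambda>x y. op_form S x y + op_form T x y)"
  proof
    show "op_form S x y + op_form T x y = cnj (op_form S y x + op_form T y x)" for x y
      using S.commute[of x y] T.commute[of x y] by simp
  qed (auto simp: S.add_left T.add_left S.scale_left T.scale_left S.Re_self_nonneg T.Re_self_nonneg
      algebra_simps)
  show "bounded_linear (\<lambda>x. (blinfun_apply S x, blinfun_apply T x))"
    by (intro bounded_linear_Pair blinfun.bounded_linear_right)
  show "Re (op_form S x x + op_form T x x) = (norm (blinfun_apply S x, blinfun_apply T x))\<^sup>2" for x
    by (simp add: Re_op_form norm_Pair)
  show "compact (closure (blinfun_apply S ` cball 0 1) \<times> closure (blinfun_apply T ` cball 0 1))"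
    using S(2) T(2) by (simp add: compact_op_def compact_Times)
  show "(\<lambda>x. (blinfun_apply S x, blinfun_apply T x)) ` cball 0 1
      \<subseteq> closure (blinfun_apply S ` cball 0 1) \<times> closure (blinfun_apply T ` cball 0 1)"
    using closure_subset by fast
qed

text \<open>Any diagonalisation computes the singular values, so that for scaled and for rank one
  operators an explicit one can be written down in place of that from
  \<open>spectral_theorem\<close>.\<close>

lemma singular_values_eq:
  assumes S: "complex_linear_op S" and "spectral_form (op_form S) l g"
  shows "singular_values S = (\<lambda>j. sqrt (l j))"
proof -
  interpret spectral_form "op_form S" l g by fact
  have eig: "blinfun_apply (cadjoint S) (blinfun_apply S x) = r *\<^sub>R x \<longleftrightarrow>
      (\<forall>h. op_form S x h = of_real r * cinner x h)" (is "?L \<longleftrightarrow> ?R") for x and r :: real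
  proof -
    have "op_form S x h = cinner (blinfun_apply (cadjoint S) (blinfun_apply S x)) h" for h
      using arg_cong[OF cinner_cadjoint[OF S, of h "blinfun_apply S x"], of cnj]
      by (metis op_form_def cinner_commute)
    moreover have "of_real r * cinner x h = cinner (r *\<^sub>R x) h" for h
      by (metis cinner_scaleC_left scaleC_of_real)
    ultimately show ?thesis using cinner_ext by metis
  qed
  let ?P = "\<lambda>s. antimono s \<and> s \<longlonglongrightarrow> 0 \<and> (\<forall>\<sigma>>0. card {j. s j = \<sigma>} =
        cdim {x. blinfun_apply (cadjoint S) (blinfun_apply S x) = \<sigma>\<^sup>2 *\<^sub>R x})"
  have P: "?P (\<lambda>j. sqrt (l j))"
  proof (intro conjI allI impI)
    show "antimono (\<lambda>j. sqrt (l j))"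
      using decr by (auto simp: antimono_def)
    show "(\<lambda>j. sqrt (l j)) \<longlonglongrightarrow> 0"
      using tendsto_real_sqrt[OF null] by simp
    fix \<sigma> :: real assume "\<sigma> > 0"
    then have "sqrt (l j) = \<sigma> \<longleftrightarrow> l j = \<sigma>\<^sup>2" for j
      using l_nonneg[of j] by auto
    then show "card {j. sqrt (l j) = \<sigma>}
        = cdim {x. blinfun_apply (cadjoint S) (blinfun_apply S x) = \<sigma>\<^sup>2 *\<^sub>R x}"
      using card_eigenspace[of "\<sigma>\<^sup>2"] \<open>\<sigma> > 0\<close> by (simp add: eig)
  qed
  show ?thesis
    unfolding singular_values_def
  proof (rule the_equality)
    show "?P (\<lambda>j. sqrt (l j))" by (rule P)
    show "s = (\<lambda>j. sqrt (l j))" if "?P s" for s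
      using that P by (intro decreasing_null_seq_unique) auto
  qed
qed

lemma sqrt_powr: "0 \<le> x \<Longrightarrow> sqrt x powr p = x powr (p / 2)"
  by (simp add: powr_half_sqrt[symmetric] powr_powr)

lemma schatten_class_iff:
  assumes "complex_linear_op S" "compact_op S" "spectral_form (op_form S) l g"
  shows "S \<in> schatten_class p \<longleftrightarrow> summable (\<lambda>j. l j powr (p / 2))"
  using assms spectral_form.l_nonneg[OF assms(3)]
  by (simp add: schatten_class_def singular_values_eq[OF assms(1,3)] sqrt_powr)

lemma schatten_norm_powr:
  assumes "complex_linear_op S" "spectral_form (op_form S) l g" "0 < p"
    and "summable (\<lambda>j. l j powr (p / 2))"
  shows "schatten_norm p S powr p = (\<Sum>j. l j powr (p / 2))"
proof -
  have "schatten_norm p S = (\<Sum>j. l j powr (p / 2)) powr (1 / p)"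
    unfolding schatten_norm_def singular_values_eq[OF assms(1,2)]
    using spectral_form.l_nonneg[OF assms(2)] by (simp add: sqrt_powr)
  moreover have "0 \<le> (\<Sum>j. l j powr (p / 2))"
    using assms(4) by (intro suminf_nonneg) auto
  ultimately show ?thesis using \<open>0 < p\<close> by (simp add: powr_powr)
qed

section \<open>Trace inequalities\<close>

text \<open>Concavity of the power, with weights of total mass at most \<open>1\<close>: the missing
  mass may be put at \<open>0\<close>, where the power vanishes, and monotonicity replaces the mean
  by \<open>c\<close>.\<close>

lemma powr_jensen:
  fixes w t :: "'i \<Rightarrow> real"
  assumes "finite I" and q: "0 \<le> q" "q \<le> 1"
    and w: "\<And>i. i \<in> I \<Longrightarrow> 0 \<le> w i" and t: "\<And>i. i \<in> I \<Longrightarrow> 0 \<le> t i"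
    and w1: "(\<Sum>i\<in>I. w i) \<le> 1" and c: "(\<Sum>i\<in>I. w i * t i) \<le> c"
  shows "(\<Sum>i\<in>I. w i * t i powr q) \<le> c powr q"
proof (cases "c \<le> 0")
  case True
  have "w i * t i = 0" if "i \<in> I" for i
  proof -
    have "(\<Sum>i\<in>I. w i * t i) = 0"
      using c True sum_nonneg[of I "\<lambda>i. w i * t i"] w t by force
    then show ?thesis using that sum_nonneg_eq_0_iff[OF \<open>finite I\<close>, of "\<lambda>i. w i * t i"] w t by auto
  qed
  then have "(\<Sum>i\<in>I. w i * t i powr q) = 0" by (intro sum.neutral) auto
  then show ?thesis by simp
next
  case False
  then have "c > 0" by simp
  \<comment> \<open>The graph lies below its tangent at \<open>c\<close>, which is Young's
    inequality for \<open>t i / c\<close> and \<open>1\<close>.\<close>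
  have tangent: "t i powr q \<le> c powr q * ((1 - q) + q * (t i / c))" if "i \<in> I" for i
  proof (cases "t i = 0")
    case False
    then have "t i > 0" using t[OF that] by simp
    have "(t i / c) powr q * 1 powr (1 - q) \<le> q * (t i / c) + (1 - q) * 1"
      by (rule Youngs_inequality_0) (use q \<open>c > 0\<close> \<open>t i > 0\<close> in auto)
    then show ?thesis
      using \<open>c > 0\<close> \<open>t i > 0\<close> by (simp add: powr_divide field_simps)
  qed (use q \<open>c > 0\<close> in simp)
  have "(\<Sum>i\<in>I. w i * t i powr q) \<le> (\<Sum>i\<in>I. w i * (c powr q * ((1 - q) + q * (t i / c))))"
    using tangent w by (intro sum_mono mult_left_mono) auto
  also have "\<dots> = c powr q * ((1 - q) * (\<Sum>i\<in>I. w i) + q / c * (\<Sum>i\<in>I. w i * t i))"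
    unfolding sum_distrib_left distrib_left sum.distrib[symmetric]
    by (intro sum.cong) (simp_all add: algebra_simps)
  also have "\<dots> \<le> c powr q * ((1 - q) * 1 + q / c * c)"
    using q w1 c \<open>c > 0\<close> by (intro mult_left_mono add_mono) auto
  also have "\<dots> = c powr q" using \<open>c > 0\<close> by simp
  finally show ?thesis .
qed

lemma inner_sq_commute: "(cmod (cinner x y))\<^sup>2 = (cmod (cinner y x))\<^sup>2"
  using cinner_commute[of x y] by (metis complex_mod_cnj)

text \<open>Interchange of summation for the trace inequalities: each row is summed exactly, each
  column is only bounded.\<close>

lemma sums_sum_le:
  fixes a :: "'i \<Rightarrow> real"
  assumes "\<And>i. i \<in> I \<Longrightarrow> (\<lambda>j. F i j) sums a i"
    and "\<And>j. (\<Sum>i\<in>I. F i j) \<le> b j" and "summable b"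
  shows "(\<Sum>i\<in>I. a i) \<le> (\<Sum>j. b j)"
  by (rule sums_le[OF _ sums_sum[OF assms(1)] summable_sums[OF assms(3)]]) (auto intro: assms)

context spectral_form
begin

lemma partial_quad_le: "finite J \<Longrightarrow> (\<Sum>i\<in>J. l i * (cmod (cinner h (g i)))\<^sup>2) \<le> quad h"
  using sum_le_suminf[OF sums_summable[OF quad_sums], of J h] sums_unique[OF quad_sums, of h]
  by (simp add: l_nonneg)

text \<open>Parseval's identity holds for the eigenvectors since \<open>B\<close> is small on the complement of
  the first members of \<open>f\<close>.\<close>

lemma eigenvector_parseval:
  assumes "orthofamily f" and "\<gamma> \<longlonglongrightarrow> 0"
    and dom: "\<And>n h. (\<And>i. i < n \<Longrightarrow> cinner h (f i) = 0) \<Longrightarrow> quad h \<le> \<gamma> n * (norm h)\<^sup>2"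
    and "0 < l j"
  shows "(\<lambda>i. (cmod (cinner (f i) (g j)))\<^sup>2) sums 1"
proof -
  interpret f: orthofamily f by fact
  define r where "r = (\<lambda>n. f.resid n (g j))"
  have ng: "norm (g j) = 1"
    using norm_family[of j] g_nonzero_iff[of j] \<open>0 < l j\<close> by simp
  have inner: "cinner (g j) (r n) = of_real ((norm (r n))\<^sup>2)" for n
  proof -
    have "cinner (r n) (r n) = cinner (g j) (r n)
        - (\<Sum>i<n. cinner (g j) (f i) * cinner (f i) (r n))"
      by (simp add: r_def f.resid_def cinner.diff_left cinner.sum_left cinner.scale_left)
    moreover have "cinner (f i) (r n) = 0" if "i < n" for i
      using f.resid_orth[OF that, of "g j"] cinner_commute[of "f i" "r n"] by (simp add: r_def)
    ultimately show ?thesis using cinner.self_eq[of "r n"] by simp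
  qed
  have lim: "(\<lambda>n. quad (r n)) \<longlonglongrightarrow> 0"
  proof (rule Lim_null_comparison)
    have "quad (r n) \<le> \<bar>\<gamma> n\<bar>" for n
    proof -
      have "quad (r n) \<le> \<gamma> n * (norm (r n))\<^sup>2"
        unfolding r_def by (rule dom) (rule f.resid_orth)
      also have "\<dots> \<le> \<bar>\<gamma> n\<bar> * (norm (r n))\<^sup>2" by (intro mult_right_mono) auto
      also have "\<dots> \<le> \<bar>\<gamma> n\<bar> * 1\<^sup>2"
        using f.norm_resid_le[of n "g j"] ng by (intro mult_left_mono power_mono) (auto simp: r_def)
      finally show ?thesis by simp
    qed
    then show "\<forall>\<^sub>F n in sequentially. norm (quad (r n)) \<le> \<bar>\<gamma> n\<bar>" by simp
    show "(\<lambda>n. \<bar>\<gamma> n\<bar>) \<longlonglongrightarrow> 0" using assms(2) by (simp add: tendsto_rabs_zero)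
  qed
  have "(\<lambda>n. (norm (r n))\<^sup>2) \<longlonglongrightarrow> 0"
  proof (rule Lim_null_comparison)
    have "(norm (r n))\<^sup>2 \<le> sqrt (quad (g j)) * sqrt (quad (r n)) / l j" for n
    proof -
      \<comment> \<open>The eigenvalue equation turns the norm of the residual into a value of
        \<open>B\<close>, which Cauchy-Schwarz bounds by means of the small
        \<open>quad (r n)\<close>.\<close>
      have "l j * (norm (r n))\<^sup>2 = cmod (B (g j) (r n))"
        using \<open>0 < l j\<close> by (simp add: eigen inner norm_mult norm_power)
      also have "\<dots> \<le> sqrt (quad (g j)) * sqrt (quad (r n))" by (rule cauchy_schwarz')
      finally show ?thesis using \<open>0 < l j\<close> by (simp add: field_simps)
    qed
    then show "\<forall>\<^sub>F n in sequentially. norm ((norm (r n))\<^sup>2) \<le> sqrt (quad (g j)) * sqrt (quad (r n)) / l j"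
      by simp
    have "(\<lambda>n. sqrt (quad (g j)) * sqrt (quad (r n)) / l j) \<longlonglongrightarrow> sqrt (quad (g j)) * sqrt 0 / l j"
      using \<open>0 < l j\<close> by (intro tendsto_intros lim) auto
    then show "(\<lambda>n. sqrt (quad (g j)) * sqrt (quad (r n)) / l j) \<longlonglongrightarrow> 0" by simp
  qed
  then have "(\<lambda>n. 1 - (norm (r n))\<^sup>2) \<longlonglongrightarrow> 1 - 0" by (intro tendsto_intros)
  moreover have "(\<Sum>i<n. (cmod (cinner (f i) (g j)))\<^sup>2) = 1 - (norm (r n))\<^sup>2" for n
    using f.norm_decomp[of "g j" n] ng by (simp add: r_def inner_sq_commute[of "g j"])
  ultimately show ?thesis by (simp add: sums_def)
qed

text \<open>
  For \<open>q \<le> 1\<close> the trace of the \<open>q\<close>-th power is the minimum over orthonormal bases \<open>f\<close> of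
  \<open>\<Sum>i. quad (f i) powr q\<close>.
\<close>

lemma trace_powr_le:
  assumes f: "orthofamily f" and "\<gamma> \<longlonglongrightarrow> 0"
    and dom: "\<And>n h. (\<And>i. i < n \<Longrightarrow> cinner h (f i) = 0) \<Longrightarrow> quad h \<le> \<gamma> n * (norm h)\<^sup>2"
    and q: "0 \<le> q" "q \<le> 1" and summ: "summable (\<lambda>i. quad (f i) powr q)" and "finite J"
  shows "(\<Sum>j\<in>J. l j powr q) \<le> (\<Sum>i. quad (f i) powr q)"
proof (rule sums_sum_le[OF _ _ summ])
  interpret f: orthofamily f by fact
  \<comment> \<open>The squared coefficients form a doubly substochastic matrix. For
    \<open>0 < l j\<close> they sum over \<open>i\<close> to exactly \<open>1\<close>, by Parseval;
    over \<open>j\<close> their sum is at most \<open>1\<close>, by Bessel, which is what Jensen's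
    inequality asks for.\<close>
  show "(\<lambda>i. (cmod (cinner (f i) (g j)))\<^sup>2 * l j powr q) sums (l j powr q)" for j
  proof (cases "0 < l j")
    case True
    from sums_mult2[OF eigenvector_parseval[OF f assms(2) dom True], of "l j powr q"]
    show ?thesis by simp
  next
    case False
    then have "l j = 0" using l_nonneg[of j] by simp
    then show ?thesis by simp
  qed
  show "(\<Sum>j\<in>J. (cmod (cinner (f i) (g j)))\<^sup>2 * l j powr q) \<le> quad (f i) powr q" for i
  proof (rule powr_jensen[OF \<open>finite J\<close> q])
    have "(\<Sum>j\<in>J. (cmod (cinner (f i) (g j)))\<^sup>2) \<le> (norm (f i))\<^sup>2" by (rule bessel) fact
    also have "\<dots> \<le> 1" by (simp add: f.norm_family)
    finally show "(\<Sum>j\<in>J. (cmod (cinner (f i) (g j)))\<^sup>2) \<le> 1" .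
    show "(\<Sum>j\<in>J. (cmod (cinner (f i) (g j)))\<^sup>2 * l j) \<le> quad (f i)"
      using partial_quad_le[OF \<open>finite J\<close>, of "f i"] by (simp add: mult.commute)
  qed (auto simp: l_nonneg)
qed

end

text \<open>
  If \<open>A \<le> C\<close>, then \<open>C\<close> dominates \<open>a j\<close> times the projection onto \<open>g j\<close>, hence
  \<open>\<langle>C\<^sup>-\<^sup>1 g j, g j\<rangle> \<le> 1 / a j\<close>; this replaces the operator monotonicity of powers in the
  estimate of the trace of \<open>C powr (q - 1) * A\<close>.
\<close>

lemma trace_weighted_le:
  assumes "spectral_form A a g" and "spectral_form C c f"
    and le: "\<And>h. Re (A h h) \<le> Re (C h h)"
    and q: "0 \<le> q" "q \<le> 1" and summ: "summable (\<lambda>j. a j powr q)"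
    and "finite I" and pos: "\<And>i. i \<in> I \<Longrightarrow> 0 < c i"
  shows "(\<Sum>i\<in>I. c i powr (q - 1) * Re (A (f i) (f i))) \<le> (\<Sum>j. a j powr q)"
proof (rule sums_sum_le[OF _ _ summ])
  interpret A: spectral_form A a g by fact
  interpret C: spectral_form C c f by fact
  show "(\<lambda>j. c i powr (q - 1) * (a j * (cmod (cinner (f i) (g j)))\<^sup>2))
      sums (c i powr (q - 1) * Re (A (f i) (f i)))" for i
    using sums_mult[OF A.quad_sums[of "f i"]] by (simp add: A.quad_def)
  show "(\<Sum>i\<in>I. c i powr (q - 1) * (a j * (cmod (cinner (f i) (g j)))\<^sup>2)) \<le> a j powr q" for j
  proof (cases "0 < a j")
    case False
    then have "a j = 0" using A.l_nonneg[of j] by simp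
    then show ?thesis by simp
  next
    case True
    define w where "w = (\<lambda>i. (cmod (cinner (g j) (f i)))\<^sup>2)"
    \<comment> \<open>\<open>v\<close> is the inverse of \<open>C\<close> applied to the part of
      \<open>g j\<close> in the span of the \<open>f i\<close> with \<open>i\<close> in
      \<open>I\<close>, and \<open>s\<close> is the value of the form of that inverse at this
      part.\<close>
    define v where "v = (\<Sum>i\<in>I. (cinner (g j) (f i) / c i) *\<^sub>C f i)"
    define s where "s = (\<Sum>i\<in>I. w i * (1 / c i))"
    have sq: "z * cnj z = of_real ((cmod z)\<^sup>2)" for z
      using complex_norm_square[of z] by simp
    have "cinner v (g j) = (\<Sum>i\<in>I. of_real (w i * (1 / c i)))"
      unfolding v_def cinner.sum_left cinner.scale_left
    proof (rule sum.cong)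
      show "cinner (g j) (f i) / c i * cinner (f i) (g j) = of_real (w i * (1 / c i))" for i
        using sq[of "cinner (g j) (f i)"] cinner_commute[of "f i" "g j"] by (simp add: w_def)
    qed simp
    then have vg: "cinner v (g j) = of_real s" by (simp add: s_def)
    have "C v y = (\<Sum>i\<in>I. cinner (g j) (f i) * cinner (f i) y)" for y
      unfolding v_def C.sum_left C.scale_left C.eigen
      by (intro sum.cong) (auto dest: pos)
    then have "C v v = (\<Sum>i\<in>I. cinner (g j) (f i) * cinner (f i) v)" .
    also have "\<dots> = cinner v (g j)"
    proof -
      have "cinner (f i) v = cnj (cinner (g j) (f i) / c i)" if "i \<in> I" for i
      proof -
        have "cinner (f i) v = (\<Sum>k\<in>I. if i = k then cnj (cinner (g j) (f i) / c i) else 0)"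
          unfolding v_def cinner.sum_right cinner.scale_right
          using pos[OF that] C.g_nonzero_iff[of i] by (intro sum.cong) (auto simp: C.orthonormal)
        then show ?thesis using that \<open>finite I\<close> by simp
      qed
      then have "(\<Sum>i\<in>I. cinner (g j) (f i) * cinner (f i) v) = (\<Sum>i\<in>I. of_real (w i * (1 / c i)))"
        by (intro sum.cong) (simp_all add: w_def sq)
      then show ?thesis by (simp add: vg s_def)
    qed
    finally have Cv: "Re (C v v) = s" by (simp add: vg)
    \<comment> \<open>\<open>C v v\<close> and \<open>cinner v (g j)\<close> both equal
      \<open>s\<close>. Domination of \<open>A\<close> by \<open>C\<close> at \<open>v\<close> thus
      becomes a quadratic inequality in \<open>s\<close>, whence
      \<open>s \<le> 1 / a j\<close>.\<close>
    have "a j * s\<^sup>2 \<le> s"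
    proof -
      have "a j * (cmod (cinner v (g j)))\<^sup>2 \<le> A.quad v"
        using A.partial_quad_le[of "{j}" v] by simp
      also have "\<dots> \<le> s" using le[of v] by (simp add: A.quad_def Cv)
      finally show ?thesis by (simp add: vg)
    qed
    moreover have "0 \<le> s" unfolding s_def w_def using pos by (intro sum_nonneg) (auto simp: less_imp_le)
    ultimately have s: "s \<le> 1 / a j"
      using True by (cases "s = 0") (auto simp: power2_eq_square field_simps)
    \<comment> \<open>Jensen with the exponent \<open>1 - q\<close> carries the bound from the
      inverse of \<open>C\<close> to its power \<open>q - 1\<close>.\<close>
    have "(\<Sum>i\<in>I. w i * (1 / c i) powr (1 - q)) \<le> (1 / a j) powr (1 - q)"
    proof (rule powr_jensen[OF \<open>finite I\<close>])
      have "(\<Sum>i\<in>I. w i) \<le> (norm (g j))\<^sup>2" unfolding w_def by (rule C.bessel) fact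
      also have "\<dots> \<le> 1" by (simp add: A.norm_family)
      finally show "(\<Sum>i\<in>I. w i) \<le> 1" .
      show "(\<Sum>i\<in>I. w i * (1 / c i)) \<le> 1 / a j" using s by (simp add: s_def)
    qed (use q pos in \<open>auto simp: w_def less_imp_le\<close>)
    then have "a j * (\<Sum>i\<in>I. w i * (1 / c i) powr (1 - q)) \<le> a j * (1 / a j) powr (1 - q)"
      using True by (intro mult_left_mono) auto
    also have "a j * (1 / a j) powr (1 - q) = a j powr q"
      using True by (simp add: powr_divide powr_diff)
    also have "a j * (\<Sum>i\<in>I. w i * (1 / c i) powr (1 - q))
        = (\<Sum>i\<in>I. c i powr (q - 1) * (a j * (cmod (cinner (f i) (g j)))\<^sup>2))"
      unfolding sum_distrib_left
    proof (rule sum.cong)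
      fix i assume "i \<in> I"
      then have "(1 / c i) powr (1 - q) = c i powr (q - 1)"
        using pos[of i] by (simp add: powr_divide powr_diff)
      then show "a j * (w i * (1 / c i) powr (1 - q))
          = c i powr (q - 1) * (a j * (cmod (cinner (f i) (g j)))\<^sup>2)"
        by (simp add: w_def inner_sq_commute[of "g j"])
    qed simp
    finally show ?thesis .
  qed
qed

section \<open>Clarkson's inequality in Schatten classes\<close>

lemma complex_linear_op_add: "complex_linear_op S \<Longrightarrow> complex_linear_op T \<Longrightarrow> complex_linear_op (S + T)"
  by (simp add: complex_linear_op_def blinfun.add_left scaleC_add_right)

lemma complex_linear_op_scaleC: "complex_linear_op S \<Longrightarrow> complex_linear_op (a *\<^sub>C S)"
  by (simp add: complex_linear_op_def scaleC_scaleC mult.commute)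

lemma compact_op_subsetI:
  assumes "compact K" and "blinfun_apply S ` cball 0 1 \<subseteq> K"
  shows "compact_op S"
  unfolding compact_op_def
  using compact_Int_closed[OF assms(1) closed_closure[of "blinfun_apply S ` cball 0 1"]]
    closure_minimal[OF assms(2) compact_imp_closed[OF assms(1)]] by (simp add: Int_absorb1)

lemma compact_op_ball_subset: "blinfun_apply S ` cball 0 1 \<subseteq> closure (blinfun_apply S ` cball 0 1)"
  by (rule closure_subset)

lemma compact_op_add: "compact_op S \<Longrightarrow> compact_op T \<Longrightarrow> compact_op (S + T)"
proof (rule compact_op_subsetI)
  assume "compact_op S" "compact_op T"
  then show "compact {x + y | x y. x \<in> closure (blinfun_apply S ` cball 0 1) \<and>
      y \<in> closure (blinfun_apply T ` cball 0 1)}"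
    unfolding compact_op_def by (rule compact_sums)
  show "blinfun_apply (S + T) ` cball 0 1 \<subseteq> {x + y | x y. x \<in> closure (blinfun_apply S ` cball 0 1) \<and>
      y \<in> closure (blinfun_apply T ` cball 0 1)}"
  proof
    fix z assume "z \<in> blinfun_apply (S + T) ` cball 0 1"
    then obtain x where "x \<in> cball 0 1" "z = blinfun_apply S x + blinfun_apply T x"
      by (auto simp: blinfun.add_left)
    then show "z \<in> {x + y | x y. x \<in> closure (blinfun_apply S ` cball 0 1) \<and>
        y \<in> closure (blinfun_apply T ` cball 0 1)}"
      using compact_op_ball_subset[of S] compact_op_ball_subset[of T] by blast
  qed
qed

lemma compact_op_scaleC: "compact_op S \<Longrightarrow> compact_op (a *\<^sub>C S)"
proof (rule compact_op_subsetI)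
  assume "compact_op S"
  then show "compact ((\<lambda>x. a *\<^sub>C x) ` closure (blinfun_apply S ` cball 0 1))"
    unfolding compact_op_def
    by (intro compact_continuous_image linear_continuous_on bounded_linear_scaleC)
  show "blinfun_apply (a *\<^sub>C S) ` cball 0 1 \<subseteq> (\<lambda>x. a *\<^sub>C x) ` closure (blinfun_apply S ` cball 0 1)"
    using compact_op_ball_subset[of S] by auto
qed

lemma schatten_classD:
  assumes "S \<in> schatten_class p"
  shows "complex_linear_op S" "compact_op S"
    "\<exists>l g. spectral_form (op_form S) l g \<and> summable (\<lambda>j. l j powr (p / 2))"
proof -
  show S: "complex_linear_op S" "compact_op S"
    using assms by (simp_all add: schatten_class_def)
  interpret compact_form "op_form S" by (rule compact_form_op_form[OF S])
  show "\<exists>l g. spectral_form (op_form S) l g \<and> summable (\<lambda>j. l j powr (p / 2))"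
    using spectral_theorem schatten_class_iff[OF S spectral_theorem] assms by blast
qed

lemma schatten_norm_nonneg: "0 \<le> schatten_norm p S"
  by (simp add: schatten_norm_def)

lemma schatten_scaleC:
  assumes S: "S \<in> schatten_class p" and "0 < p"
  shows "a *\<^sub>C S \<in> schatten_class p" and "schatten_norm p (a *\<^sub>C S) = cmod a * schatten_norm p S"
proof -
  note S' = schatten_classD[OF S]
  obtain l g where lg: "spectral_form (op_form S) l g" and summ: "summable (\<lambda>j. l j powr (p / 2))"
    using S'(3) by blast
  interpret spectral_form "op_form S" l g by fact
  \<comment> \<open>For \<open>a = 0\<close> all eigenvalues become \<open>0\<close>, and by the
    convention of \<open>spectral_form\<close> the eigenvectors must then be \<open>0\<close> as
    well.\<close>
  define l' g' where "l' = (\<lambda>j. (cmod a)\<^sup>2 * l j)" and "g' = (\<lambda>j. if a = 0 then 0 else g j)"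
  have form: "op_form (a *\<^sub>C S) x y = of_real ((cmod a)\<^sup>2) * op_form S x y" for x y
    using complex_norm_square[of a] by (simp add: op_form_def cinner.scale_left cinner.scale_right)
  have lin: "complex_linear_op (a *\<^sub>C S)" and comp: "compact_op (a *\<^sub>C S)"
    using S' by (auto intro: complex_linear_op_scaleC compact_op_scaleC)
  interpret a: pos_form "op_form (a *\<^sub>C S)" by (rule pos_form_op_form[OF lin])
  have spec: "spectral_form (op_form (a *\<^sub>C S)) l' g'"
  proof
    show "antimono l'" using decr by (auto simp: antimono_def l'_def intro!: mult_left_mono)
    show "l' \<longlonglongrightarrow> 0" unfolding l'_def by (rule tendsto_mult_right_zero[OF null])
    show "cinner (g' i) (g' j) = of_bool (i = j \<and> 0 < l' i)" for i j
      using g_nonzero_iff[of i] by (auto simp: g'_def l'_def orthonormal zero_less_mult_iff)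
    show "op_form (a *\<^sub>C S) (g' j) h = of_real (l' j) * cinner (g' j) h" for j h
      unfolding form by (auto simp: g'_def l'_def eigen)
    show "Re (op_form (a *\<^sub>C S) h h) \<le> l' n * (norm h)\<^sup>2"
      if "\<And>i. i < n \<Longrightarrow> cinner h (g' i) = 0" for n h
    proof (cases "a = 0")
      case False
      then have "Re (op_form S h h) \<le> l n * (norm h)\<^sup>2"
        using that by (intro dominates) (simp add: g'_def)
      from mult_left_mono[OF this, of "(cmod a)\<^sup>2"] show ?thesis
        unfolding form l'_def by (simp add: mult.assoc flip: of_real_power)
    qed (simp add: Re_op_form l'_def)
  qed
  have pw: "l' j powr (p / 2) = cmod a powr p * l j powr (p / 2)" for j
  proof -
    have "l' j powr (p / 2) = ((cmod a)\<^sup>2) powr (p / 2) * l j powr (p / 2)"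
      unfolding l'_def by (rule powr_mult)
    also have "((cmod a)\<^sup>2) powr (p / 2) = cmod a powr p"
      by (cases "a = 0") (simp_all add: powr_powr flip: powr_numeral)
    finally show ?thesis .
  qed
  have summ': "summable (\<lambda>j. l' j powr (p / 2))"
    unfolding pw by (intro summable_mult summ)
  show "a *\<^sub>C S \<in> schatten_class p"
    using schatten_class_iff[OF lin comp spec] summ' by simp
  have "schatten_norm p (a *\<^sub>C S) powr p = cmod a powr p * schatten_norm p S powr p"
    unfolding schatten_norm_powr[OF lin spec \<open>0 < p\<close> summ'] schatten_norm_powr[OF S'(1) lg \<open>0 < p\<close> summ] pw
    by (rule suminf_mult[OF summ])
  also have "\<dots> = (cmod a * schatten_norm p S) powr p"
    by (simp add: powr_mult schatten_norm_nonneg)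
  finally have "(schatten_norm p (a *\<^sub>C S) powr p) powr (1 / p)
      = ((cmod a * schatten_norm p S) powr p) powr (1 / p)" by simp
  then show "schatten_norm p (a *\<^sub>C S) = cmod a * schatten_norm p S"
    using \<open>0 < p\<close> by (simp add: powr_powr schatten_norm_nonneg)
qed

text \<open>Closure under addition comes from the same estimate as the inequality. The second claim
  presupposes membership of \<open>S - T\<close> because this follows only afterwards, in
  \<open>schatten_diff\<close>, from the first claim.\<close>

lemma schatten_clarkson:
  fixes S T :: "'h::complex_hilbert_space \<Rightarrow>\<^sub>L 'h"
  assumes p: "0 < p" "p \<le> 2" and S: "S \<in> schatten_class p" and T: "T \<in> schatten_class p"
  shows "S + T \<in> schatten_class p"
    and "S - T \<in> schatten_class p \<Longrightarrow> schatten_norm p (S + T) powr p + schatten_norm p (S - T) powr p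
      \<le> 2 * (schatten_norm p S powr p + schatten_norm p T powr p)"
proof -
  note S' = schatten_classD[OF S] and T' = schatten_classD[OF T]
  define q where "q = p / 2"
  have q: "0 \<le> q" "q \<le> 1" using p by (simp_all add: q_def)
  obtain a ga where A: "spectral_form (op_form S) a ga" "summable (\<lambda>j. a j powr q)"
    using S'(3) by (auto simp: q_def)
  obtain b gb where B: "spectral_form (op_form T) b gb" "summable (\<lambda>j. b j powr q)"
    using T'(3) by (auto simp: q_def)
  interpret A: spectral_form "op_form S" a ga by (rule A(1))
  interpret B: spectral_form "op_form T" b gb by (rule B(1))
  define F where "F = (\<lambda>x y. op_form S x y + op_form T x y)"
  have "compact_form F"
    unfolding F_def by (rule compact_form_add[OF S'(1,2) T'(1,2)])
  then interpret F: compact_form F .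
  define c f where "c = F.eigval" and "f = F.eigvec"
  have C: "spectral_form F c f" unfolding c_def f_def by (rule F.spectral_theorem)
  interpret C: spectral_form F c f by (rule C)
  have Ff: "F.quad (f i) = c i" for i
    unfolding c_def f_def by (rule F.eigvec_props)
  have quadF: "F.quad h = (norm (blinfun_apply S h))\<^sup>2 + (norm (blinfun_apply T h))\<^sup>2" for h
    unfolding F.quad_def by (simp add: F_def Re_op_form)
  \<comment> \<open>Writing \<open>c i powr q\<close> as \<open>c i powr (q - 1) * c i\<close> and
    splitting \<open>c i\<close> into its contributions from \<open>S\<close> and \<open>T\<close>
    leaves two sums for \<open>trace_weighted_le\<close>. Indices with \<open>c i = 0\<close> are
    dropped first because the weight has an exponent \<open>q - 1 \<le> 0\<close>.\<close>
  have cle: "(\<Sum>i\<in>I. c i powr q) \<le> (\<Sum>j. a j powr q) + (\<Sum>j. b j powr q)" if "finite I" for I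
  proof -
    define I' where "I' = {i\<in>I. 0 < c i}"
    have I': "finite I'" using that by (simp add: I'_def)
    have "(\<Sum>i\<in>I. c i powr q) = (\<Sum>i\<in>I'. c i powr q)"
      using that C.l_nonneg by (intro sum.mono_neutral_right) (auto simp: I'_def less_le)
    also have "\<dots> = (\<Sum>i\<in>I'. c i powr (q - 1) * Re (op_form S (f i) (f i)))
        + (\<Sum>i\<in>I'. c i powr (q - 1) * Re (op_form T (f i) (f i)))"
      unfolding sum.distrib[symmetric] distrib_left[symmetric]
    proof (rule sum.cong)
      fix i assume "i \<in> I'"
      then have "0 < c i" by (simp add: I'_def)
      then have "c i powr q = c i powr (q - 1) * c i" by (simp add: powr_diff)
      moreover have "c i = Re (op_form S (f i) (f i)) + Re (op_form T (f i) (f i))"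
        using Ff[of i] unfolding F.quad_def by (simp add: F_def)
      ultimately show "c i powr q = c i powr (q - 1) * (Re (op_form S (f i) (f i)) + Re (op_form T (f i) (f i)))"
        by metis
    qed simp
    also have "\<dots> \<le> (\<Sum>j. a j powr q) + (\<Sum>j. b j powr q)"
      by (intro add_mono trace_weighted_le[OF A(1) C _ q A(2) I'] trace_weighted_le[OF B(1) C _ q B(2) I'])
        (auto simp: F_def I'_def Re_op_form)
    finally show ?thesis .
  qed
  have c_summ: "summable (\<lambda>i. c i powr q)"
    by (rule summableI_nonneg_bounded[OF _ cle]) auto
  have c_le: "(\<Sum>i. c i powr q) \<le> (\<Sum>j. a j powr q) + (\<Sum>j. b j powr q)"
    by (rule suminf_le_const[OF c_summ cle]) simp
  define dp where "dp = (\<lambda>i. ((norm (blinfun_apply (S + T) (f i)))\<^sup>2) powr q)"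
  define dm where "dm = (\<lambda>i. ((norm (blinfun_apply (S - T) (f i)))\<^sup>2) powr q)"
  \<comment> \<open>By the parallelogram law \<open>c i\<close> is the mean of the two squared
    norms; concavity of the power \<open>q\<close> does the rest.\<close>
  have dle: "dp i + dm i \<le> 2 * c i powr q" for i
  proof -
    define t where "t = (\<lambda>s. if s then (norm (blinfun_apply (S + T) (f i)))\<^sup>2
      else (norm (blinfun_apply (S - T) (f i)))\<^sup>2)"
    have "(\<Sum>s\<in>{True, False}. 1 / 2 * t s powr q) \<le> c i powr q"
    proof (rule powr_jensen[OF _ q])
      show "(\<Sum>s\<in>{True, False}. 1 / 2 * t s) \<le> c i"
        using cinner.parallelogram[of "blinfun_apply S (f i)" "blinfun_apply T (f i)"] Ff[of i] quadF[of "f i"]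
        by (simp add: t_def blinfun.add_left blinfun.diff_left)
    qed (auto simp: t_def)
    then show ?thesis by (simp add: t_def dp_def dm_def)
  qed
  have dp: "summable dp" and dm: "summable dm"
  proof -
    have c2: "summable (\<lambda>i. 2 * c i powr q)" by (intro summable_mult c_summ)
    have le: "norm (dp i) \<le> 2 * c i powr q" "norm (dm i) \<le> 2 * c i powr q" for i
      using dle[of i] powr_ge_zero unfolding dp_def dm_def by (smt (verit) real_norm_def)+
    show "summable dp" by (rule summable_comparison_test'[OF c2, of 0]) (rule le)
    show "summable dm" by (rule summable_comparison_test'[OF c2, of 0]) (rule le)
  qed
  have dom: "(norm (blinfun_apply S h))\<^sup>2 + (norm (blinfun_apply T h))\<^sup>2 \<le> c n * (norm h)\<^sup>2"
    if "\<And>i. i < n \<Longrightarrow> cinner h (f i) = 0" for n h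
    using C.dominates[OF that] quadF[of h] by (simp add: F.quad_def)
  \<comment> \<open>The form of \<open>U\<close> is at most twice \<open>F\<close>, so it is small
    on the complement of the first members of \<open>f\<close>. This makes \<open>f\<close>
    admissible in \<open>trace_powr_le\<close>, for \<open>S + T\<close> and \<open>S - T\<close>
    alike.\<close>
  have 2: "U \<in> schatten_class p \<and> schatten_norm p U powr p \<le> (\<Sum>i. d i)"
    if U: "complex_linear_op U" "compact_op U"
      and Ule: "\<And>h. (norm (blinfun_apply U h))\<^sup>2
        \<le> 2 * ((norm (blinfun_apply S h))\<^sup>2 + (norm (blinfun_apply T h))\<^sup>2)"
      and d: "d = (\<lambda>i. ((norm (blinfun_apply U (f i)))\<^sup>2) powr q)" "summable d"
    for U d
  proof -
    interpret U: compact_form "op_form U" by (rule compact_form_op_form[OF U])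
    interpret Us: spectral_form "op_form U" U.eigval U.eigvec by (rule U.spectral_theorem)
    have qU: "U.quad h = (norm (blinfun_apply U h))\<^sup>2" for h by (simp add: U.quad_def Re_op_form)
    have le: "(\<Sum>j\<in>J. U.eigval j powr q) \<le> (\<Sum>i. d i)" if "finite J" for J
      unfolding d(1) qU[symmetric]
    proof (rule Us.trace_powr_le[OF _ _ _ q _ that])
      show "orthofamily f" by (rule C.orthofamily_axioms)
      show "(\<lambda>n. 2 * c n) \<longlonglongrightarrow> 0" by (rule tendsto_mult_right_zero[OF C.null])
      show "U.quad h \<le> 2 * c n * (norm h)\<^sup>2" if "\<And>i. i < n \<Longrightarrow> cinner h (f i) = 0" for n h
        using dom[of n h, OF that] Ule[of h] by (simp add: qU)
      show "summable (\<lambda>i. U.quad (f i) powr q)" using d by (simp add: qU)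
    qed
    have summ: "summable (\<lambda>j. U.eigval j powr q)"
      by (rule summableI_nonneg_bounded[OF _ le]) auto
    then have "U \<in> schatten_class p"
      using schatten_class_iff[OF U U.spectral_theorem] by (simp add: q_def)
    moreover have "schatten_norm p U powr p \<le> (\<Sum>i. d i)"
      unfolding schatten_norm_powr[OF U(1) U.spectral_theorem p(1) summ[unfolded q_def]]
      using suminf_le_const[OF summ le] by (simp add: q_def)
    ultimately show ?thesis ..
  qed
  have pm1: "(norm (x + y))\<^sup>2 \<le> 2 * ((norm x)\<^sup>2 + (norm y)\<^sup>2)" for x y :: 'h
    using cinner.parallelogram[of x y] zero_le_power2[of "norm (x - y)"] by argo
  have pm2: "(norm (x - y))\<^sup>2 \<le> 2 * ((norm x)\<^sup>2 + (norm y)\<^sup>2)" for x y :: 'h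
    using cinner.parallelogram[of x y] zero_le_power2[of "norm (x + y)"] by argo
  have P: "S + T \<in> schatten_class p \<and> schatten_norm p (S + T) powr p \<le> (\<Sum>i. dp i)"
    using S' T' pm1 by (intro 2[OF _ _ _ dp_def dp])
      (auto simp: blinfun.add_left intro: complex_linear_op_add compact_op_add)
  then show "S + T \<in> schatten_class p" ..
  assume "S - T \<in> schatten_class p"
  then have M: "schatten_norm p (S - T) powr p \<le> (\<Sum>i. dm i)"
    using pm2 2[OF _ _ _ dm_def dm] schatten_classD(1,2)[of "S - T" p] by (auto simp: blinfun.diff_left)
  have "(\<Sum>i. dp i) + (\<Sum>i. dm i) = (\<Sum>i. dp i + dm i)"
    by (rule suminf_add[OF dp dm])
  also have "\<dots> \<le> (\<Sum>i. 2 * c i powr q)"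
    by (intro suminf_le dle summable_add dp dm summable_mult c_summ)
  also have "\<dots> = 2 * (\<Sum>i. c i powr q)" by (rule suminf_mult[OF c_summ])
  also have "\<dots> \<le> 2 * ((\<Sum>j. a j powr q) + (\<Sum>j. b j powr q))" using c_le by simp
  also have "(\<Sum>j. a j powr q) = schatten_norm p S powr p"
    using schatten_norm_powr[OF S'(1) A(1) p(1)] A(2) by (simp add: q_def)
  also have "(\<Sum>j. b j powr q) = schatten_norm p T powr p"
    using schatten_norm_powr[OF T'(1) B(1) p(1)] B(2) by (simp add: q_def)
  finally show "schatten_norm p (S + T) powr p + schatten_norm p (S - T) powr p
      \<le> 2 * (schatten_norm p S powr p + schatten_norm p T powr p)"
    using P M by linarith
qed

section \<open>Diagonal coefficients\<close>

text \<open>Convexity of the power \<open>p\<close>, obtained from concavity of the power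
  \<open>1 / p\<close>.\<close>

lemma powr_convex_sum:
  fixes w s :: "'i \<Rightarrow> real"
  assumes "finite I" and p: "1 \<le> p"
    and w: "\<And>i. i \<in> I \<Longrightarrow> 0 \<le> w i" and s: "\<And>i. i \<in> I \<Longrightarrow> 0 \<le> s i"
    and w1: "(\<Sum>i\<in>I. w i) \<le> 1"
  shows "(\<Sum>i\<in>I. w i * s i) powr p \<le> (\<Sum>i\<in>I. w i * s i powr p)"
proof -
  have "(\<Sum>i\<in>I. w i * (s i powr p) powr (1 / p)) \<le> (\<Sum>i\<in>I. w i * s i powr p) powr (1 / p)"
    using p w w1 by (intro powr_jensen[OF \<open>finite I\<close>]) auto
  moreover have "(\<Sum>i\<in>I. w i * (s i powr p) powr (1 / p)) = (\<Sum>i\<in>I. w i * s i)"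
    using p s by (intro sum.cong) (auto simp: powr_powr)
  ultimately have "(\<Sum>i\<in>I. w i * s i) powr p \<le> ((\<Sum>i\<in>I. w i * s i powr p) powr (1 / p)) powr p"
    using p w s by (intro powr_mono2) (auto intro!: sum_nonneg)
  also have "\<dots> = (\<Sum>i\<in>I. w i * s i powr p)"
    using p w by (simp add: powr_powr sum_nonneg)
  finally show ?thesis .
qed

text \<open>By the singular value decomposition, the modulus of the \<open>i\<close>-th diagonal
  coefficient is at most the sum of \<open>w i j * sqrt (l j)\<close> over \<open>j\<close>, with a
  doubly substochastic matrix \<open>w\<close>. Convexity uses the row sums of \<open>w\<close>, the
  summation over \<open>i\<close> its column sums.\<close>

lemma schatten_diagonal_le:
  assumes S: "S \<in> schatten_class p" and p: "1 \<le> p" and e: "orthofamily e" and "finite I"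
  shows "(\<Sum>i\<in>I. cmod (cinner (blinfun_apply S (e i)) (e i)) powr p) \<le> schatten_norm p S powr p"
proof -
  note S' = schatten_classD[OF S]
  interpret e: orthofamily e by fact
  obtain l g where L: "spectral_form (op_form S) l g" and summ: "summable (\<lambda>j. l j powr (p / 2))"
    using S'(3) by blast
  interpret spectral_form "op_form S" l g by (rule L)
  \<comment> \<open>The left singular vectors. Where \<open>l j = 0\<close> also
    \<open>g j = 0\<close>, hence \<open>h j = 0\<close>, so the family is again orthonormal up to
    zeros.\<close>
  define h where "h = (\<lambda>j. complex_of_real (1 / sqrt (l j)) *\<^sub>C blinfun_apply S (g j))"
  have Sg: "blinfun_apply S (g j) = complex_of_real (sqrt (l j)) *\<^sub>C h j" for j
  proof (cases "0 < l j")
    case True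
    then have "complex_of_real (sqrt (l j)) * complex_of_real (1 / sqrt (l j)) = 1" by simp
    then show ?thesis
      unfolding h_def scaleC_scaleC by (simp add: complex_vector.scale_one del: of_real_divide)
  next
    case False
    then have "g j = 0" using g_nonzero_iff by blast
    then show ?thesis by (simp add: h_def blinfun.zero_right scaleC_of_real)
  qed
  have hh: "cinner (h i) (h j) = of_bool (i = j \<and> 0 < l i)" for i j
  proof -
    have "cinner (h i) (h j) = of_real (1 / sqrt (l i)) * of_real (1 / sqrt (l j)) * op_form S (g i) (g j)"
      by (simp add: h_def cinner.scale_left cinner.scale_right op_form_def)
    also have "\<dots> = of_real (1 / sqrt (l i)) * of_real (1 / sqrt (l j)) * (of_real (l i) * of_bool (i = j \<and> 0 < l i))"
      by (simp add: eigen orthonormal g_nonzero_iff)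
    also have "\<dots> = of_bool (i = j \<and> 0 < l i)"
    proof (cases "i = j \<and> 0 < l i")
      case True
      then have "1 / sqrt (l i) * (1 / sqrt (l i)) * l i = 1" by (auto simp: abs_of_pos)
      then have "complex_of_real (1 / sqrt (l i)) * complex_of_real (1 / sqrt (l i)) * complex_of_real (l i) = 1"
        by (metis of_real_1 of_real_mult)
      then show ?thesis using True by simp
    next
      case False
      then show ?thesis by (simp del: of_real_divide)
    qed
    finally show ?thesis .
  qed
  have h0: "h i \<noteq> 0 \<longleftrightarrow> 0 < l i" for i
  proof (cases "0 < l i")
    case True
    then show ?thesis using hh[of i i] by (cases "h i = 0") auto
  next
    case False
    then show ?thesis using hh[of i i] cinner.self_eq[of "h i"] by simp
  qed
  interpret h: orthofamily h
    by unfold_locales (simp add: hh h0)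
  have le1: "norm (e i) \<le> 1" "norm (g i) \<le> 1" "norm (h i) \<le> 1" for i
    by (simp_all add: e.norm_family norm_family h.norm_family)
  \<comment> \<open>The mean of the squares bounds the product of the two coefficients, and Bessel's
    inequality controls its row and column sums.\<close>
  define w where "w = (\<lambda>i j. ((cmod (cinner (e i) (g j)))\<^sup>2 + (cmod (cinner (e i) (h j)))\<^sup>2) / 2)"
  have bessel1: "(\<Sum>j\<in>J. (cmod (cinner x (u j)))\<^sup>2) \<le> 1" if "orthofamily u" "norm x \<le> 1" "finite J" for x u J
    using orthofamily.bessel[OF that(1,3), of x] power_mono[OF that(2), of 2] by simp
  have wj: "(\<Sum>j\<in>J. w i j) \<le> 1" if "finite J" for i J
    using bessel1[OF orthofamily_axioms le1(1) that, of i] bessel1[OF h.orthofamily_axioms le1(1) that, of i]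
    by (simp add: w_def sum.distrib flip: sum_divide_distrib)
  have wi: "(\<Sum>i\<in>I. w i j) \<le> 1" for j
    using bessel1[OF e le1(2) \<open>finite I\<close>, of j] bessel1[OF e le1(3) \<open>finite I\<close>, of j]
    by (simp add: w_def sum.distrib inner_sq_commute[of "e _"] flip: sum_divide_distrib)
  \<comment> \<open>The expansion cut off at \<open>m\<close>, so that convexity is applied to
    finite sums; the limit in \<open>m\<close> is taken at the end.\<close>
  define z where "z = (\<lambda>m i. \<Sum>j<m. cinner (e i) (g j) * cinner (blinfun_apply S (g j)) (e i))"
  have zle: "cmod (z m i) powr p \<le> (\<Sum>j<m. w i j * l j powr (p / 2))" for m i
  proof -
    have "cmod (cinner (e i) (g j) * cinner (blinfun_apply S (g j)) (e i)) \<le> w i j * sqrt (l j)" for j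
    proof -
      have "cmod (cinner (e i) (g j) * cinner (blinfun_apply S (g j)) (e i))
          = (cmod (cinner (e i) (g j)) * cmod (cinner (e i) (h j))) * sqrt (l j)"
        using l_nonneg[of j] cinner_commute[of "h j" "e i"]
        by (simp add: Sg cinner.scale_left norm_mult)
      also have "cmod (cinner (e i) (g j)) * cmod (cinner (e i) (h j)) \<le> w i j"
        using sum_squares_bound[of "cmod (cinner (e i) (g j))" "cmod (cinner (e i) (h j))"]
        by (simp add: w_def)
      finally show ?thesis using l_nonneg[of j] by (simp add: mult_right_mono)
    qed
    then have "cmod (z m i) \<le> (\<Sum>j<m. w i j * sqrt (l j))"
      unfolding z_def by (intro order_trans[OF norm_sum] sum_mono)
    then have "cmod (z m i) powr p \<le> (\<Sum>j<m. w i j * sqrt (l j)) powr p"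
      using p by (intro powr_mono2) auto
    also have "\<dots> \<le> (\<Sum>j<m. w i j * sqrt (l j) powr p)"
      using p wj by (intro powr_convex_sum) (auto simp: w_def l_nonneg)
    finally show ?thesis by (simp add: sqrt_powr l_nonneg)
  qed
  have bound: "(\<Sum>i\<in>I. cmod (z m i) powr p) \<le> schatten_norm p S powr p" for m
  proof -
    have "(\<Sum>i\<in>I. cmod (z m i) powr p) \<le> (\<Sum>i\<in>I. \<Sum>j<m. w i j * l j powr (p / 2))"
      by (intro sum_mono zle)
    also have "\<dots> = (\<Sum>j<m. (\<Sum>i\<in>I. w i j) * l j powr (p / 2))"
      by (subst sum.swap) (simp add: sum_distrib_right)
    also have "\<dots> \<le> (\<Sum>j<m. 1 * l j powr (p / 2))"
      by (intro sum_mono mult_right_mono wi) auto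
    also have "\<dots> \<le> (\<Sum>j. l j powr (p / 2))"
      using sum_le_suminf[OF summ, of "{..<m}"] by simp
    also have "\<dots> = schatten_norm p S powr p"
      using schatten_norm_powr[OF S'(1) L _ summ] p by simp
    finally show ?thesis .
  qed
  have lim: "(\<lambda>m. z m i) \<longlonglongrightarrow> cinner (blinfun_apply S (e i)) (e i)" for i
  proof -
    have eq: "z m i = cinner (blinfun_apply S (e i)) (e i) - cinner (blinfun_apply S (resid m (e i))) (e i)" for m
    proof -
      have "blinfun_apply S (\<Sum>j<m. cinner (e i) (g j) *\<^sub>C g j)
          = (\<Sum>j<m. cinner (e i) (g j) *\<^sub>C blinfun_apply S (g j))"
        using S'(1) by (simp add: blinfun.sum_right complex_linear_op_def)
      then show ?thesis
        by (simp add: resid_def blinfun.diff_right cinner.diff_left cinner.sum_left cinner.scale_left z_def)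
    qed
    have "(\<lambda>m. cinner (blinfun_apply S (resid m (e i))) (e i)) \<longlonglongrightarrow> 0"
    proof (rule Lim_null_comparison)
      have "cmod (cinner (blinfun_apply S (resid m (e i))) (e i)) \<le> sqrt (quad (resid m (e i)))" for m
      proof -
        have "cmod (cinner (blinfun_apply S (resid m (e i))) (e i)) \<le> norm (blinfun_apply S (resid m (e i))) * 1"
          by (intro order_trans[OF cinner_cauchy_schwarz] mult_left_mono le1) simp
        then show ?thesis by (simp add: quad_def Re_op_form)
      qed
      then show "\<forall>\<^sub>F m in sequentially. norm (cinner (blinfun_apply S (resid m (e i))) (e i))
          \<le> sqrt (quad (resid m (e i)))" by simp
      show "(\<lambda>m. sqrt (quad (resid m (e i)))) \<longlonglongrightarrow> 0"
        using tendsto_real_sqrt[OF quad_resid_tendsto] by simp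
    qed
    from tendsto_diff[OF tendsto_const this] show ?thesis by (simp add: eq)
  qed
  have "(\<lambda>m. \<Sum>i\<in>I. cmod (z m i) powr p)
      \<longlonglongrightarrow> (\<Sum>i\<in>I. cmod (cinner (blinfun_apply S (e i)) (e i)) powr p)"
    using p by (intro tendsto_sum tendsto_powr' tendsto_norm lim tendsto_const) auto
  then show ?thesis
    by (rule LIMSEQ_le_const2) (auto intro: bound)
qed

definition rank_one_proj :: "'h::complex_hilbert_space \<Rightarrow> 'h \<Rightarrow>\<^sub>L 'h" where
  "rank_one_proj e = Blinfun (\<lambda>x. cinner x e *\<^sub>C e)"

lemma bounded_linear_scaleC_left: "bounded_linear (\<lambda>c. c *\<^sub>C (x :: 'a::complex_normed_vector))"
proof (rule bounded_linear_intro[where K = "norm x"])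
  show "(r *\<^sub>R c) *\<^sub>C x = r *\<^sub>R (c *\<^sub>C x)" for r c
    by (simp add: scaleR_conv_of_real scaleC_of_real flip: scaleC_scaleC)
qed (simp_all add: scaleC_add_left norm_scaleC)

lemma rank_one_proj_apply [simp]: "blinfun_apply (rank_one_proj e) x = cinner x e *\<^sub>C e"
  unfolding rank_one_proj_def
  by (subst bounded_linear_Blinfun_apply)
    (intro bounded_linear_compose[OF bounded_linear_scaleC_left]
      bounded_bilinear.bounded_linear_left[OF bounded_bilinear_cinner], rule refl)

text \<open>Provides a unit vector of the class at which the diagonal coefficient along
  \<open>e\<close> has the value \<open>1\<close>.\<close>

lemma rank_one_proj_schatten:
  fixes e :: "'h::complex_hilbert_space"
  assumes "norm e = 1" and "0 < p"
  shows "rank_one_proj e \<in> schatten_class p" and "schatten_norm p (rank_one_proj e) = 1"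
proof -
  define S where "S = rank_one_proj e"
  have ee: "cinner e e = 1" using cinner.self_eq[of e] assms by simp
  have lin: "complex_linear_op S"
    by (simp add: S_def complex_linear_op_def cinner.scale_left scaleC_scaleC)
  have comp: "compact_op S"
  proof (rule compact_op_subsetI)
    show "compact ((\<lambda>c. c *\<^sub>C e) ` cball 0 1)"
      by (intro compact_continuous_image linear_continuous_on bounded_linear_scaleC_left compact_cball)
    have "cmod (cinner x e) \<le> 1" if "norm x \<le> 1" for x
      using cinner_cauchy_schwarz[of x e] assms that by simp
    then show "blinfun_apply S ` cball 0 1 \<subseteq> (\<lambda>c. c *\<^sub>C e) ` cball 0 1"
      by (auto simp: S_def)
  qed
  interpret pos_form "op_form S" by (rule pos_form_op_form[OF lin])
  define l where "l = (\<lambda>j::nat. of_bool (j = 0) :: real)"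
  define g where "g = (\<lambda>j::nat. if j = 0 then e else 0)"
  have form: "op_form S x y = cinner x e * cinner e y" for x y
    using cinner_commute[of e y] by (simp add: S_def op_form_def cinner.scale_left cinner.scale_right ee)
  have spec: "spectral_form (op_form S) l g"
  proof
    show "antimono l" by (auto simp: antimono_def l_def)
    show "l \<longlonglongrightarrow> 0"
      by (rule tendsto_eventually, unfold eventually_sequentially, rule exI[of _ 1]) (simp add: l_def)
    show "cinner (g i) (g j) = of_bool (i = j \<and> 0 < l i)" for i j
      by (auto simp: g_def l_def ee)
    show "op_form S (g j) h = of_real (l j) * cinner (g j) h" for j h
      by (auto simp: g_def l_def form ee)
    show "Re (op_form S h h) \<le> l n * (norm h)\<^sup>2" if "\<And>i. i < n \<Longrightarrow> cinner h (g i) = 0" for n h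
    proof (cases n)
      case 0
      have "(norm (blinfun_apply S h))\<^sup>2 \<le> (norm h)\<^sup>2"
        using cinner_cauchy_schwarz[of h e] assms by (intro power_mono) (auto simp: S_def norm_scaleC)
      then show ?thesis by (simp add: Re_op_form l_def 0)
    next
      case (Suc m)
      then have "cinner h e = 0" using that[of 0] by (simp add: g_def)
      then show ?thesis by (simp add: form l_def Suc)
    qed
  qed
  have sums: "(\<lambda>j. l j powr (p / 2)) sums 1"
  proof -
    have "(\<lambda>j. l j powr (p / 2)) = (\<lambda>j. if j = 0 then 1 else 0)" by (auto simp: l_def)
    then show ?thesis using sums_single[of 0 "\<lambda>_. 1 :: real"] by simp
  qed
  have summ: "summable (\<lambda>j. l j powr (p / 2))" and sum: "(\<Sum>j. l j powr (p / 2)) = 1"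
    by (fact sums_summable[OF sums], fact sums_unique[OF sums, symmetric])
  show "rank_one_proj e \<in> schatten_class p"
    using schatten_class_iff[OF lin comp spec] summ by (simp add: S_def)
  have "schatten_norm p S powr p = 1"
    using schatten_norm_powr[OF lin spec assms(2) summ] sum by simp
  then have "(schatten_norm p S powr p) powr (1 / p) = 1" by simp
  then show "schatten_norm p (rank_one_proj e) = 1"
    using assms(2) by (simp add: powr_powr schatten_norm_nonneg S_def)
qed

text \<open>Gram-Schmidt, steered by a dimension count: \<open>n\<close> independent vectors cannot
  all lie in the span of \<open>m < n\<close> vectors, so some \<open>b\<close> extends the
  family.\<close>

lemma orthonormal_family_exists:
  assumes "cdim_at_least TYPE('h::complex_hilbert_space) n"
  shows "\<exists>e :: nat \<Rightarrow> 'h. orthofamily e \<and> (\<forall>i. e i \<noteq> 0 \<longleftrightarrow> i < n)"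
proof -
  obtain B :: "'h set" where B: "finite B" "card B = n" "\<not> cdependent B"
    using assms by (auto simp: cdim_at_least_def)
  have "m \<le> n \<Longrightarrow> \<exists>e :: nat \<Rightarrow> 'h. orthofamily e \<and> (\<forall>i. e i \<noteq> 0 \<longleftrightarrow> i < m)" for m
  proof (induction m)
    case 0
    show ?case by (intro exI[of _ "\<lambda>_. 0"] conjI orthofamily.intro) simp_all
  next
    case (Suc m)
    then obtain e :: "nat \<Rightarrow> 'h" where e: "orthofamily e" and e0: "\<forall>i. e i \<noteq> 0 \<longleftrightarrow> i < m"
      by (meson Suc_leD)
    interpret orthofamily e by (rule e)
    have "\<not> B \<subseteq> cspan (e ` {..<m})"
    proof
      assume "B \<subseteq> cspan (e ` {..<m})"
      then have "card B \<le> card (e ` {..<m})"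
        using complex_vector.independent_span_bound[of "e ` {..<m}" B] B(3) by simp
      also have "\<dots> \<le> m" using card_image_le[of "{..<m}" e] by simp
      finally show False using Suc.prems B(2) by simp
    qed
    then obtain b where b: "b \<notin> cspan (e ` {..<m})" by blast
    define r where "r = resid m b"
    have "(\<Sum>i<m. cinner b (e i) *\<^sub>C e i) \<in> cspan (e ` {..<m})"
      by (intro complex_vector.span_sum complex_vector.span_scale complex_vector.span_base imageI)
    then have "r \<noteq> 0" using b by (auto simp: r_def resid_def)
    define u where "u = complex_of_real (1 / norm r) *\<^sub>C r"
    have nu: "norm u = 1" using \<open>r \<noteq> 0\<close> by (simp add: u_def norm_scaleC norm_divide)
    then have uu: "cinner u u = 1" using cinner.self_eq[of u] by simp
    have ue: "cinner u (e j) = 0" for j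
    proof (cases "j < m")
      case True
      then show ?thesis unfolding u_def r_def cinner.scale_left by (simp add: resid_orth)
    next
      case False
      then have "e j = 0" using e0 by blast
      then show ?thesis by simp
    qed
    have eu: "cinner (e j) u = 0" for j
      by (subst cinner_commute) (simp add: ue)
    have "u \<noteq> 0" using nu by (metis norm_zero zero_neq_one)
    then have "orthofamily (e(m := u))"
      by unfold_locales (simp add: orthonormal ue eu uu)
    moreover have "\<forall>i. (e(m := u)) i \<noteq> 0 \<longleftrightarrow> i < Suc m"
    proof
      show "(e(m := u)) i \<noteq> 0 \<longleftrightarrow> i < Suc m" for i
        using e0[rule_format, of i] \<open>u \<noteq> 0\<close> by (cases "i = m") (simp_all add: less_Suc_eq)
    qed
    ultimately show ?case by (intro exI[of _ "e(m := u)"] conjI)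
  qed
  from this[of n] show ?thesis by simp
qed

section \<open>Products of homogeneous polynomials\<close>

lemma poly_circle_max:
  fixes F :: "complex poly"
  shows "\<exists>w. cmod w = 1 \<and> cmod (poly F 0) \<le> cmod (poly F w)"
proof -
  have "compact (sphere (0::complex) 1)" "sphere (0::complex) 1 \<noteq> {}" by simp_all
  moreover have "continuous_on (sphere 0 1) (\<lambda>v. cmod (poly F v))"
    by (intro continuous_intros)
  ultimately obtain w where w: "w \<in> sphere 0 1" "\<And>v. v \<in> sphere 0 1 \<Longrightarrow> cmod (poly F v) \<le> cmod (poly F w)"
    using continuous_attains_sup[of "sphere (0::complex) 1" "\<lambda>v. cmod (poly F v)"] by blast
  have "cmod (poly F 0) \<le> cmod (poly F w)"
  proof (rule maximum_modulus_frontier[where f = "poly F" and S = "ball 0 1"])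
    show "poly F holomorphic_on interior (ball 0 1)"
      by (intro holomorphic_intros)
    show "continuous_on (closure (ball 0 1)) (poly F)" by (intro continuous_intros)
    show "cmod (poly F v) \<le> cmod (poly F w)" if "v \<in> frontier (ball 0 1)" for v
      using that w(2) by simp
  qed simp_all
  then show ?thesis using w(1) by auto
qed

text \<open>Only the slots below \<open>m\<close> hold the moving point; the tuple \<open>t\<close>
  in the others is left general because expanding slot \<open>m\<close> puts \<open>y\<close> or
  \<open>x\<close> into it, the latter with a factor \<open>w\<close>.\<close>

lemma multilinear_on_poly:
  assumes T: "multilinear_on X k T" and xy: "x \<in> X" "y \<in> X"
    and X: "\<And>w. y + w *\<^sub>C x \<in> X" "\<And>w. w *\<^sub>C x \<in> X"
    and "m \<le> k" and "t \<in> {..<k} \<rightarrow>\<^sub>E X"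
  shows "\<exists>q. \<forall>w. T (\<lambda>i. if i < m then y + w *\<^sub>C x else t i) = poly q w"
  using assms(6,7)
proof (induction m arbitrary: t)
  case 0
  show ?case by (intro exI[of _ "[:T t:]"]) simp
next
  case (Suc m)
  have t: "t(m := y) \<in> {..<k} \<rightarrow>\<^sub>E X" "t(m := x) \<in> {..<k} \<rightarrow>\<^sub>E X"
    using Suc.prems xy by (auto simp: PiE_iff extensional_def)
  obtain q1 where q1: "\<And>w. T (\<lambda>i. if i < m then y + w *\<^sub>C x else (t(m := y)) i) = poly q1 w"
    using Suc.IH[OF _ t(1)] Suc.prems(1) by auto
  obtain q2 where q2: "\<And>w. T (\<lambda>i. if i < m then y + w *\<^sub>C x else (t(m := x)) i) = poly q2 w"
    using Suc.IH[OF _ t(2)] Suc.prems(1) by auto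
  have "T (\<lambda>i. if i < Suc m then y + w *\<^sub>C x else t i) = poly (q1 + pCons 0 q2) w" for w
  proof -
    define u where "u = (\<lambda>i. if i < m then y + w *\<^sub>C x else t i)"
    have u: "u \<in> {..<k} \<rightarrow>\<^sub>E X"
      using Suc.prems X by (auto simp: u_def PiE_iff extensional_def)
    have eqs: "(\<lambda>i. if i < Suc m then y + w *\<^sub>C x else t i) = u(m := y + w *\<^sub>C x)"
      "u(m := y) = (\<lambda>i. if i < m then y + w *\<^sub>C x else (t(m := y)) i)"
      "u(m := x) = (\<lambda>i. if i < m then y + w *\<^sub>C x else (t(m := x)) i)"
      by (auto simp: u_def fun_eq_iff)
    have "T (u(m := y + w *\<^sub>C x)) = T (u(m := y)) + w * T (u(m := x))"
      using T u Suc.prems(1) xy X unfolding multilinear_on_def by (metis Suc_le_lessD)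
    then show ?thesis by (simp add: eqs q1 q2)
  qed
  then show ?case by blast
qed

lemma multilinear_on_scale:
  assumes T: "multilinear_on X k T" and x: "x \<in> X" "a *\<^sub>C x \<in> X"
    and "m \<le> k" and "t \<in> {..<k} \<rightarrow>\<^sub>E X"
  shows "T (\<lambda>i. if i < m then a *\<^sub>C x else t i) = a ^ m * T (\<lambda>i. if i < m then x else t i)"
  using assms(4,5)
proof (induction m arbitrary: t)
  case (Suc m)
  have t: "t(m := x) \<in> {..<k} \<rightarrow>\<^sub>E X"
    using Suc.prems x by (auto simp: PiE_iff extensional_def)
  define u where "u = (\<lambda>i. if i < m then a *\<^sub>C x else t i)"
  have u: "u \<in> {..<k} \<rightarrow>\<^sub>E X"
    using Suc.prems x by (auto simp: u_def PiE_iff extensional_def)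
  have eqs: "(\<lambda>i. if i < Suc m then a *\<^sub>C x else t i) = u(m := a *\<^sub>C x)"
    "u(m := x) = (\<lambda>i. if i < m then a *\<^sub>C x else (t(m := x)) i)"
    "(\<lambda>i. if i < Suc m then x else t i) = (\<lambda>i. if i < m then x else (t(m := x)) i)"
    by (auto simp: u_def fun_eq_iff)
  have "T (u(m := a *\<^sub>C x)) = a * T (u(m := x))"
    using T u Suc.prems(1) x unfolding multilinear_on_def by (metis Suc_le_lessD)
  then show ?case using Suc.IH[OF _ t] Suc.prems(1) by (simp add: eqs)
qed simp

text \<open>The properties of a Schatten class on which the lower bound rests. Definiteness of
  \<open>N\<close> is not among them, hence the clause for \<open>N z = 0\<close> in
  \<open>hom_poly_bounded\<close>.\<close>

locale clarkson_space =
  fixes X :: "'a::complex_vector set" and N :: "'a \<Rightarrow> real" and p :: real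
  assumes zero_mem: "0 \<in> X" and add_mem: "x \<in> X \<Longrightarrow> y \<in> X \<Longrightarrow> x + y \<in> X"
    and scale_mem: "x \<in> X \<Longrightarrow> a *\<^sub>C x \<in> X"
    and N_nonneg: "0 \<le> N x" and N_scale: "x \<in> X \<Longrightarrow> N (a *\<^sub>C x) = cmod a * N x"
    and p_pos: "0 < p"
    and clarkson: "x \<in> X \<Longrightarrow> y \<in> X \<Longrightarrow>
      N (x + y) powr p + N (x - y) powr p \<le> 2 * (N x powr p + N y powr p)"
begin

lemma hom_poly_scale:
  assumes "homogeneous_polynomial X N k P" and x: "x \<in> X"
  shows "P (a *\<^sub>C x) = a ^ k * P x"
proof -
  obtain T where T: "multilinear_on X k T" "\<And>x. x \<in> X \<Longrightarrow> P x = T (\<lambda>i\<in>{..<k}. x)"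
    using assms(1) by (auto simp: homogeneous_polynomial_def)
  have "(\<lambda>i\<in>{..<k}. x) \<in> {..<k} \<rightarrow>\<^sub>E X" using x by auto
  from multilinear_on_scale[OF T(1) x scale_mem[OF x] order_refl this, of a]
  show ?thesis using T(2)[OF x] T(2)[OF scale_mem[OF x]] by (simp add: restrict_def cong: if_cong)
qed

lemma hom_poly_line:
  assumes "homogeneous_polynomial X N k P" and x: "x \<in> X" and y: "y \<in> X"
  shows "\<exists>q. \<forall>w. P (y + w *\<^sub>C x) = poly q w"
proof -
  obtain T where T: "multilinear_on X k T" "\<And>x. x \<in> X \<Longrightarrow> P x = T (\<lambda>i\<in>{..<k}. x)"
    using assms(1) by (auto simp: homogeneous_polynomial_def)
  have t: "(\<lambda>i\<in>{..<k}. x) \<in> {..<k} \<rightarrow>\<^sub>E X" using x by auto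
  have X: "y + w *\<^sub>C x \<in> X" for w using x y add_mem scale_mem by blast
  from multilinear_on_poly[OF T(1) x y X scale_mem[OF x] order_refl t]
  show ?thesis using T(2)[OF X] by (simp add: restrict_def cong: if_cong)
qed

text \<open>Continuity at \<open>0\<close> bounds \<open>P\<close> by \<open>1\<close> on a ball of
  radius \<open>d\<close>, and homogeneity carries a bound to the unit sphere. If
  \<open>N z = 0\<close>, all multiples of \<open>z\<close> lie in that ball, where a nonzero
  \<open>P z\<close> would grow beyond \<open>1\<close> by homogeneity.\<close>

lemma hom_poly_bounded:
  assumes P: "homogeneous_polynomial X N k P" and k: "1 \<le> k"
  shows "\<exists>M. \<forall>z\<in>X. N z = 1 \<longrightarrow> cmod (P z) \<le> M"
    and "z \<in> X \<Longrightarrow> N z = 0 \<Longrightarrow> P z = 0"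
proof -
  obtain T where T: "continuous_tuple_map X N k T" "\<And>x. x \<in> X \<Longrightarrow> P x = T (\<lambda>i\<in>{..<k}. x)"
    using P by (auto simp: homogeneous_polynomial_def)
  have P0: "P 0 = 0"
    using hom_poly_scale[OF P zero_mem, of 0] k by (simp add: power_0_left)
  have t0: "(\<lambda>i\<in>{..<k}. 0) \<in> {..<k} \<rightarrow>\<^sub>E X" using zero_mem by auto
  from T(1)[unfolded continuous_tuple_map_def, rule_format, OF t0 zero_less_one]
  obtain d where d: "d > 0" "\<And>y. y \<in> {..<k} \<rightarrow>\<^sub>E X \<Longrightarrow>
      (\<And>i. i < k \<Longrightarrow> N (y i - (\<lambda>i\<in>{..<k}. 0) i) < d) \<Longrightarrow> cmod (T y - T (\<lambda>i\<in>{..<k}. 0)) < 1"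
    by auto
  have small: "cmod (P y) < 1" if "y \<in> X" "N y < d" for y
    using d(2)[of "\<lambda>i\<in>{..<k}. y"] that T(2)[OF that(1)] T(2)[OF zero_mem] P0 by simp
  have "cmod (P z) \<le> (2 / d) ^ k" if z: "z \<in> X" "N z = 1" for z
  proof -
    define a where "a = complex_of_real (d / 2)"
    have "cmod (P (a *\<^sub>C z)) < 1"
      using z d(1) by (intro small scale_mem) (simp_all add: N_scale a_def norm_divide)
    then have "(d / 2) ^ k * cmod (P z) < 1"
      using d(1) by (simp add: hom_poly_scale[OF P z(1)] norm_mult norm_power a_def norm_divide)
    then show ?thesis using d(1) by (simp add: power_divide field_simps)
  qed
  then show "\<exists>M. \<forall>z\<in>X. N z = 1 \<longrightarrow> cmod (P z) \<le> M" by blast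
  show "P z = 0" if z: "z \<in> X" "N z = 0" for z
  proof (rule ccontr)
    assume nz: "P z \<noteq> 0"
    define t where "t = 1 + 1 / cmod (P z)"
    have t: "t \<ge> 1" "t * cmod (P z) > 1" using nz by (simp_all add: t_def field_simps)
    have "t \<le> t ^ k" using t(1) k by (metis power_increasing power_one_right)
    then have "t * cmod (P z) \<le> t ^ k * cmod (P z)" by (rule mult_right_mono) simp
    moreover have "cmod (P (complex_of_real t *\<^sub>C z)) < 1"
      using z d(1) by (intro small scale_mem) (simp_all add: N_scale)
    then have "t ^ k * cmod (P z) < 1"
      using t(1) by (simp add: hom_poly_scale[OF P z(1)] norm_mult norm_power)
    ultimately show False using t(2) by linarith
  qed
qed

text \<open>
  For \<open>\<bar>w\<bar> = 1\<close> homogeneity gives \<open>\<bar>R (y + w x)\<bar> = \<bar>R (x + cnj w y)\<bar>\<close>, so up to modulus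
  \<open>Q (y + w x) R (y + w x)\<close> is a polynomial \<open>f w\<close> with \<open>\<bar>f 0\<bar> = \<bar>Q y R x\<bar>\<close>. The maximum
  principle is applied to \<open>f w * f (- w)\<close>, and Clarkson's inequality controls the two
  exponential factors together.
\<close>

lemma add_vector_step:
  assumes R: "homogeneous_polynomial X N k R" and x: "x \<in> X" and y: "y \<in> X"
    and Q: "\<And>w. Q (y + w *\<^sub>C x) = poly q w" and "0 \<le> \<alpha>"
  shows "\<exists>w. cmod (Q y) * exp (- \<alpha> * N y powr p) * (cmod (R x) * exp (- \<alpha> * N x powr p))
    \<le> cmod (Q (y + w *\<^sub>C x)) * cmod (R (y + w *\<^sub>C x)) * exp (- \<alpha> * N (y + w *\<^sub>C x) powr p)"
proof -
  obtain r where r: "\<And>w. R (x + w *\<^sub>C y) = poly r w"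
    using hom_poly_line[OF R y x] by blast
  \<comment> \<open>Conjugating the coefficients of \<open>r\<close> makes its value at
    \<open>cnj w\<close>, up to conjugation, a polynomial in \<open>w\<close>; the remaining factor
    \<open>w ^ k\<close> has modulus \<open>1\<close>.\<close>
  define f where "f = q * map_poly cnj r"
  define E where "E = (\<lambda>w. exp (- \<alpha> * N (y + w *\<^sub>C x) powr p))"
  have f0: "cmod (poly f 0) = cmod (Q y) * cmod (R x)"
    using Q[of 0] r[of 0] by (simp add: f_def norm_mult)
  have fw: "cmod (poly f w) = cmod (Q (y + w *\<^sub>C x)) * cmod (R (y + w *\<^sub>C x))" if "cmod w = 1" for w
  proof -
    have "w * cnj w = 1" using complex_norm_square[of w] that by simp
    then have "w *\<^sub>C (x + cnj w *\<^sub>C y) = y + w *\<^sub>C x"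
      by (simp add: scaleC_add_right scaleC_scaleC add.commute)
    then have "R (y + w *\<^sub>C x) = w ^ k * poly r (cnj w)"
      using hom_poly_scale[OF R add_mem[OF x scale_mem[OF y]], of w "cnj w"] r by simp
    then show ?thesis using that by (simp add: f_def norm_mult norm_power Q)
  qed
  obtain w where w: "cmod w = 1" "cmod (poly (f * pcompose f [:0, -1:]) 0) \<le> cmod (poly (f * pcompose f [:0, -1:]) w)"
    using poly_circle_max by blast
  have mod: "cmod (poly f 0) * cmod (poly f 0) \<le> cmod (poly f w) * cmod (poly f (- w))"
    using w(2) by (simp add: poly_pcompose norm_mult)
  define A where "A = cmod (Q y) * exp (- \<alpha> * N y powr p) * (cmod (R x) * exp (- \<alpha> * N x powr p))"
  have A: "A = cmod (poly f 0) * exp (- \<alpha> * (N y powr p + N x powr p))"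
    by (simp add: A_def f0 distrib_left exp_add exp_diff exp_minus field_simps)
  have "N (y + w *\<^sub>C x) powr p + N (y + (- w) *\<^sub>C x) powr p \<le> 2 * (N y powr p + N x powr p)"
    using clarkson[OF y scale_mem[OF x], of w] N_scale[OF x, of w] w(1)
    by (simp add: complex_vector.scale_minus_left)
  from mult_left_mono[OF this \<open>0 \<le> \<alpha>\<close>]
  have exps: "exp (- \<alpha> * (N y powr p + N x powr p)) * exp (- \<alpha> * (N y powr p + N x powr p)) \<le> E w * E (- w)"
    unfolding E_def exp_add[symmetric] exp_le_cancel_iff by (simp add: algebra_simps)
  have "A * A \<le> (cmod (poly f w) * E w) * (cmod (poly f (- w)) * E (- w))"
    using mult_mono[OF mod exps] by (simp add: A mult_ac)
  \<comment> \<open>One of the signs must do: if \<open>A\<close> exceeded both factors,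
    \<open>A * A\<close> would exceed their product.\<close>
  then have "A \<le> cmod (poly f w) * E w \<or> A \<le> cmod (poly f (- w)) * E (- w)"
    by (smt (verit) A_def E_def exp_ge_zero mult_strict_mono norm_ge_zero mult_nonneg_nonneg)
  moreover have "cmod (- w) = 1" using w(1) by simp
  ultimately show ?thesis
    unfolding A_def[symmetric] using fw w(1) unfolding E_def by metis
qed

lemma greedy_sum:
  fixes m :: nat
  assumes P: "\<And>i. i \<in> {1..m} \<Longrightarrow> homogeneous_polynomial X N (k i) (P i)"
    and x: "\<And>i. i \<in> {1..m} \<Longrightarrow> x i \<in> X" and "0 \<le> \<alpha>"
  shows "\<exists>y\<in>X. (\<Prod>i=1..m. cmod (P i (x i)) * exp (- \<alpha> * N (x i) powr p))
    \<le> (\<Prod>i=1..m. cmod (P i y)) * exp (- \<alpha> * N y powr p)"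
  using P x
proof (induction m)
  case 0
  \<comment> \<open>The sum starts at \<open>0\<close>; as \<open>N 0 = 0\<close>, both sides are
    \<open>1\<close>.\<close>
  show ?case using zero_mem N_scale[OF zero_mem, of 0] by (intro bexI[of _ 0]) simp_all
next
  case (Suc m)
  have "\<exists>y\<in>X. (\<Prod>i=1..m. cmod (P i (x i)) * exp (- \<alpha> * N (x i) powr p))
    \<le> (\<Prod>i=1..m. cmod (P i y)) * exp (- \<alpha> * N y powr p)"
    using Suc.prems by (intro Suc.IH) auto
  then obtain y where y: "y \<in> X"
    and le: "(\<Prod>i=1..m. cmod (P i (x i)) * exp (- \<alpha> * N (x i) powr p))
      \<le> (\<Prod>i=1..m. cmod (P i y)) * exp (- \<alpha> * N y powr p)" by blast
  have xm: "x (Suc m) \<in> X" and R: "homogeneous_polynomial X N (k (Suc m)) (P (Suc m))"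
    using Suc.prems by auto
  \<comment> \<open>The polynomials treated so far act together as \<open>Q\<close>;
    \<open>add_vector_step\<close> asks of them only that they restrict to a polynomial on the line
    through \<open>y\<close>.\<close>
  define Q where "Q = (\<lambda>z. \<Prod>i=1..m. P i z)"
  have "\<forall>i. \<exists>q. i \<in> {1..m} \<longrightarrow> (\<forall>w. P i (y + w *\<^sub>C x (Suc m)) = poly q w)"
    using hom_poly_line[OF Suc.prems(1) xm y] by auto
  from choice[OF this] obtain q where
    q: "\<And>i w. i \<in> {1..m} \<Longrightarrow> P i (y + w *\<^sub>C x (Suc m)) = poly (q i) w" by blast
  have Q: "Q (y + w *\<^sub>C x (Suc m)) = poly (\<Prod>i=1..m. q i) w" for w
    unfolding Q_def poly_prod by (intro prod.cong) (simp_all add: q)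
  obtain w where w: "cmod (Q y) * exp (- \<alpha> * N y powr p)
      * (cmod (P (Suc m) (x (Suc m))) * exp (- \<alpha> * N (x (Suc m)) powr p))
    \<le> cmod (Q (y + w *\<^sub>C x (Suc m))) * cmod (P (Suc m) (y + w *\<^sub>C x (Suc m)))
      * exp (- \<alpha> * N (y + w *\<^sub>C x (Suc m)) powr p)"
    using add_vector_step[OF R xm y Q \<open>0 \<le> \<alpha>\<close>] by blast
  have "(\<Prod>i=1..Suc m. cmod (P i (x i)) * exp (- \<alpha> * N (x i) powr p))
      \<le> cmod (Q y) * exp (- \<alpha> * N y powr p)
      * (cmod (P (Suc m) (x (Suc m))) * exp (- \<alpha> * N (x (Suc m)) powr p))"
    using mult_right_mono[OF le, of "cmod (P (Suc m) (x (Suc m))) * exp (- \<alpha> * N (x (Suc m)) powr p)"]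
    by (simp add: Q_def prod_norm)
  also note w
  finally have "(\<Prod>i=1..Suc m. cmod (P i (x i)) * exp (- \<alpha> * N (x i) powr p))
    \<le> (\<Prod>i=1..Suc m. cmod (P i (y + w *\<^sub>C x (Suc m)))) * exp (- \<alpha> * N (y + w *\<^sub>C x (Suc m)) powr p)"
    by (simp add: Q_def prod_norm norm_mult)
  then show ?case using add_mem[OF y scale_mem[OF xm]] by blast
qed

end

section \<open>The optimal constant and bounds for polynomial norms\<close>

lemma powr_power_commute: "(x powr a) ^ k = (x ^ k) powr (a::real)" for x :: real
  by (induction k) (simp_all add: powr_mult)

definition opt_const :: "real \<Rightarrow> nat \<Rightarrow> (nat \<Rightarrow> nat) \<Rightarrow> real" where
  "opt_const p n k = ((\<Prod>i=1..n. real (k i) ^ k i) / real (\<Sum>i=1..n. k i) ^ (\<Sum>i=1..n. k i)) powr (1 / p)"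

lemma opt_const_pos:
  assumes "1 \<le> n" and k: "\<And>i. i \<in> {1..n} \<Longrightarrow> 1 \<le> k i"
  shows "0 < opt_const p n k"
proof -
  have K: "0 < (\<Sum>i=1..n. k i)" using assms by (intro sum_pos) (auto simp: Suc_le_eq)
  have "0 < (\<Prod>i=1..n. real (k i) ^ k i)" using k by (intro prod_pos) fastforce
  moreover have "0 < real (\<Sum>i=1..n. k i) ^ (\<Sum>i=1..n. k i)"
    using K by (simp only: of_nat_0_less_iff zero_less_power)
  ultimately show ?thesis
    unfolding opt_const_def by (subst powr_gt_zero) (metis divide_pos_pos less_irrefl)
qed

text \<open>Exhibits the constant as the product of the \<open>r i ^ k i\<close> in
  \<open>product_at_points\<close>, the form in which homogeneity produces it.\<close>

lemma opt_const_eq_prod: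
  "opt_const p n k = (\<Prod>i=1..n. ((real (k i) / real (\<Sum>i=1..n. k i)) powr (1 / p)) ^ k i)"
proof -
  define K where "K = (\<Sum>i=1..n. k i)"
  have "(\<Prod>i=1..n. ((real (k i) / real K) powr (1 / p)) ^ k i) = (\<Prod>i=1..n. (real (k i) / real K) ^ k i) powr (1 / p)"
    unfolding powr_power_commute prod_powr_distrib ..
  also have "(\<Prod>i=1..n. (real (k i) / real K) ^ k i) = (\<Prod>i=1..n. real (k i) ^ k i) / real K ^ K"
    by (simp add: power_divide prod_dividef power_sum[symmetric] K_def)
  finally show ?thesis unfolding opt_const_def K_def by simp
qed

text \<open>The right-hand side is the maximum over the simplex, taken at
  \<open>u i = k i / K\<close>. Multiplying \<open>t \<le> exp (t - 1)\<close> for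
  \<open>t = u i * K / k i\<close>, each raised to the power \<open>k i\<close>, makes the exponents
  add up to at most \<open>0\<close>.\<close>

lemma weighted_amgm:
  fixes u :: "nat \<Rightarrow> real"
  assumes k: "\<And>i. i \<in> {1..n} \<Longrightarrow> 1 \<le> k i"
    and u: "\<And>i. i \<in> {1..n} \<Longrightarrow> 0 \<le> u i" and u1: "(\<Sum>i=1..n. u i) \<le> 1"
  shows "(\<Prod>i=1..n. u i ^ k i) \<le> (\<Prod>i=1..n. real (k i) ^ k i) / real (\<Sum>i=1..n. k i) ^ (\<Sum>i=1..n. k i)"
proof -
  define K where "K = (\<Sum>i=1..n. k i)"
  have "(\<Prod>i=1..n. (u i * real K / real (k i)) ^ k i) \<le> (\<Prod>i=1..n. exp (real K * u i - real (k i)))"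
  proof (rule prod_mono)
    fix i assume i: "i \<in> {1..n}"
    then have ki: "real (k i) > 0" using k[OF i] by simp
    have "u i * real K / real (k i) \<le> exp (u i * real K / real (k i) - 1)"
      using exp_ge_add_one_self[of "u i * real K / real (k i) - 1"] by simp
    then have "(u i * real K / real (k i)) ^ k i \<le> exp (u i * real K / real (k i) - 1) ^ k i"
      using u[OF i] by (intro power_mono) auto
    also have "\<dots> = exp (real K * u i - real (k i))"
      using ki by (simp add: exp_of_nat_mult[symmetric] algebra_simps)
    finally show "0 \<le> (u i * real K / real (k i)) ^ k i \<and>
        (u i * real K / real (k i)) ^ k i \<le> exp (real K * u i - real (k i))"
      using u[OF i] by simp
  qed
  also have "\<dots> = exp (real K * (\<Sum>i=1..n. u i) - real K)"
    by (simp add: exp_sum[symmetric] sum_subtractf sum_distrib_left[symmetric] K_def)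
  also have "\<dots> \<le> 1"
    using mult_left_mono[OF u1, of "real K"] by simp
  finally have "(\<Prod>i=1..n. (u i * real K / real (k i)) ^ k i) \<le> 1" .
  moreover have "(\<Prod>i=1..n. (u i * real K / real (k i)) ^ k i)
      = (\<Prod>i=1..n. u i ^ k i) * real K ^ K / (\<Prod>i=1..n. real (k i) ^ k i)"
    by (simp add: power_divide power_mult_distrib prod_dividef prod.distrib power_sum[symmetric] K_def)
  moreover have "0 < (\<Prod>i=1..n. real (k i) ^ k i)" using k by (intro prod_pos) fastforce
  ultimately have le: "(\<Prod>i=1..n. u i ^ k i) * real K ^ K \<le> (\<Prod>i=1..n. real (k i) ^ k i)"
    by simp
  have "0 < real K ^ K" by (cases "K = 0") auto
  with le show ?thesis unfolding K_def[symmetric] by (subst pos_le_divide_eq)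
qed

text \<open>The bound \<open>M\<close> guarantees that the \<open>Sup\<close> in
  \<open>polynomial_norm\<close> is a true supremum.\<close>

lemma polynomial_norm_upper:
  assumes "\<And>z. z \<in> X \<Longrightarrow> N z = 1 \<Longrightarrow> cmod (P z) \<le> M" and "z \<in> X" "N z = 1"
  shows "cmod (P z) \<le> polynomial_norm X N P"
  unfolding polynomial_norm_def
proof (rule cSup_upper)
  show "bdd_above (insert 0 {cmod (P z) |z. z \<in> X \<and> N z = 1})"
    using assms(1) by (intro bdd_aboveI[of _ "max 0 M"]) (auto simp: le_max_iff_disj)
qed (use assms in auto)

lemma polynomial_norm_le:
  assumes "0 \<le> M" and "\<And>z. z \<in> X \<Longrightarrow> N z = 1 \<Longrightarrow> cmod (P z) \<le> M"
  shows "polynomial_norm X N P \<le> M"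
  unfolding polynomial_norm_def using assms by (intro cSup_least) auto

lemma polynomial_norm_nonneg:
  assumes "\<And>z. z \<in> X \<Longrightarrow> N z = 1 \<Longrightarrow> cmod (P z) \<le> M"
  shows "0 \<le> polynomial_norm X N P"
  unfolding polynomial_norm_def
proof (rule cSup_upper)
  show "bdd_above (insert 0 {cmod (P z) |z. z \<in> X \<and> N z = 1})"
    using assms by (intro bdd_aboveI[of _ "max 0 M"]) (auto simp: le_max_iff_disj)
qed simp

text \<open>\<open>0 \<le> a\<close> keeps the element above \<open>a\<close> from being the
  \<open>0\<close> inserted in \<open>polynomial_norm\<close>.\<close>

lemma polynomial_norm_approx:
  assumes "0 \<le> a" "a < polynomial_norm X N P"
  shows "\<exists>z\<in>X. N z = 1 \<and> a < cmod (P z)"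
proof -
  obtain s where "s \<in> insert 0 {cmod (P z) |z. z \<in> X \<and> N z = 1}" "a < s"
    using less_cSupE[OF assms(2)[unfolded polynomial_norm_def]] by auto
  then show ?thesis using assms(1) by auto
qed

context clarkson_space
begin

lemma product_bounded:
  assumes P: "\<And>i. i \<in> {1..n} \<Longrightarrow> homogeneous_polynomial X N (k i) (P i)"
    and k: "\<And>i. i \<in> {1..n} \<Longrightarrow> 1 \<le> k i"
  shows "\<exists>M. \<forall>z\<in>X. N z = 1 \<longrightarrow> cmod (\<Prod>i=1..n. P i z) \<le> M"
proof -
  have "\<forall>i. \<exists>M. i \<in> {1..n} \<longrightarrow> (\<forall>z\<in>X. N z = 1 \<longrightarrow> cmod (P i z) \<le> M)"
    using hom_poly_bounded(1)[OF P k] by blast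
  from choice[OF this] obtain M where
    M: "\<And>i z. i \<in> {1..n} \<Longrightarrow> z \<in> X \<Longrightarrow> N z = 1 \<Longrightarrow> cmod (P i z) \<le> M i" by blast
  have "cmod (\<Prod>i=1..n. P i z) \<le> (\<Prod>i=1..n. M i)" if "z \<in> X" "N z = 1" for z
    unfolding prod_norm[symmetric] using M that by (intro prod_mono) auto
  then show ?thesis by blast
qed

lemma product_at_points:
  assumes P: "\<And>i. i \<in> {1..n} \<Longrightarrow> homogeneous_polynomial X N (k i) (P i)"
    and k: "\<And>i. i \<in> {1..n} \<Longrightarrow> 1 \<le> k i" and "1 \<le> n"
    and x: "\<And>i. i \<in> {1..n} \<Longrightarrow> x i \<in> X \<and> N (x i) = 1"
    and nz: "\<And>i. i \<in> {1..n} \<Longrightarrow> P i (x i) \<noteq> 0"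
  shows "opt_const p n k * (\<Prod>i=1..n. cmod (P i (x i))) \<le> polynomial_norm X N (\<lambda>z. \<Prod>i=1..n. P i z)"
proof -
  define K where "K = (\<Sum>i=1..n. k i)"
  have "0 < K" unfolding K_def using k \<open>1 \<le> n\<close> by (intro sum_pos) (auto simp: Suc_le_eq)
  \<comment> \<open>The \<open>p\<close>-th powers of these radii sum to \<open>1\<close>, so the
    exponentials contribute \<open>exp (- \<alpha>)\<close> in total, which cancels against the
    bound \<open>NK\<close>.\<close>
  define r where "r = (\<lambda>i. (real (k i) / real K) powr (1 / p))"
  have r: "r i > 0" if "i \<in> {1..n}" for i
    using k[OF that] \<open>0 < K\<close> by (simp add: r_def)
  have rp: "r i powr p = real (k i) / real K" for i
    using p_pos by (simp add: r_def powr_powr)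
  define \<alpha> where "\<alpha> = real K / p"
  have "\<alpha> > 0" using p_pos \<open>0 < K\<close> by (simp add: \<alpha>_def)
  define y where "y = (\<lambda>i. complex_of_real (r i) *\<^sub>C x i)"
  have yX: "y i \<in> X" if "i \<in> {1..n}" for i
    unfolding y_def using x[OF that] by (intro scale_mem) simp
  obtain z where z: "z \<in> X" and le: "(\<Prod>i=1..n. cmod (P i (y i)) * exp (- \<alpha> * N (y i) powr p))
    \<le> (\<Prod>i=1..n. cmod (P i z)) * exp (- \<alpha> * N z powr p)"
    using greedy_sum[of n k P y \<alpha>, OF P yX less_imp_le[OF \<open>\<alpha> > 0\<close>]] by blast
  have summand: "cmod (P i (y i)) * exp (- \<alpha> * N (y i) powr p)
      = r i ^ k i * cmod (P i (x i)) * exp (- \<alpha> * (real (k i) / real K))" if "i \<in> {1..n}" for i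
  proof -
    have "N (y i) = r i" using x[OF that] r[OF that] by (simp add: y_def N_scale)
    moreover have "cmod (P i (y i)) = r i ^ k i * cmod (P i (x i))"
      using hom_poly_scale[OF P[OF that]] x[OF that] r[OF that] by (simp add: y_def norm_mult norm_power)
    ultimately show ?thesis by (simp add: rp)
  qed
  have "(\<Prod>i=1..n. cmod (P i (y i)) * exp (- \<alpha> * N (y i) powr p))
      = (\<Prod>i=1..n. r i ^ k i) * (\<Prod>i=1..n. cmod (P i (x i))) * exp (\<Sum>i=1..n. - \<alpha> * (real (k i) / real K))"
    unfolding exp_sum[OF finite_atLeastAtMost] prod.distrib[symmetric] by (intro prod.cong summand refl)
  also have "(\<Prod>i=1..n. r i ^ k i) = opt_const p n k"
    by (simp add: opt_const_eq_prod r_def K_def)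
  also have "(\<Sum>i=1..n. - \<alpha> * (real (k i) / real K)) = - \<alpha>"
  proof -
    have "(\<Sum>i=1..n. - \<alpha> * (real (k i) / real K)) = - \<alpha> * ((\<Sum>i=1..n. real (k i)) / real K)"
      by (simp only: sum_distrib_left sum_divide_distrib)
    also have "(\<Sum>i=1..n. real (k i)) = real K" by (simp add: K_def)
    finally show ?thesis using \<open>0 < K\<close> by simp
  qed
  finally have le': "opt_const p n k * (\<Prod>i=1..n. cmod (P i (x i))) * exp (- \<alpha>)
      \<le> (\<Prod>i=1..n. cmod (P i z)) * exp (- \<alpha> * N z powr p)"
    using le by simp
  have pos: "0 < opt_const p n k * (\<Prod>i=1..n. cmod (P i (x i)))"
    using nz by (intro mult_pos_pos opt_const_pos \<open>1 \<le> n\<close> k prod_pos) auto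
  \<comment> \<open>Needed to normalise \<open>z\<close>. If \<open>N z\<close> were
    \<open>0\<close>, the product at \<open>z\<close> would vanish although the lower bound is
    positive, thanks to \<open>nz\<close>.\<close>
  have Nz: "N z > 0"
  proof (rule ccontr)
    assume "\<not> ?thesis"
    then have "N z = 0" using N_nonneg[of z] by simp
    have "(1::nat) \<in> {1..n}" using \<open>1 \<le> n\<close> by simp
    then have "P 1 z = 0" using hom_poly_bounded(2)[OF P k z \<open>N z = 0\<close>] by blast
    then have "(\<Prod>i=1..n. cmod (P i z)) = 0"
      using \<open>1 \<in> {1..n}\<close> by (intro prod_zero) auto
    then have "opt_const p n k * (\<Prod>i=1..n. cmod (P i (x i))) * exp (- \<alpha>) \<le> 0"
      using le' by (simp only: mult_zero_left)
    moreover have "0 < opt_const p n k * (\<Prod>i=1..n. cmod (P i (x i))) * exp (- \<alpha>)"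
      using pos by (rule mult_pos_pos) simp
    ultimately show False by linarith
  qed
  \<comment> \<open>The maximum of \<open>t ^ K * exp (- \<alpha> * t powr p)\<close> at
    \<open>t = 1\<close>: the inequality \<open>s \<le> exp (s - 1)\<close> for
    \<open>s = N z powr p\<close>, raised to the power \<alpha>.\<close>
  have NK: "N z ^ K \<le> exp (\<alpha> * N z powr p - \<alpha>)"
  proof -
    have "N z powr p \<le> exp (N z powr p - 1)"
      using exp_ge_add_one_self[of "N z powr p - 1"] by simp
    then have "(N z powr p) powr \<alpha> \<le> exp (N z powr p - 1) powr \<alpha>"
      using \<open>\<alpha> > 0\<close> by (intro powr_mono2) auto
    moreover have "(N z powr p) powr \<alpha> = N z ^ K"
      using p_pos Nz by (simp add: powr_powr \<alpha>_def powr_realpow)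
    moreover have "exp (N z powr p - 1) powr \<alpha> = exp (\<alpha> * N z powr p - \<alpha>)"
      by (simp add: powr_def algebra_simps)
    ultimately show ?thesis by simp
  qed
  define c where "c = opt_const p n k * (\<Prod>i=1..n. cmod (P i (x i)))"
  have "c * exp (- \<alpha>) * exp (\<alpha> * N z powr p)
      \<le> (\<Prod>i=1..n. cmod (P i z)) * exp (- \<alpha> * N z powr p) * exp (\<alpha> * N z powr p)"
    using le' unfolding c_def by (rule mult_right_mono) simp
  also have "\<dots> = (\<Prod>i=1..n. cmod (P i z))"
    by (simp add: mult.assoc flip: exp_add)
  also have "c * exp (- \<alpha>) * exp (\<alpha> * N z powr p) = c * exp (\<alpha> * N z powr p - \<alpha>)"
    by (simp add: mult.assoc flip: exp_add)
  finally have "c * exp (\<alpha> * N z powr p - \<alpha>) \<le> (\<Prod>i=1..n. cmod (P i z))" .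
  moreover have "c * N z ^ K \<le> c * exp (\<alpha> * N z powr p - \<alpha>)"
    using NK pos by (intro mult_left_mono) (simp_all add: c_def)
  ultimately have fin: "c * N z ^ K \<le> (\<Prod>i=1..n. cmod (P i z))" by linarith
  define v where "v = complex_of_real (1 / N z) *\<^sub>C z"
  have v: "v \<in> X" "N v = 1"
    using scale_mem[OF z] N_scale[OF z] Nz by (simp_all add: v_def norm_divide)
  have "cmod (\<Prod>i=1..n. P i v) = (\<Prod>i=1..n. (1 / N z) ^ k i * cmod (P i z))"
    unfolding prod_norm[symmetric]
  proof (rule prod.cong)
    show "cmod (P i v) = (1 / N z) ^ k i * cmod (P i z)" if "i \<in> {1..n}" for i
      using hom_poly_scale[OF P[OF that] z] Nz by (simp add: v_def norm_mult norm_power norm_divide)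
  qed simp
  also have "\<dots> = (1 / N z) ^ K * (\<Prod>i=1..n. cmod (P i z))"
    by (simp add: prod.distrib power_sum K_def)
  finally have eq: "cmod (\<Prod>i=1..n. P i v) = (1 / N z) ^ K * (\<Prod>i=1..n. cmod (P i z))" .
  have "c = (1 / N z) ^ K * (c * N z ^ K)" using Nz by (simp add: power_divide)
  also have "\<dots> \<le> cmod (\<Prod>i=1..n. P i v)"
    unfolding eq using fin Nz by (intro mult_left_mono) auto
  finally have "c \<le> cmod (\<Prod>i=1..n. P i v)" .
  moreover have "cmod (\<Prod>i=1..n. P i v) \<le> polynomial_norm X N (\<lambda>z. \<Prod>i=1..n. P i z)"
  proof -
    obtain M where "\<And>z. z \<in> X \<Longrightarrow> N z = 1 \<Longrightarrow> cmod (\<Prod>i=1..n. P i z) \<le> M"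
      using product_bounded[of n k P, OF P k] by blast
    from polynomial_norm_upper[of X N "\<lambda>z. \<Prod>i=1..n. P i z", OF this v] show ?thesis .
  qed
  ultimately show ?thesis by (simp add: c_def)
qed

theorem polynomial_norm_product:
  assumes P: "\<And>i. i \<in> {1..n} \<Longrightarrow> homogeneous_polynomial X N (k i) (P i)"
    and k: "\<And>i. i \<in> {1..n} \<Longrightarrow> 1 \<le> k i" and "1 \<le> n"
  shows "opt_const p n k * (\<Prod>i=1..n. polynomial_norm X N (P i))
    \<le> polynomial_norm X N (\<lambda>z. \<Prod>i=1..n. P i z)"
proof -
  define s where "s = (\<lambda>i. polynomial_norm X N (P i))"
  have s0: "0 \<le> s i" if i: "i \<in> {1..n}" for i
  proof -
    obtain M where "\<And>z. z \<in> X \<Longrightarrow> N z = 1 \<Longrightarrow> cmod (P i z) \<le> M"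
      using hom_poly_bounded(1)[OF P[OF i] k[OF i]] by blast
    then show ?thesis unfolding s_def by (rule polynomial_norm_nonneg)
  qed
  have L0: "0 \<le> polynomial_norm X N (\<lambda>z. \<Prod>i=1..n. P i z)"
  proof -
    obtain M where "\<And>z. z \<in> X \<Longrightarrow> N z = 1 \<Longrightarrow> cmod (\<Prod>i=1..n. P i z) \<le> M"
      using product_bounded[of n k P, OF P k] by blast
    then show ?thesis by (rule polynomial_norm_nonneg)
  qed
  show ?thesis
  proof (cases "\<exists>i\<in>{1..n}. s i = 0")
    case True
    then have "(\<Prod>i=1..n. s i) = 0" by (intro prod_zero) auto
    then show ?thesis using L0 unfolding s_def by (simp only: mult_zero_right)
  next
    case False
    then have s: "0 < s i" if "i \<in> {1..n}" for i using s0[OF that] that by (metis less_le)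
    \<comment> \<open>The suprema may not be attained, so points are chosen up to a factor
      \<open>t < 1\<close>, which tends to \<open>1\<close> afterwards. The strict
      \<open>t * s i < s i\<close> requires \<open>s i > 0\<close>, whence the separate case
      above.\<close>
    have bound: "opt_const p n k * (\<Prod>i=1..n. t * s i) \<le> polynomial_norm X N (\<lambda>z. \<Prod>i=1..n. P i z)"
      if t: "0 \<le> t" "t < 1" for t
    proof -
      have "\<exists>x. i \<in> {1..n} \<longrightarrow> x \<in> X \<and> N x = 1 \<and> t * s i < cmod (P i x)" for i
      proof (cases "i \<in> {1..n}")
        case True
        then have "t * s i < polynomial_norm X N (P i)" "0 \<le> t * s i"
          using s[OF True] t by (simp_all add: s_def)
        then show ?thesis using polynomial_norm_approx[of "t * s i" X N "P i"] by blast
      qed blast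
      then obtain x where x: "\<And>i. i \<in> {1..n} \<Longrightarrow> x i \<in> X \<and> N (x i) = 1 \<and> t * s i < cmod (P i (x i))"
        by metis
      have "opt_const p n k * (\<Prod>i=1..n. t * s i) \<le> opt_const p n k * (\<Prod>i=1..n. cmod (P i (x i)))"
      proof (intro mult_left_mono prod_mono conjI)
        show "t * s i \<le> cmod (P i (x i))" "0 \<le> t * s i" if "i \<in> {1..n}" for i
          using x[OF that] s0[OF that] t by auto
        show "0 \<le> opt_const p n k" by (simp add: opt_const_def)
      qed
      also have "\<dots> \<le> polynomial_norm X N (\<lambda>z. \<Prod>i=1..n. P i z)"
      proof (rule product_at_points[of n k P x, OF P k \<open>1 \<le> n\<close>])
        show "x i \<in> X \<and> N (x i) = 1" if "i \<in> {1..n}" for i using x[OF that] by blast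
        show "P i (x i) \<noteq> 0" if "i \<in> {1..n}" for i
        proof -
          have "0 \<le> t * s i" using t s0[OF that] by simp
          then have "0 < cmod (P i (x i))" using x[OF that] by linarith
          then show ?thesis by simp
        qed
      qed
      finally show ?thesis .
    qed
    have "((\<lambda>m. opt_const p n k * (\<Prod>i=1..n. (1 - 1 / real (Suc m)) * s i))
        \<longlonglongrightarrow> opt_const p n k * (\<Prod>i=1..n. (1 - 0) * s i))"
      using LIMSEQ_inverse_real_of_nat unfolding inverse_eq_divide by (intro tendsto_intros)
    then have "opt_const p n k * (\<Prod>i=1..n. (1 - 0) * s i) \<le> polynomial_norm X N (\<lambda>z. \<Prod>i=1..n. P i z)"
      by (rule LIMSEQ_le_const2) (intro exI[of _ 0] allI impI bound, simp_all)
    then show ?thesis by (simp add: s_def)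
  qed
qed

end

section \<open>Sharpness\<close>

text \<open>A single \<delta> for all factors, as \<open>continuous_tuple_map\<close> asks for. The
  step splits the difference as \<open>(B - A) * b k + A * (b k - a k)\<close> and gives half of
  \<epsilon> to each term; the \<open>+ 1\<close> in the divisors keeps them positive.\<close>

lemma prod_continuous_at:
  fixes a :: "nat \<Rightarrow> complex"
  assumes "0 < \<epsilon>"
  shows "\<exists>\<delta>>0. \<forall>b. (\<forall>i<k. cmod (b i - a i) < \<delta>) \<longrightarrow> cmod ((\<Prod>i<k. b i) - (\<Prod>i<k. a i)) < \<epsilon>"
  using assms
proof (induction k arbitrary: \<epsilon>)
  case 0
  then show ?case by (intro exI[of _ 1]) simp
next
  case (Suc k)
  define A where "A = (\<Prod>i<k. a i)"
  define \<epsilon>1 where "\<epsilon>1 = \<epsilon> / (2 * (cmod (a k) + 1))"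
  have pos: "0 < cmod (a k) + 1" "0 < cmod A + 1" using norm_ge_zero by (smt (verit))+
  have half: "e / (2 * u) * u = e / 2" if "0 < u" for e u :: real
    using that by simp
  have "\<epsilon>1 > 0" using pos Suc.prems by (simp add: \<epsilon>1_def)
  then obtain \<delta>1 where \<delta>1: "\<delta>1 > 0"
    and IH: "\<And>b. (\<And>i. i < k \<Longrightarrow> cmod (b i - a i) < \<delta>1) \<Longrightarrow> cmod ((\<Prod>i<k. b i) - A) < \<epsilon>1"
    using Suc.IH[of \<epsilon>1] unfolding A_def by blast
  define \<delta> where "\<delta> = min \<delta>1 (min 1 (\<epsilon> / (2 * (cmod A + 1))))"
  have "\<delta> > 0" using \<delta>1 Suc.prems pos by (simp add: \<delta>_def)
  moreover have "cmod ((\<Prod>i<Suc k. b i) - (\<Prod>i<Suc k. a i)) < \<epsilon>"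
    if b: "\<forall>i<Suc k. cmod (b i - a i) < \<delta>" for b
  proof -
    define B where "B = (\<Prod>i<k. b i)"
    have BA: "cmod (B - A) < \<epsilon>1" unfolding B_def using b by (intro IH) (auto simp: \<delta>_def)
    have bk: "cmod (b k - a k) < 1" "cmod (b k - a k) < \<epsilon> / (2 * (cmod A + 1))"
      using b by (auto simp: \<delta>_def)
    have bk1: "cmod (b k) \<le> cmod (a k) + 1"
      using norm_triangle_ineq[of "b k - a k" "a k"] bk(1) by simp
    have "(\<Prod>i<Suc k. b i) - (\<Prod>i<Suc k. a i) = (B - A) * b k + A * (b k - a k)"
      by (simp add: A_def B_def algebra_simps)
    then have "cmod ((\<Prod>i<Suc k. b i) - (\<Prod>i<Suc k. a i)) \<le> cmod (B - A) * cmod (b k) + cmod A * cmod (b k - a k)"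
      by (metis norm_mult norm_triangle_ineq)
    also have "\<dots> \<le> cmod (B - A) * (cmod (a k) + 1) + (cmod A + 1) * cmod (b k - a k)"
      by (intro add_mono mult_left_mono mult_right_mono bk1) auto
    also have "\<dots> < \<epsilon>1 * (cmod (a k) + 1) + (cmod A + 1) * (\<epsilon> / (2 * (cmod A + 1)))"
      using BA bk(2) pos by (intro add_strict_mono mult_strict_right_mono mult_strict_left_mono)
    also have "\<dots> = \<epsilon> / 2 + \<epsilon> / 2"
      unfolding \<epsilon>1_def half[OF pos(1)] by (subst mult.commute) (simp only: half[OF pos(2)])
    finally show ?thesis by simp
  qed
  ultimately show ?case by blast
qed

lemma linear_power_homogeneous:
  assumes add: "\<And>u v. u \<in> X \<Longrightarrow> v \<in> X \<Longrightarrow> \<phi> (u + v) = \<phi> u + \<phi> v"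
    and scale: "\<And>a u. u \<in> X \<Longrightarrow> \<phi> (a *\<^sub>C u) = a * \<phi> u"
    and diff: "\<And>u v. u \<in> X \<Longrightarrow> v \<in> X \<Longrightarrow> cmod (\<phi> u - \<phi> v) \<le> N (u - v)"
  shows "homogeneous_polynomial X N k (\<lambda>x. \<phi> x ^ k)"
  unfolding homogeneous_polynomial_def
proof (intro exI[of _ "\<lambda>x. \<Prod>i<k. \<phi> (x i)"] conjI ballI)
  have upd: "(\<Prod>j<k. \<phi> ((x(i := u)) j)) = \<phi> u * (\<Prod>j\<in>{..<k} - {i}. \<phi> (x j))" if "i < k" for x i u
    using that by (subst prod.remove[of _ i]) (auto intro!: prod.cong)
  show "multilinear_on X k (\<lambda>x. \<Prod>i<k. \<phi> (x i))"
    unfolding multilinear_on_def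
  proof (intro ballI allI impI)
    fix x i u v a assume "i < k" "u \<in> X" "v \<in> X"
    then show "(\<Prod>j<k. \<phi> ((x(i := u + v)) j)) = (\<Prod>j<k. \<phi> ((x(i := u)) j)) + (\<Prod>j<k. \<phi> ((x(i := v)) j))
      \<and> (\<Prod>j<k. \<phi> ((x(i := a *\<^sub>C u)) j)) = a * (\<Prod>j<k. \<phi> ((x(i := u)) j))"
      unfolding upd[OF \<open>i < k\<close>] by (simp add: add scale algebra_simps)
  qed
  show "continuous_tuple_map X N k (\<lambda>x. \<Prod>i<k. \<phi> (x i))"
    unfolding continuous_tuple_map_def
  proof (intro ballI allI impI)
    fix x and \<epsilon> :: real assume x: "x \<in> {..<k} \<rightarrow>\<^sub>E X" and "\<epsilon> > 0"
    obtain \<delta> where \<delta>: "\<delta> > 0" "\<And>b. (\<And>i. i < k \<Longrightarrow> cmod (b i - \<phi> (x i)) < \<delta>) \<Longrightarrow>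
        cmod ((\<Prod>i<k. b i) - (\<Prod>i<k. \<phi> (x i))) < \<epsilon>"
      using prod_continuous_at[OF \<open>\<epsilon> > 0\<close>, of k "\<lambda>i. \<phi> (x i)"] by blast
    have "cmod ((\<Prod>i<k. \<phi> (y i)) - (\<Prod>i<k. \<phi> (x i))) < \<epsilon>"
      if y: "y \<in> {..<k} \<rightarrow>\<^sub>E X" "\<forall>i<k. N (y i - x i) < \<delta>" for y
    proof (rule \<delta>(2))
      fix i assume "i < k"
      then have "y i \<in> X" "x i \<in> X" using x y(1) by auto
      from diff[OF this] show "cmod (\<phi> (y i) - \<phi> (x i)) < \<delta>" using y(2) \<open>i < k\<close> by fastforce
    qed
    then show "\<exists>\<delta>>0. \<forall>y\<in>{..<k} \<rightarrow>\<^sub>E X. (\<forall>i<k. N (y i - x i) < \<delta>) \<longrightarrow>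
        cmod ((\<Prod>i<k. \<phi> (y i)) - (\<Prod>i<k. \<phi> (x i))) < \<epsilon>"
      using \<delta>(1) by blast
  qed
qed simp

section \<open>Schatten classes as Clarkson spaces, and the extremal polynomials\<close>

lemma zero_in_schatten_class:
  "(0 :: 'h::complex_hilbert_space \<Rightarrow>\<^sub>L 'h) \<in> schatten_class p"
proof -
  have lin: "complex_linear_op (0 :: 'h \<Rightarrow>\<^sub>L 'h)"
    by (simp add: complex_linear_op_def)
  have comp: "compact_op (0 :: 'h \<Rightarrow>\<^sub>L 'h)"
    by (rule compact_op_subsetI[of "{0}"]) auto
  interpret pos_form "op_form (0 :: 'h \<Rightarrow>\<^sub>L 'h)" by (rule pos_form_op_form[OF lin])
  have "spectral_form (op_form (0 :: 'h \<Rightarrow>\<^sub>L 'h)) (\<lambda>_. 0) (\<lambda>_. 0)"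
    by unfold_locales (simp_all add: op_form_def)
  from schatten_class_iff[OF lin comp this] show "(0 :: 'h \<Rightarrow>\<^sub>L 'h) \<in> schatten_class p" by simp
qed

lemma schatten_diff:
  assumes "0 < p" "p \<le> 2" "S \<in> schatten_class p" "T \<in> schatten_class p"
  shows "S - T \<in> schatten_class p"
proof -
  have "S - T = S + (- 1) *\<^sub>C T"
    by (rule blinfun_eqI)
      (simp add: blinfun.diff_left blinfun.add_left complex_vector.scale_minus_left)
  moreover have "S + (- 1) *\<^sub>C T \<in> schatten_class p"
    by (rule schatten_clarkson(1)[OF assms(1-3) schatten_scaleC(1)[OF assms(4,1)]])
  ultimately show ?thesis by (simp only:)
qed

lemma clarkson_space_schatten:
  assumes "0 < p" "p \<le> 2"
  shows "clarkson_space (schatten_class p :: ('h::complex_hilbert_space \<Rightarrow>\<^sub>L 'h) set) (schatten_norm p) p"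
proof
  fix S T :: "'h \<Rightarrow>\<^sub>L 'h" assume ST: "S \<in> schatten_class p" "T \<in> schatten_class p"
  then show "schatten_norm p (S + T) powr p + schatten_norm p (S - T) powr p
      \<le> 2 * (schatten_norm p S powr p + schatten_norm p T powr p)"
    by (intro schatten_clarkson(2)[OF assms] schatten_diff[OF assms])
  show "S + T \<in> schatten_class p" using schatten_clarkson(1)[OF assms ST] .
qed (use schatten_scaleC[OF _ assms(1)] zero_in_schatten_class schatten_norm_nonneg assms(1) in blast)+

text \<open>Continuity is the case of a single vector in \<open>schatten_diagonal_le\<close>: the
  coefficient is 1-Lipschitz for \<open>schatten_norm p\<close>.\<close>

lemma diagonal_power_homogeneous:
  fixes e :: "'h::complex_hilbert_space"
  assumes "1 \<le> p" "p \<le> 2" and e: "norm e = 1"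
  shows "homogeneous_polynomial (schatten_class p) (schatten_norm p) k
    (\<lambda>S. cinner (blinfun_apply S e) e ^ k)"
proof (rule linear_power_homogeneous)
  fix S T :: "'h \<Rightarrow>\<^sub>L 'h" assume ST: "S \<in> schatten_class p" "T \<in> schatten_class p"
  define f where "f = (\<lambda>i::nat. if i = 0 then e else 0)"
  have "cinner e e = 1" using cinner.self_eq[of e] e by simp
  moreover have "e \<noteq> 0" using e by auto
  ultimately have f: "orthofamily f" by unfold_locales (auto simp: f_def)
  have "S - T \<in> schatten_class p"
    using assms ST by (intro schatten_diff) auto
  from schatten_diagonal_le[OF this assms(1) f, of "{0}"]
  have "cmod (cinner (blinfun_apply (S - T) e) e) powr p \<le> schatten_norm p (S - T) powr p"
    by (simp add: f_def)
  then have "cmod (cinner (blinfun_apply (S - T) e) e) \<le> schatten_norm p (S - T)"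
    using assms(1) powr_less_mono2[of p "schatten_norm p (S - T)"] schatten_norm_nonneg[of p "S - T"]
    by (smt (verit))
  then show "cmod (cinner (blinfun_apply S e) e - cinner (blinfun_apply T e) e) \<le> schatten_norm p (S - T)"
    by (simp add: blinfun.diff_left cinner.diff_left)
qed (simp_all add: blinfun.add_left cinner.add_left cinner.scale_left)

lemma opt_const_sharp:
  assumes p: "1 \<le> p" "p \<le> 2" and "1 \<le> n" and k: "\<And>i. i \<in> {1..n} \<Longrightarrow> 1 \<le> k i"
    and dim: "cdim_at_least TYPE('h::complex_hilbert_space) n"
  shows "\<exists>P :: nat \<Rightarrow> ('h \<Rightarrow>\<^sub>L 'h) \<Rightarrow> complex.
    (\<forall>i\<in>{1..n}. homogeneous_polynomial (schatten_class p) (schatten_norm p) (k i) (P i)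
       \<and> 1 \<le> polynomial_norm (schatten_class p) (schatten_norm p) (P i))
     \<and> polynomial_norm (schatten_class p) (schatten_norm p) (\<lambda>S. \<Prod>i=1..n. P i S) \<le> opt_const p n k"
proof -
  obtain e :: "nat \<Rightarrow> 'h" where e: "orthofamily e" and e0: "\<forall>i. e i \<noteq> 0 \<longleftrightarrow> i < n"
    using orthonormal_family_exists[OF dim] by blast
  interpret e: orthofamily e by (rule e)
  interpret clarkson_space "schatten_class p :: ('h \<Rightarrow>\<^sub>L 'h) set" "schatten_norm p" p
    using p by (intro clarkson_space_schatten) auto
  \<comment> \<open>The polynomials are numbered from \<open>1\<close>, the orthonormal family from
    \<open>0\<close>.\<close>
  define f where "f = (\<lambda>i. e (i - 1))"
  define P where "P = (\<lambda>i S. cinner (blinfun_apply S (f i)) (f i) ^ k i)"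
  have nf: "norm (f i) = 1" if "i \<in> {1..n}" for i
    using that e0[rule_format, of "i - 1"] by (auto simp: f_def e.norm_family)
  have hom: "homogeneous_polynomial (schatten_class p) (schatten_norm p) (k i) (P i)" if "i \<in> {1..n}" for i
    unfolding P_def by (rule diagonal_power_homogeneous[OF p nf[OF that]])
  have ge1: "1 \<le> polynomial_norm (schatten_class p) (schatten_norm p) (P i)" if i: "i \<in> {1..n}" for i
  proof -
    obtain M where M: "\<And>z. z \<in> schatten_class p \<Longrightarrow> schatten_norm p z = 1 \<Longrightarrow> cmod (P i z) \<le> M"
      using hom_poly_bounded(1)[OF hom[OF i] k[OF i]] by blast
    have "cinner (f i) (f i) = 1" using nf[OF i] cinner.self_eq[of "f i"] by simp
    then have "P i (rank_one_proj (f i)) = 1" by (simp add: P_def cinner.scale_left)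
    moreover have "cmod (P i (rank_one_proj (f i))) \<le> polynomial_norm (schatten_class p) (schatten_norm p) (P i)"
      using M rank_one_proj_schatten[OF nf[OF i] p_pos] by (rule polynomial_norm_upper)
    ultimately show ?thesis by simp
  qed
  have "polynomial_norm (schatten_class p) (schatten_norm p) (\<lambda>S. \<Prod>i=1..n. P i S) \<le> opt_const p n k"
  proof (rule polynomial_norm_le)
    show "0 \<le> opt_const p n k" by (simp add: opt_const_def)
    fix S :: "'h \<Rightarrow>\<^sub>L 'h" assume S: "S \<in> schatten_class p" "schatten_norm p S = 1"
    \<comment> \<open>Nonnegative numbers with sum at most \<open>1\<close>, the input of
      \<open>weighted_amgm\<close>; the \<open>p\<close>-th root of its conclusion is the asserted
      bound.\<close>
    define u where "u = (\<lambda>i. cmod (cinner (blinfun_apply S (f i)) (f i)) powr p)"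
    have "(\<Sum>i=1..n. u i) = (\<Sum>i<n. cmod (cinner (blinfun_apply S (e i)) (e i)) powr p)"
      unfolding u_def f_def
      by (rule sum.reindex_bij_witness[of _ Suc "\<lambda>i. i - 1"]) auto
    also have "\<dots> \<le> 1"
      using schatten_diagonal_le[OF S(1) p(1) e, of "{..<n}"] S(2) by simp
    finally have "(\<Prod>i=1..n. u i ^ k i) \<le> (\<Prod>i=1..n. real (k i) ^ k i) / real (\<Sum>i=1..n. k i) ^ (\<Sum>i=1..n. k i)"
      by (intro weighted_amgm k) (auto simp: u_def)
    then have "(\<Prod>i=1..n. u i ^ k i) powr (1 / p) \<le> opt_const p n k"
      unfolding opt_const_def using p by (intro powr_mono2 prod_nonneg) (auto simp: u_def)
    moreover have "(\<Prod>i=1..n. u i ^ k i) powr (1 / p) = cmod (\<Prod>i=1..n. P i S)"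
      unfolding prod_powr_distrib prod_norm[symmetric]
    proof (rule prod.cong)
      fix i
      have "(u i ^ k i) powr (1 / p) = (u i powr (1 / p)) ^ k i"
        by (rule powr_power_commute[symmetric])
      also have "u i powr (1 / p) = cmod (cinner (blinfun_apply S (f i)) (f i))"
        using p by (simp add: u_def powr_powr)
      finally show "(u i ^ k i) powr (1 / p) = cmod (P i S)" by (simp add: P_def norm_power)
    qed simp
    ultimately show "cmod (\<Prod>i=1..n. P i S) \<le> opt_const p n k" by simp
  qed
  then show ?thesis using hom ge1 by (intro exI[of _ P] conjI ballI)
qed

theorem theorem2p3:
  fixes p :: real and n :: nat and k :: "nat \<Rightarrow> nat" and K :: nat
    and X :: "('h::complex_hilbert_space \<Rightarrow>\<^sub>L 'h) set" and N :: "('h \<Rightarrow>\<^sub>L 'h) \<Rightarrow> real"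
    and c :: real
  assumes "1 \<le> p" and "p \<le> 2" and "1 \<le> n"
    and "\<And>i. i \<in> {1..n} \<Longrightarrow> 1 \<le> k i"
    and "K = (\<Sum>i=1..n. k i)"
    and "X = schatten_class p" and "N = schatten_norm p"
    and "c = ((\<Prod>i=1..n. real (k i) ^ k i) / real K ^ K) powr (1 / p)"
  shows
    "(\<forall>P :: nat \<Rightarrow> ('h \<Rightarrow>\<^sub>L 'h) \<Rightarrow> complex.
        (\<forall>i\<in>{1..n}. homogeneous_polynomial X N (k i) (P i)) \<longrightarrow>
        polynomial_norm X N (\<lambda>x. \<Prod>i=1..n. P i x) \<ge> c * (\<Prod>i=1..n. polynomial_norm X N (P i)))
     \<and>
     (cdim_at_least TYPE('h) n \<longrightarrow>
      (\<forall>C>c. \<not> (\<forall>P :: nat \<Rightarrow> ('h \<Rightarrow>\<^sub>L 'h) \<Rightarrow> complex.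
        (\<forall>i\<in>{1..n}. homogeneous_polynomial X N (k i) (P i)) \<longrightarrow>
        polynomial_norm X N (\<lambda>x. \<Prod>i=1..n. P i x) \<ge> C * (\<Prod>i=1..n. polynomial_norm X N (P i)))))"
proof (intro conjI allI impI)
  have c: "c = opt_const p n k" unfolding assms(8) opt_const_def assms(5) ..
  fix P :: "nat \<Rightarrow> ('h \<Rightarrow>\<^sub>L 'h) \<Rightarrow> complex"
  assume P: "\<forall>i\<in>{1..n}. homogeneous_polynomial X N (k i) (P i)"
  interpret clarkson_space X N p
    unfolding assms(6,7) using assms(1,2) by (intro clarkson_space_schatten) auto
  show "c * (\<Prod>i=1..n. polynomial_norm X N (P i)) \<le> polynomial_norm X N (\<lambda>x. \<Prod>i=1..n. P i x)"
    unfolding c by (rule polynomial_norm_product[OF P[rule_format] assms(4,3)])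
next
  have c: "c = opt_const p n k" unfolding assms(8) opt_const_def assms(5) ..
  fix C assume dim: "cdim_at_least TYPE('h) n" and C: "c < C"
  obtain P :: "nat \<Rightarrow> ('h \<Rightarrow>\<^sub>L 'h) \<Rightarrow> complex" where
    P: "\<And>i. i \<in> {1..n} \<Longrightarrow> homogeneous_polynomial X N (k i) (P i)"
      "\<And>i. i \<in> {1..n} \<Longrightarrow> 1 \<le> polynomial_norm X N (P i)"
      "polynomial_norm X N (\<lambda>x. \<Prod>i=1..n. P i x) \<le> c"
    using opt_const_sharp[where p = p and n = n and k = k, OF assms(1-4) dim] unfolding c assms(6,7) by blast
  \<comment> \<open>For \<open>C > 0\<close>, factors that are at least \<open>1\<close> can only
    enlarge the left side, so the inequality with \<open>C\<close> would force
    \<open>C \<le> c\<close>.\<close>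
  have "0 < C" using C opt_const_pos[where p = p and n = n and k = k, OF assms(3,4)] c by simp
  have "C * 1 \<le> C * (\<Prod>i=1..n. polynomial_norm X N (P i))"
    using \<open>0 < C\<close> P(2) by (intro mult_left_mono prod_ge_1) auto
  then have "\<not> C * (\<Prod>i=1..n. polynomial_norm X N (P i)) \<le> polynomial_norm X N (\<lambda>x. \<Prod>i=1..n. P i x)"
    using P(3) C by linarith
  then show "\<not> (\<forall>P :: nat \<Rightarrow> ('h \<Rightarrow>\<^sub>L 'h) \<Rightarrow> complex.
        (\<forall>i\<in>{1..n}. homogeneous_polynomial X N (k i) (P i)) \<longrightarrow>
        polynomial_norm X N (\<lambda>x. \<Prod>i=1..n. P i x) \<ge> C * (\<Prod>i=1..n. polynomial_norm X N (P i)))"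
    using P(1) by (intro notI) (drule spec[of _ P], simp)
qed

end
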